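(* Let $\mathbb{G}\leqslant\mathrm{Aut}(X,\lambda)$ be an ergodic full group on a standard $\sigma$-finite space $(X,\lambda)$. The group $\mathbb{G}_f=\{T\in\mathbb{G} : \lambda(\mathrm{supp}\,T)<\infty\}$ is simple, and it is the only normal subgroup of $\mathbb{G}$ other than $\{\mathrm{id}_X\}$ and $\mathbb{G}$.
   Context: A standard $\sigma$-finite space $(X,\lambda)$ is a standard Borel space $X$ with an atomless $\sigma$-finite Borel measure $\lambda$ such that $\lambda(X)=+\infty$. $\mathrm{Aut}(X,\lambda)$ is the group of Borel bijections $T$ of $X$ with $\lambda(T(A))=\lambda(T^{-1}(A))=\lambda(A)$ for every Borel $A$, where two bijections are identified when they coincide on a conull set. The support is $\mathrm{supp}\,T=\{x\in X: T(x)\neq x\}$. A full group is a subgroup $\mathbb{G}\leqslant\mathrm{Aut}(X,\lambda)$ stable under cutting and pasting: if $T\in\mathrm{Aut}(X,\lambda)$ and there are a countable partition $(A_n)$ of $X$ and elements $T_n\in\mathbb{G}$ with $T_{\restriction A_n}=T_{n\restriction A_n}$ for all $n$, then $T\in\mathbb{G}$. It is ergodic if every Borel $A\subseteq X$ with $\lambda(T(A)\Delta A)=0$ for all $T\in\mathbb{G}$ is null or conull. *)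

theory Defs
  imports "HOL-Analysis.Analysis" "HOL-Algebra.Bij" "HOL-Algebra.Coset"
begin

section \<open>Standard \<open>\<sigma>\<close>-finite spaces\<close>

definition standard_borel_space :: "'a measure \<Rightarrow> bool" where
  "standard_borel_space M \<longleftrightarrow>
     (\<exists>\<tau>. topspace \<tau> = space M \<and> completely_metrizable_space \<tau> \<and> second_countable \<tau> \<and>
          sets M = sigma_sets (space M) {U. openin \<tau> U})"

definition atomless :: "'a measure \<Rightarrow> bool" where
  "atomless M \<longleftrightarrow>
     (\<forall>A\<in>sets M. 0 < emeasure M A \<longrightarrow>
        (\<exists>B\<in>sets M. B \<subseteq> A \<and> 0 < emeasure M B \<and> emeasure M B < emeasure M A))"

locale standard_sigma_finite_space = sigma_finite_measure M for M :: "'a measure" +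
  assumes standard_borel: "standard_borel_space M"
    and atomless: "atomless M"
    and infinite_measure: "emeasure M (space M) = \<infinity>"


section \<open>The group \<open>Aut(X, \<lambda>)\<close>\<close>

text \<open>
  As in \<^const>\<open>Bij\<close>, transformations are extensional functions, so that equality of
  representatives is pointwise equality on the underlying space.  Borel images of Borel sets
  are required explicitly, so that \<open>emeasure M (T ` A)\<close> is meaningful on any measure space;
  on a standard Borel space this is automatic.
\<close>

definition mp_bijections :: "'a measure \<Rightarrow> ('a \<Rightarrow> 'a) set" where
  "mp_bijections M =
     {T \<in> Bij (space M). T \<in> measurable M M \<and>
        (\<forall>A\<in>sets M. T ` A \<in> sets M \<and> emeasure M (T ` A) = emeasure M A \<and>
                    emeasure M (T -` A \<inter> space M) = emeasure M A)}"

definition mp_group :: "'a measure \<Rightarrow> ('a \<Rightarrow> 'a) monoid" where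
  "mp_group M = (BijGroup (space M))\<lparr>carrier := mp_bijections M\<rparr>"

definition ae_id :: "'a measure \<Rightarrow> ('a \<Rightarrow> 'a) set" where
  "ae_id M = {T \<in> mp_bijections M. AE x in M. T x = x}"

text \<open>
  Identifying transformations that coincide on a conull set amounts to dividing by the normal
  subgroup of those that coincide with the identity on a conull set; see \<open>rcoset_ae_id\<close> below.
  An element of \<open>Aut M\<close> is thus a class (a set) of transformations.
\<close>

definition Aut :: "'a measure \<Rightarrow> ('a \<Rightarrow> 'a) set monoid" where
  "Aut M = mp_group M Mod ae_id M"

lemma mp_bijectionsD:
  assumes "T \<in> mp_bijections M"
  shows "T \<in> Bij (space M)" "bij_betw T (space M) (space M)" "T \<in> measurable M M"
    "\<And>x. x \<in> space M \<Longrightarrow> T x \<in> space M"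
    "\<And>A. A \<in> sets M \<Longrightarrow> T ` A \<in> sets M"
    "\<And>A. A \<in> sets M \<Longrightarrow> emeasure M (T ` A) = emeasure M A"
    "\<And>A. A \<in> sets M \<Longrightarrow> emeasure M (T -` A \<inter> space M) = emeasure M A"
  using assms by (auto simp: mp_bijections_def Bij_def bij_betw_def)

lemma mp_group_simps:
  "carrier (mp_group M) = mp_bijections M"
  "\<one>\<^bsub>mp_group M\<^esub> = (\<lambda>x\<in>space M. x)"
  "S \<in> mp_bijections M \<Longrightarrow> T \<in> mp_bijections M \<Longrightarrow> S \<otimes>\<^bsub>mp_group M\<^esub> T = compose (space M) S T"
  by (auto simp: mp_group_def BijGroup_def mp_bijectionsD(1))

lemma compose_mp_bijections:
  assumes S: "S \<in> mp_bijections M" and T: "T \<in> mp_bijections M"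
  shows "compose (space M) S T \<in> mp_bijections M"
proof -
  have "compose (space M) S T \<in> measurable M M"
    using measurable_comp[OF mp_bijectionsD(3)[OF T] mp_bijectionsD(3)[OF S]]
    by (subst measurable_cong[where g = "S \<circ> T"]) (auto simp: compose_def)
  moreover have "compose (space M) S T ` A = S ` T ` A" if "A \<in> sets M" for A
    using sets.sets_into_space[OF that] by (auto simp: compose_def image_iff)
  moreover have "compose (space M) S T -` A \<inter> space M = T -` (S -` A \<inter> space M) \<inter> space M" for A
    using mp_bijectionsD(4)[OF T] by (auto simp: compose_def)
  moreover have "emeasure M (T -` (S -` A \<inter> space M) \<inter> space M) = emeasure M A" if "A \<in> sets M" for A
    using mp_bijectionsD(7)[OF T measurable_sets[OF mp_bijectionsD(3)[OF S] that]]
      mp_bijectionsD(7)[OF S that] by simp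
  ultimately show ?thesis
    using mp_bijectionsD(1,5,6)[OF S] mp_bijectionsD(1,5,6)[OF T]
    by (simp add: mp_bijections_def compose_Bij)
qed

lemma inv_mp_bijections:
  assumes T: "T \<in> mp_bijections M"
  shows "(\<lambda>x\<in>space M. inv_into (space M) T x) \<in> mp_bijections M"
proof -
  let ?S = "\<lambda>x\<in>space M. inv_into (space M) T x"
  have b: "inj_on T (space M)" "T ` space M = space M"
    using mp_bijectionsD(2)[OF T] by (auto simp: bij_betw_def)
  have vim: "?S -` A \<inter> space M = T ` A" if "A \<in> sets M" for A
  proof -
    have A: "A \<subseteq> space M" using sets.sets_into_space[OF that] .
    show ?thesis
    proof (rule subset_antisym; rule subsetI)
      fix x assume "x \<in> ?S -` A \<inter> space M"
      then show "x \<in> T ` A"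
        using b(2) f_inv_into_f[of x T "space M"] by (intro image_eqI[where x = "?S x"]) (simp_all split: if_splits)
    next
      fix x assume "x \<in> T ` A"
      then show "x \<in> ?S -` A \<inter> space M"
        using A mp_bijectionsD(4)[OF T] by (auto simp: inv_into_f_f[OF b(1)] subset_iff)
    qed
  qed
  have im: "?S ` A = T -` A \<inter> space M" if "A \<in> sets M" for A
  proof -
    have A: "A \<subseteq> space M" using sets.sets_into_space[OF that] .
    show ?thesis
    proof (rule subset_antisym; rule subsetI)
      fix x assume "x \<in> ?S ` A"
      then obtain y where y: "y \<in> A" "x = ?S y" by blast
      then have y': "y \<in> space M" "y \<in> T ` space M" using A b(2) by auto
      then show "x \<in> T -` A \<inter> space M"
        using y inv_into_into[OF y'(2)] f_inv_into_f[OF y'(2)] by simp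
    next
      fix x assume "x \<in> T -` A \<inter> space M"
      then show "x \<in> ?S ` A"
        using mp_bijectionsD(4)[OF T]
        by (intro image_eqI[where x = "T x"]) (simp_all add: inv_into_f_f[OF b(1)])
    qed
  qed
  have "?S \<in> space M \<rightarrow> space M"
    using inv_into_into[of _ T "space M"] b(2) by simp
  then have "?S \<in> measurable M M"
    using mp_bijectionsD(5)[OF T] vim by (simp add: measurable_def)
  then show ?thesis
    using T vim im measurable_sets[OF mp_bijectionsD(3)[OF T]]
    by (auto simp: mp_bijections_def intro: restrict_inv_into_Bij)
qed

lemma subgroup_mp_bijections: "subgroup (mp_bijections M) (BijGroup (space M))"
proof (rule subgroup.intro)
  show "mp_bijections M \<subseteq> carrier (BijGroup (space M))"
    by (auto simp: mp_bijections_def BijGroup_def)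
  show "S \<otimes>\<^bsub>BijGroup (space M)\<^esub> T \<in> mp_bijections M"
    if "S \<in> mp_bijections M" "T \<in> mp_bijections M" for S T
    using that compose_mp_bijections by (auto simp: BijGroup_def mp_bijectionsD(1))
  have eq: "(\<lambda>x\<in>space M. x) ` A = A" "(\<lambda>x\<in>space M. x) -` A \<inter> space M = A" if "A \<in> sets M" for A
    using sets.sets_into_space[OF that] by auto
  show "\<one>\<^bsub>BijGroup (space M)\<^esub> \<in> mp_bijections M"
    using eq by (auto simp: BijGroup_def mp_bijections_def id_Bij intro!: measurableI)
  show "inv\<^bsub>BijGroup (space M)\<^esub> T \<in> mp_bijections M" if "T \<in> mp_bijections M" for T
    using that inv_mp_bijections by (simp add: inv_BijGroup mp_bijectionsD(1))
qed

lemma group_mp_group: "group (mp_group M)"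
  unfolding mp_group_def
  by (rule subgroup.subgroup_is_group[OF subgroup_mp_bijections group_BijGroup])

lemma inv_mp_group:
  "T \<in> mp_bijections M \<Longrightarrow> inv\<^bsub>mp_group M\<^esub> T = (\<lambda>x\<in>space M. inv_into (space M) T x)"
  unfolding mp_group_def
  using group.m_inv_consistent[OF group_BijGroup subgroup_mp_bijections]
  by (metis inv_BijGroup mp_bijectionsD(1))

lemma AE_mp_bijection:
  assumes T: "T \<in> mp_bijections M" and P: "AE x in M. P x"
  shows "AE x in M. P (T x)"
proof -
  from P obtain N where N: "N \<in> null_sets M" "{x \<in> space M. \<not> P x} \<subseteq> N"
    by (auto elim!: AE_E)
  have "T -` N \<inter> space M \<in> null_sets M"
    using N(1) mp_bijectionsD(3,7)[OF T] by (auto simp: null_sets_def)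
  then show ?thesis
    by (rule AE_I') (use N(2) mp_bijectionsD(4)[OF T] in auto)
qed

lemma normal_ae_id: "ae_id M \<lhd> mp_group M"
proof -
  interpret group "mp_group M" by (rule group_mp_group)
  have inv_T: "inv_into (space M) T (T x) = x" "T (inv_into (space M) T x) = x"
    if "T \<in> mp_bijections M" "x \<in> space M" for T x
    using mp_bijectionsD(2)[OF that(1)] that(2)
    by (auto simp: bij_betw_def inv_into_f_f f_inv_into_f)
  show ?thesis
  proof (rule normal_invI)
    show "subgroup (ae_id M) (mp_group M)"
    proof (rule subgroupI)
      show "ae_id M \<subseteq> carrier (mp_group M)" by (auto simp: ae_id_def mp_group_simps)
      have "\<one>\<^bsub>mp_group M\<^esub> \<in> ae_id M"
        using one_closed by (auto simp: ae_id_def mp_group_simps)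
      then show "ae_id M \<noteq> {}" by blast
    next
      fix T assume "T \<in> ae_id M"
      then have T: "T \<in> mp_bijections M" and ae: "AE x in M. T x = x" by (auto simp: ae_id_def)
      have "AE x in M. (inv\<^bsub>mp_group M\<^esub> T) x = x"
        using ae AE_space by eventually_elim (use inv_T(1)[OF T] in \<open>auto simp: inv_mp_group[OF T], metis\<close>)
      then show "inv\<^bsub>mp_group M\<^esub> T \<in> ae_id M"
        using inv_closed[of T] T by (auto simp: ae_id_def mp_group_simps)
    next
      fix S T assume "S \<in> ae_id M" "T \<in> ae_id M"
      then have ST: "S \<in> mp_bijections M" "T \<in> mp_bijections M"
        and ae: "AE x in M. S x = x" "AE x in M. T x = x" by (auto simp: ae_id_def)
      have "AE x in M. compose (space M) S T x = x"
        using ae AE_space by eventually_elim (auto simp: compose_def)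
      then show "S \<otimes>\<^bsub>mp_group M\<^esub> T \<in> ae_id M"
        using compose_mp_bijections[OF ST] ST by (auto simp: ae_id_def mp_group_simps)
    qed
  next
    fix T S assume "T \<in> carrier (mp_group M)" "S \<in> ae_id M"
    then have T: "T \<in> mp_bijections M" and S: "S \<in> mp_bijections M" and ae: "AE x in M. S x = x"
      by (auto simp: ae_id_def mp_group_simps)
    let ?U = "\<lambda>x\<in>space M. inv_into (space M) T x"
    have U: "?U \<in> mp_bijections M" by (rule inv_mp_bijections[OF T])
    have "AE x in M. compose (space M) (compose (space M) T S) ?U x = x"
      using AE_mp_bijection[OF U ae] AE_space
      by eventually_elim (use inv_T(2)[OF T] mp_bijectionsD(4)[OF U] in \<open>auto simp: compose_def\<close>)
    then show "T \<otimes>\<^bsub>mp_group M\<^esub> S \<otimes>\<^bsub>mp_group M\<^esub> inv\<^bsub>mp_group M\<^esub> T \<in> ae_id M"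
      using T S U compose_mp_bijections[OF T S] compose_mp_bijections[OF compose_mp_bijections[OF T S] U]
      by (simp add: ae_id_def mp_group_simps inv_mp_group)
  qed
qed

lemma rcoset_ae_id:
  assumes T: "T \<in> mp_bijections M"
  shows "ae_id M #>\<^bsub>mp_group M\<^esub> T = {S \<in> mp_bijections M. AE x in M. S x = T x}"
proof -
  interpret group "mp_group M" by (rule group_mp_group)
  have inv_T: "inv_into (space M) T (T x) = x" "T (inv_into (space M) T x) = x"
    if "x \<in> space M" for x
    using mp_bijectionsD(2)[OF T] that
    by (auto simp: bij_betw_def inv_into_f_f f_inv_into_f)
  show ?thesis
  proof (rule subset_antisym; rule subsetI)
    fix S assume "S \<in> ae_id M #>\<^bsub>mp_group M\<^esub> T"
    then obtain R where R: "R \<in> mp_bijections M" "AE x in M. R x = x" and S: "S = compose (space M) R T"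
      using T by (auto simp: r_coset_def ae_id_def mp_group_simps)
    have "AE x in M. S x = T x"
      using AE_mp_bijection[OF T R(2)] AE_space by eventually_elim (auto simp: S compose_def)
    then show "S \<in> {S \<in> mp_bijections M. AE x in M. S x = T x}"
      using S compose_mp_bijections[OF R(1) T] by auto
  next
    fix S assume "S \<in> {S \<in> mp_bijections M. AE x in M. S x = T x}"
    then have S: "S \<in> mp_bijections M" and ae: "AE x in M. S x = T x" by auto
    let ?U = "\<lambda>x\<in>space M. inv_into (space M) T x"
    let ?R = "compose (space M) S ?U"
    have U: "?U \<in> mp_bijections M" by (rule inv_mp_bijections[OF T])
    have "AE x in M. ?R x = x"
      using AE_mp_bijection[OF U ae] AE_space
      by eventually_elim (use inv_T(2) in \<open>auto simp: compose_def\<close>)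
    then have R: "?R \<in> ae_id M"
      using compose_mp_bijections[OF S U] by (auto simp: ae_id_def)
    have "?R = S \<otimes>\<^bsub>mp_group M\<^esub> inv\<^bsub>mp_group M\<^esub> T"
      using S U T by (simp add: mp_group_simps inv_mp_group)
    then have "S = ?R \<otimes>\<^bsub>mp_group M\<^esub> T"
      using S T m_assoc[of S "inv\<^bsub>mp_group M\<^esub> T" T] l_inv[of T] inv_closed[of T] r_one[of S]
      unfolding mp_group_simps(1) by simp
    then show "S \<in> ae_id M #>\<^bsub>mp_group M\<^esub> T"
      using R by (auto simp: r_coset_def)
  qed
qed

lemma carrier_Aut:
  "carrier (Aut M) = {{S \<in> mp_bijections M. AE x in M. S x = T x} | T. T \<in> mp_bijections M}"
  by (auto simp: Aut_def FactGroup_def RCOSETS_def mp_group_simps rcoset_ae_id)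

lemma group_Aut: "group (Aut M)"
  unfolding Aut_def by (rule normal.factorgroup_is_group[OF normal_ae_id])


section \<open>Full groups\<close>

text \<open>
  All conditions on classes below are invariant under changing representatives on null sets, and
  classes are nonempty, so quantifying over all representatives is the same as choosing one.
  A countable partition may have empty pieces, which covers finite partitions.
\<close>

definition full_group :: "'a measure \<Rightarrow> ('a \<Rightarrow> 'a) set set \<Rightarrow> bool" where
  "full_group M G \<longleftrightarrow>
     subgroup G (Aut M) \<and>
     (\<forall>t\<in>carrier (Aut M). \<forall>A :: nat \<Rightarrow> 'a set. \<forall>s.
        range A \<subseteq> sets M \<and> disjoint_family A \<and> (\<Union>n. A n) = space M \<and>
        (\<forall>n. s n \<in> G \<and> (\<forall>T\<in>t. \<forall>S\<in>s n. AE x\<in>A n in M. T x = S x))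
        \<longrightarrow> t \<in> G)"

definition ergodic :: "'a measure \<Rightarrow> ('a \<Rightarrow> 'a) set set \<Rightarrow> bool" where
  "ergodic M G \<longleftrightarrow>
     (\<forall>A\<in>sets M. (\<forall>t\<in>G. \<forall>T\<in>t. emeasure M (sym_diff (T ` A) A) = 0) \<longrightarrow>
        emeasure M A = 0 \<or> emeasure M (space M - A) = 0)"

definition supp :: "'a measure \<Rightarrow> ('a \<Rightarrow> 'a) \<Rightarrow> 'a set" where
  "supp M T = {x \<in> space M. T x \<noteq> x}"

definition finite_supp_part :: "'a measure \<Rightarrow> ('a \<Rightarrow> 'a) set set \<Rightarrow> ('a \<Rightarrow> 'a) set set" where
  "finite_supp_part M G = {t \<in> G. \<forall>T\<in>t. emeasure M (supp M T) < \<infinity>}"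


section \<open>Simple groups\<close>

text \<open>
  The predicate \<open>simple_group\<close> of HOL-Algebra demands \<open>order G > 1\<close>, where the order of an
  infinite group is \<open>0\<close>, so it excludes all infinite groups.
\<close>

definition simple_grp :: "('a, 'b) monoid_scheme \<Rightarrow> bool" where
  "simple_grp G \<longleftrightarrow>
     group G \<and> carrier G \<noteq> {\<one>\<^bsub>G\<^esub>} \<and> (\<forall>H. H \<lhd> G \<longrightarrow> H = {\<one>\<^bsub>G\<^esub>} \<or> H = carrier G)"

end

theory Submission
  imports Defs
begin

text \<open>
  Let \<open>\<Gamma>\<close> be the group of representatives of \<open>G\<close> and let \<open>N\<close> be nontrivial and invariant under
  conjugation by the elements of finite support.  Ergodicity and an exhaustion argument embed, up
  to a null set, any set into any other set of at least the same measure by a map that is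
  countably piecewise in \<open>\<Gamma>\<close>.  If \<open>f\<close> is such a map on \<open>C\<close> and \<open>f ` C\<close> is disjoint from \<open>C\<close>, the
  involution exchanging \<open>C\<close> and \<open>f ` C\<close> (a flip) lies in \<open>\<Gamma>\<close>.

  Some \<open>g \<in> N\<close> moves a set \<open>A\<close> of positive measure off itself, and then \<open>N\<close> contains the commutators
  of elements supported in \<open>A\<close>.  A flip is such a commutator up to conjugation and cutting into
  small pieces, so \<open>N\<close> contains all flips of finite support.

  For \<open>T\<close> of finite support in \<open>X\<^sub>0\<close>, choose a decreasing sequence of sets \<open>X\<^sub>n\<close> of measure
  \<open>(2/3)\<^sup>n |X\<^sub>0|\<close> and write \<open>T\<^sub>0 = T\<close>, \<open>T\<^sub>n = S\<^sub>n T\<^sub>n\<^sub>+\<^sub>1\<close> with \<open>S\<^sub>n\<close> a product of two flips inside \<open>X\<^sub>n\<close> and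
  \<open>T\<^sub>n\<close> supported in \<open>X\<^sub>n\<close>.  Copy the \<open>X\<^sub>n\<close> to disjoint sets of finite total measure and let \<open>P\<close>, \<open>S\<close>
  and \<open>Q\<close> act on the \<open>n\<close>-th copy as \<open>T\<^sub>n\<close>, \<open>S\<^sub>n\<close> and \<open>T\<^sub>n\<^sub>+\<^sub>1\<close>.  Then \<open>P = S Q\<close>, and \<open>Q\<close> shifted by one copy,
  which is \<open>V Q V\<^sup>-\<^sup>1\<close> for a product \<open>V\<close> of two flips, differs from \<open>P\<close> exactly by the copy of \<open>T\<^sub>0\<close>.
  Hence a conjugate of \<open>T\<close> is \<open>S (Q V Q\<^sup>-\<^sup>1) V\<^sup>-\<^sup>1 \<in> N\<close>.

  If \<open>N\<close> is normal in \<open>\<Gamma>\<close> and \<open>g\<close> has infinite support, then \<open>A\<close> has infinite measure and the same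
  shift with all \<open>T\<^sub>n\<close> equal exhibits every \<open>T\<close> whose support has a complement of infinite measure
  as a conjugate of a commutator of elements supported in \<open>A\<close>.  These \<open>T\<close> generate \<open>\<Gamma>\<close>.
\<close>

section \<open>Maximal elements and subsets of prescribed measure\<close>

text \<open>
  An ordering principle in the style of Brezis and Browder, used in place of explicit greedy
  exhaustions.
\<close>

lemma (in sigma_finite_measure) ae_maximal:
  fixes S :: "'b set" and m :: "'b \<Rightarrow> 'a set"
  assumes x0: "x0 \<in> S"
    and meas: "\<And>x. x \<in> S \<Longrightarrow> m x \<in> sets M"
    and refl: "\<And>x. x \<in> S \<Longrightarrow> below x x"
    and trans: "\<And>x y z. below x y \<Longrightarrow> below y z \<Longrightarrow> below x z"
    and mono: "\<And>x y. x \<in> S \<Longrightarrow> y \<in> S \<Longrightarrow> below x y \<Longrightarrow> m x \<subseteq> m y"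
    and chain: "\<And>s :: nat \<Rightarrow> 'b. (\<And>n. s n \<in> S) \<Longrightarrow> (\<And>n. below (s n) (s (Suc n))) \<Longrightarrow> \<exists>u\<in>S. \<forall>n. below (s n) u"
  shows "\<exists>x\<in>S. below x0 x \<and> (\<forall>y\<in>S. below x y \<longrightarrow> emeasure M (m y - m x) = 0)"
proof -
  \<comment> \<open>A strictly positive integrable density gives a finite measure with the same null
    sets, so that the gains along a chain are bounded real numbers even where
    \<open>emeasure M\<close> is infinite.\<close>
  obtain h where h: "h \<in> borel_measurable M" "integral\<^sup>N M h \<noteq> \<infinity>"
    "\<And>x. x \<in> space M \<Longrightarrow> 0 < h x \<and> h x < \<infinity>"
    using Ex_finite_integrable_function by blast
  have "emeasure (density M h) (space M) = (\<integral>\<^sup>+x. h x * indicator (space M) x \<partial>M)"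
    using h(1) by (simp add: emeasure_density)
  also have "\<dots> = integral\<^sup>N M h" by (intro nn_integral_cong) simp
  finally interpret T: finite_measure "density M h"
    using h(2) by (intro finite_measureI) simp
  define \<nu> where "\<nu> x = measure (density M h) (m x)" for x
  have mono': "\<nu> x \<le> \<nu> y" if "x \<in> S" "y \<in> S" "below x y" for x y
    unfolding \<nu>_def using mono[OF that] meas[OF that(2)] by (intro T.finite_measure_mono) auto
  have bdd: "bdd_above (\<nu> ` X)" for X
    by (rule bdd_aboveI[of _ "measure (density M h) (space (density M h))"])
      (auto simp: \<nu>_def simp del: space_density intro: T.bounded_measure)
  have step: "\<exists>z\<in>S. below x z \<and> (\<forall>y\<in>S. below x y \<longrightarrow> \<nu> y \<le> \<nu> z + e)" if "x \<in> S" "0 < e" for x e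
  proof -
    let ?X = "\<nu> ` {y \<in> S. below x y}"
    have "?X \<noteq> {}" using refl[OF that(1)] that(1) by blast
    moreover have "Sup ?X - e < Sup ?X" using that by simp
    ultimately have "\<exists>w\<in>?X. Sup ?X - e < w" by (rule less_cSupD)
    then obtain w where w: "w \<in> ?X" "Sup ?X - e < w" by (rule bexE)
    then obtain z where z: "z \<in> S" "below x z" "w = \<nu> z" by blast
    have "\<nu> y \<le> \<nu> z + e" if "y \<in> S" "below x y" for y
      using cSup_upper[OF _ bdd, of "\<nu> y" "{y \<in> S. below x y}"] that w(2) z(3) by auto
    then show ?thesis using z by blast
  qed
  \<comment> \<open>Each successor comes within \<open>1 / Suc n\<close> of the supremum of \<nu>
    over the elements above its predecessor. An element above an upper bound \<open>u\<close> of the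
    chain lies above every \<open>s n\<close>, hence can gain nothing over \<open>u\<close>.\<close>
  have "\<exists>s. \<forall>n. (s n \<in> S \<and> below x0 (s n)) \<and>
      (below (s n) (s (Suc n)) \<and> (\<forall>y\<in>S. below (s n) y \<longrightarrow> \<nu> y \<le> \<nu> (s (Suc n)) + 1 / Suc n))"
  proof (rule dependent_nat_choice)
    show "\<exists>x. x \<in> S \<and> below x0 x" using x0 refl by blast
    fix x and n :: nat assume x: "x \<in> S \<and> below x0 x"
    then obtain z where "z \<in> S" "below x z" "\<forall>y\<in>S. below x y \<longrightarrow> \<nu> y \<le> \<nu> z + 1 / Suc n"
      using step[of x "1 / Suc n"] by auto
    then show "\<exists>z. (z \<in> S \<and> below x0 z) \<and> (below x z \<and> (\<forall>y\<in>S. below x y \<longrightarrow> \<nu> y \<le> \<nu> z + 1 / Suc n))"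
      using x trans by blast
  qed
  then obtain s where s0: "\<forall>n. (s n \<in> S \<and> below x0 (s n)) \<and>
      (below (s n) (s (Suc n)) \<and> (\<forall>y\<in>S. below (s n) y \<longrightarrow> \<nu> y \<le> \<nu> (s (Suc n)) + 1 / Suc n))"
    by (rule exE)
  have s: "\<And>n. s n \<in> S" "\<And>n. below x0 (s n)" "\<And>n. below (s n) (s (Suc n))"
    "\<And>n y. y \<in> S \<Longrightarrow> below (s n) y \<Longrightarrow> \<nu> y \<le> \<nu> (s (Suc n)) + 1 / Suc n" using s0 by blast+
  obtain u where u: "u \<in> S" "\<And>n. below (s n) u" using chain[of s, OF s(1) s(3)] by blast
  have "emeasure M (m y - m u) = 0" if y: "y \<in> S" "below u y" for y
  proof -
    have "\<nu> y \<le> \<nu> u + 1 / Suc n" for n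
      using s(4)[OF y(1), of n] trans[OF u(2) y(2)] mono'[OF s(1) u(1) u(2), of "Suc n"] by fastforce
    moreover have "(\<lambda>n. \<nu> u + 1 / Suc n) \<longlonglongrightarrow> \<nu> u + 0"
      using LIMSEQ_inverse_real_of_nat by (intro tendsto_intros) (simp add: inverse_eq_divide)
    ultimately have "\<nu> y \<le> \<nu> u + 0" by (intro LIMSEQ_le_const) auto
    then have "measure (density M h) (m y - m u) = 0"
      using mono'[OF u(1) y] mono[OF u(1) y] meas y(1) u(1)
      by (subst T.finite_measure_Diff) (auto simp: \<nu>_def)
    then have "emeasure (density M h) (m y - m u) = 0" by (simp add: T.emeasure_eq_measure)
    then have "m y - m u \<in> null_sets (density M h)"
      using meas y(1) u(1) by (auto simp: null_sets_def)
    then have "AE x in M. x \<in> m y - m u \<longrightarrow> h x = 0"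
      using h(1) by (subst (asm) null_sets_density_iff) auto
    then have "AE x in M. x \<notin> m y - m u"
      using AE_space by eventually_elim (use h(3) in force)
    then show ?thesis
      using meas y(1) u(1) AE_iff_null_sets[of "m y - m u" M] by (auto simp: null_sets_def)
  qed
  moreover have "below x0 u" using trans[OF s(2) u(2)] .
  ultimately show ?thesis using u(1) by blast
qed

section \<open>Separating sequences and Borel sets of prescribed measure\<close>

context standard_sigma_finite_space
begin

text \<open>A countable base of the Hausdorff topology does it. Such a sequence makes
  \<open>T x \<noteq> x\<close> a countable condition: it holds exactly when some \<open>U n\<close>
  contains \<open>x\<close> but not \<open>T x\<close>.\<close>

lemma ex_separating_sets:
  obtains U :: "nat \<Rightarrow> 'a set" where "\<And>n. U n \<in> sets M"
    "\<And>x y. x \<in> space M \<Longrightarrow> y \<in> space M \<Longrightarrow> x \<noteq> y \<Longrightarrow> \<exists>n. x \<in> U n \<and> y \<notin> U n"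
proof -
  obtain \<tau> where \<tau>: "topspace \<tau> = space M" "completely_metrizable_space \<tau>" "second_countable \<tau>"
    "sets M = sigma_sets (space M) {U. openin \<tau> U}"
    using standard_borel unfolding standard_borel_space_def by blast
  obtain \<B> where B: "countable \<B>" "\<And>V. V \<in> \<B> \<Longrightarrow> openin \<tau> V"
    "\<And>U x. openin \<tau> U \<Longrightarrow> x \<in> U \<Longrightarrow> \<exists>V\<in>\<B>. x \<in> V \<and> V \<subseteq> U"
    using \<tau>(3) unfolding second_countable_def by metis
  define U where "U = from_nat_into (insert {} \<B>)"
  have rU: "range U = insert {} \<B>" unfolding U_def using B(1) by (intro range_from_nat_into) auto
  show ?thesis
  proof
    fix n
    have "openin \<tau> (U n)" using rU B(2) by (metis insert_iff openin_empty rangeI)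
    then show "U n \<in> sets M" using \<tau>(4) by (auto intro: sigma_sets.Basic)
  next
    fix x y assume xy: "x \<in> space M" "y \<in> space M" "x \<noteq> y"
    have "Hausdorff_space \<tau>"
      using \<tau>(2) by (simp add: completely_metrizable_imp_metrizable_space metrizable_imp_Hausdorff_space)
    then have "\<exists>V W. openin \<tau> V \<and> openin \<tau> W \<and> x \<in> V \<and> y \<in> W \<and> disjnt V W"
      using xy by (simp add: Hausdorff_space_def \<tau>(1))
    then obtain V W where "openin \<tau> V" "openin \<tau> W" "x \<in> V" "y \<in> W" "disjnt V W" by blast
    then obtain V' where "V' \<in> \<B>" "x \<in> V'" "V' \<subseteq> V" using B(3) by blast
    then show "\<exists>n. x \<in> U n \<and> y \<notin> U n"
    proof -
      have "V' \<in> range U" using rU \<open>V' \<in> \<B>\<close> by simp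
      then obtain n where "V' = U n" by (rule rangeE)
      moreover have "y \<notin> V'" using \<open>y \<in> W\<close> \<open>disjnt V W\<close> \<open>V' \<subseteq> V\<close> by (auto simp: disjnt_iff)
      ultimately show ?thesis using \<open>x \<in> V'\<close> by blast
    qed
  qed
qed

lemma ex_finite_subset:
  assumes "A \<in> sets M" "0 < emeasure M A"
  obtains B where "B \<in> sets M" "B \<subseteq> A" "0 < emeasure M B" "emeasure M B < \<infinity>"
proof (cases "emeasure M A = \<infinity>")
  case True
  then obtain Z where "Z \<in> sets M" "Z \<subseteq> A" "emeasure M Z < \<infinity>" "ennreal 0 < emeasure M Z"
    by (rule approx_PInf_emeasure_with_finite[OF assms(1) _, of 0])
  then show ?thesis by (intro that[of Z]) simp_all
next
  case False
  then show ?thesis using assms that[of A] by (auto simp: top.not_eq_extremum)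
qed

text \<open>Atomlessness only promises a part \<open>C\<close> of \<open>B\<close> of strictly
  smaller positive measure, but then one of \<open>C\<close> and \<open>B - C\<close> has at most
  half the measure of \<open>B\<close>. Iterated halving goes below any positive
  \<open>e\<close>.\<close>

lemma ex_small_subset:
  assumes A: "A \<in> sets M" "0 < emeasure M A" and e: "0 < e"
  obtains B where "B \<in> sets M" "B \<subseteq> A" "0 < emeasure M B" "emeasure M B < \<infinity>" "emeasure M B \<le> e"
proof -
  obtain A0 where A0: "A0 \<in> sets M" "A0 \<subseteq> A" "0 < emeasure M A0" "emeasure M A0 < \<infinity>"
    using ex_finite_subset[OF A] .
  define a where "a = measure M A0"
  have a1: "emeasure M A0 = ennreal a"
    using A0(4) by (simp add: a_def emeasure_eq_ennreal_measure less_top)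
  then have a: "emeasure M A0 = ennreal a" "a > 0" using A0(3) by simp_all
  have "\<exists>B\<in>sets M. B \<subseteq> A0 \<and> 0 < emeasure M B \<and> emeasure M B \<le> ennreal (a / 2 ^ n)" for n
  proof (induction n)
    case 0 then show ?case using A0 a by auto
  next
    case (Suc n)
    then obtain B where B: "B \<in> sets M" "B \<subseteq> A0" "0 < emeasure M B" "emeasure M B \<le> ennreal (a / 2 ^ n)" by blast
    then obtain C where C: "C \<in> sets M" "C \<subseteq> B" "0 < emeasure M C" "emeasure M C < emeasure M B"
      using atomless unfolding atomless_def by blast
    have fin: "emeasure M B < \<infinity>" using B(4) by (simp add: le_less_trans)
    have "emeasure M B = emeasure M C + emeasure M (B - C)"
      using B C by (subst plus_emeasure) (auto simp: Un_absorb1)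
    moreover have "emeasure M C < \<infinity>" using C(4) fin by simp
    moreover have "emeasure M (B - C) < \<infinity>"
      using fin by (meson B(1) Diff_subset emeasure_mono le_less_trans)
    ultimately have eq: "measure M B = measure M C + measure M (B - C)" and
      mC: "emeasure M C = measure M C" "emeasure M (B - C) = measure M (B - C)" "emeasure M B = measure M B"
      using fin by (auto simp: measure_def enn2real_plus less_top)
    have "measure M B \<le> a / 2 ^ n" using B(4) mC(3) a(2) by (simp add: ennreal_le_iff)
    then have "measure M C \<le> a / 2 ^ Suc n \<or> measure M (B - C) \<le> a / 2 ^ Suc n"
      using eq by (auto simp: field_simps)
    moreover have "0 < emeasure M (B - C)"
      using C(4) eq mC by (auto simp: ennreal_less_iff)
    ultimately show ?case
      using B C mC by (metis Diff_subset ennreal_leI order_trans sets.Diff)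
  qed
  moreover obtain n where "ennreal (a / 2 ^ n) \<le> e"
  proof -
    obtain d where d: "d > 0" "ennreal d \<le> e"
      using e by (cases e) (auto intro: that[of 1])
    obtain n where "(1/2) ^ n < d / a" using real_arch_pow_inv[of "d/a" "1/2"] d a by auto
    then have "a / 2 ^ n \<le> d" using a by (auto simp: field_simps power_divide)
    then show ?thesis using d that by (meson ennreal_leI order_trans)
  qed
  ultimately obtain B where "B\<in>sets M" "B \<subseteq> A0" "0 < emeasure M B" "emeasure M B \<le> e"
    by (meson order_trans)
  then show ?thesis
    using that A0 by (meson emeasure_mono le_less_trans order_trans)
qed

text \<open>Sierpinski's theorem. A subset of measure at most \<open>c\<close> that is maximal up to
  null sets has measure exactly \<open>c\<close>, since otherwise a small part of
  \<open>A - B\<close> could still be added.\<close>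

lemma ex_subset_emeasure:
  assumes A: "A \<in> sets M" and c: "c \<le> emeasure M A" "c < \<infinity>"
  obtains B where "B \<in> sets M" "B \<subseteq> A" "emeasure M B = c"
proof -
  let ?S = "{B \<in> sets M. B \<subseteq> A \<and> emeasure M B \<le> c}"
  have "\<exists>B\<in>?S. {} \<subseteq> B \<and> (\<forall>C\<in>?S. B \<subseteq> C \<longrightarrow> emeasure M (C - B) = 0)"
  proof (rule ae_maximal[where m = "\<lambda>B. B"])
    fix s :: "nat \<Rightarrow> 'a set"
    assume s: "\<And>n. s n \<in> ?S" "\<And>n. s n \<subseteq> s (Suc n)"
    have "emeasure M (\<Union>n. s n) = (SUP n. emeasure M (s n))"
      using s by (intro SUP_emeasure_incseq[symmetric]) (auto simp: incseq_Suc_iff)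
    also have "\<dots> \<le> c" using s(1) by (intro SUP_least) auto
    finally have "(\<Union>n. s n) \<in> ?S" using s(1) by auto
    then show "\<exists>u\<in>?S. \<forall>n. s n \<subseteq> u" by (rule bexI[rotated]) auto
  qed auto
  then obtain B where "B \<in> ?S" and max: "\<forall>C\<in>?S. B \<subseteq> C \<longrightarrow> emeasure M (C - B) = 0"
    by (elim bexE conjE) (rule that)
  then have B: "B \<in> sets M" "B \<subseteq> A" "emeasure M B \<le> c" by auto
  have "emeasure M B = c"
  proof (rule ccontr)
    assume "emeasure M B \<noteq> c"
    then have lt: "emeasure M B < c" using B by auto
    have "emeasure M A = emeasure M B + emeasure M (A - B)"
      using A B by (subst plus_emeasure) (auto simp: Un_absorb1)
    then have p1: "0 < emeasure M (A - B)" using lt c by (auto simp: zero_less_iff_neq_zero)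
    have p2: "0 < c - emeasure M B" using lt by (simp add: diff_gr0_ennreal)
    obtain C where C: "C \<in> sets M" "C \<subseteq> A - B" "0 < emeasure M C" "emeasure M C \<le> c - emeasure M B"
      by (rule ex_small_subset[OF _ p1 p2]) (use A B in auto)
    have "emeasure M (B \<union> C) = emeasure M B + emeasure M C"
      using B C by (intro plus_emeasure[symmetric]) auto
    also have "\<dots> \<le> emeasure M B + (c - emeasure M B)" using C(4) by (rule add_left_mono)
    also have "\<dots> = c" using lt by (simp add: add_diff_inverse_ennreal)
    finally have "B \<union> C \<in> ?S" using B C by auto
    moreover have "B \<union> C - B = C" using C(2) by auto
    ultimately have "emeasure M C = 0" using bspec[OF max, of "B \<union> C"] by simp
    then show False using C(3) by simp
  qed
  then show ?thesis using that B by blast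
qed

text \<open>Greedy choice: the set \<open>U n\<close> used up so far has finite measure, so the rest
  of \<open>W\<close> still has infinite measure and room for a set of measure
  \<open>c n\<close>.\<close>

lemma ex_disjoint_subsets:
  assumes W: "W \<in> sets M" "emeasure M W = \<infinity>" and c: "\<And>n :: nat. c n < \<infinity>"
  obtains D where "\<And>n. D n \<in> sets M" "\<And>n. D n \<subseteq> W" "disjoint_family D" "\<And>n. emeasure M (D n) = c n"
proof -
  have "\<exists>U. \<forall>n. (U n \<in> sets M \<and> U n \<subseteq> W \<and> emeasure M (U n) < \<infinity>) \<and>
     (U n \<subseteq> U (Suc n) \<and> emeasure M (U (Suc n) - U n) = c n)"
  proof (rule dependent_nat_choice)
    show "\<exists>U. U \<in> sets M \<and> U \<subseteq> W \<and> emeasure M U < \<infinity>" by (rule exI[of _ "{}"]) auto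
    fix U and n :: nat assume U: "U \<in> sets M \<and> U \<subseteq> W \<and> emeasure M U < \<infinity>"
    then have inf: "emeasure M (W - U) = \<infinity>" using W by (subst emeasure_Diff) (auto simp: less_top)
    obtain D where D: "D \<in> sets M" "D \<subseteq> W - U" "emeasure M D = c n"
      by (rule ex_subset_emeasure[of "W - U" "c n"]) (use W U c[of n] inf in auto)
    then show "\<exists>V. (V \<in> sets M \<and> V \<subseteq> W \<and> emeasure M V < \<infinity>) \<and> (U \<subseteq> V \<and> emeasure M (V - U) = c n)"
    proof (intro exI[of _ "U \<union> D"] conjI)
      have "emeasure M (U \<union> D) = emeasure M U + emeasure M D"
        using U D by (intro plus_emeasure[symmetric]) auto
      then show "emeasure M (U \<union> D) < \<infinity>" using U D c[of n] by simp
      have "U \<union> D - U = D" using D by auto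
      then show "emeasure M (U \<union> D - U) = c n" using D by simp
    qed (use U D W in auto)
  qed
  then obtain U where U: "\<And>n. U n \<in> sets M" "\<And>n. U n \<subseteq> W" "\<And>n. U n \<subseteq> U (Suc n)"
    "\<And>n. emeasure M (U (Suc n) - U n) = c n" by blast
  have mono: "U m \<subseteq> U n" if "m \<le> n" for m n using U(3) that by (rule lift_Suc_mono_le)
  show ?thesis
  proof (rule that[of "\<lambda>n. U (Suc n) - U n"])
    show "disjoint_family (\<lambda>n. U (Suc n) - U n)"
      by (rule disjoint_family_Suc) (use U(3) in auto)
  qed (use U in auto)
qed

text \<open>Disjoint sets of measure 1 are regrouped by the pairing function into infinitely many
  rows, each of them infinite.\<close>

lemma ex_disjoint_infinite_subsets:
  assumes W: "W \<in> sets M" "emeasure M W = \<infinity>"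
  obtains D :: "nat \<Rightarrow> 'a set" where "\<And>n. D n \<in> sets M" "\<And>n. D n \<subseteq> W" "disjoint_family D" "\<And>n. emeasure M (D n) = \<infinity>"
proof -
  obtain E where E: "\<And>n. E n \<in> sets M" "\<And>n. E n \<subseteq> W" "disjoint_family E" "\<And>n :: nat. emeasure M (E n) = 1"
    by (rule ex_disjoint_subsets[OF W, of "\<lambda>_. 1"]) auto
  define D where "D k = (\<Union>n. E (prod_encode (k, n)))" for k
  have inj: "inj (\<lambda>n. prod_encode (k, n))" for k by (auto intro: injI)
  have "emeasure M (D k) = (\<Sum>n. emeasure M (E (prod_encode (k, n))))" for k
    unfolding D_def using E(1,3) inj[of k]
    by (intro suminf_emeasure[symmetric]) (auto simp: disjoint_family_on_def inj_eq)
  then have inf: "emeasure M (D k) = \<infinity>" for k by (simp add: E(4) suminf_eq_SUP ennreal_SUP_of_nat_eq_top)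
  show ?thesis
  proof (rule that[of D])
    show "disjoint_family D"
      using E(3) unfolding disjoint_family_on_def D_def by (auto simp: prod_encode_eq) (metis IntI Pair_inject emptyE prod_encode_eq)
  qed (use E inf in \<open>auto simp: D_def\<close>)
qed

end

section \<open>Representatives and the pseudo full group\<close>

definition cls :: "'a measure \<Rightarrow> ('a \<Rightarrow> 'a) \<Rightarrow> ('a \<Rightarrow> 'a) set" where
  "cls M T = ae_id M #>\<^bsub>mp_group M\<^esub> T"

lemma mem_cls_iff: "T \<in> mp_bijections M \<Longrightarrow> S \<in> cls M T \<longleftrightarrow> S \<in> mp_bijections M \<and> (AE x in M. S x = T x)"
  by (simp add: cls_def rcoset_ae_id)

lemma cls_eqI:
  assumes "S \<in> mp_bijections M" "T \<in> mp_bijections M" "AE x in M. S x = T x"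
  shows "cls M S = cls M T"
proof -
  have "(AE x in M. R x = S x) \<longleftrightarrow> (AE x in M. R x = T x)" for R
  proof
    assume "AE x in M. R x = S x"
    with assms(3) show "AE x in M. R x = T x" by eventually_elim auto
  next
    assume "AE x in M. R x = T x"
    with assms(3) show "AE x in M. R x = S x" by eventually_elim auto
  qed
  then show ?thesis using assms by (auto simp: mem_cls_iff)
qed

lemma carrier_Aut_cls: "carrier (Aut M) = cls M ` mp_bijections M"
  by (auto simp: Aut_def FactGroup_def RCOSETS_def mp_group_simps cls_def)

lemma cls_hom: "group_hom (mp_group M) (Aut M) (cls M)"
proof -
  have "cls M = (#>\<^bsub>mp_group M\<^esub>) (ae_id M)" by (auto simp: cls_def)
  then show ?thesis
    using normal.r_coset_hom_Mod[OF normal_ae_id, of M] group_mp_group[of M] group_Aut[of M]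
    by (simp add: group_hom_def group_hom_axioms_def Aut_def)
qed

section \<open>Pointwise representatives of an ergodic full group\<close>

locale ergodic_full_group = standard_sigma_finite_space M for M :: "'a measure" +
  fixes G :: "('a \<Rightarrow> 'a) set set"
  assumes full: "full_group M G" and erg: "ergodic M G"
begin

abbreviation mul :: "('a \<Rightarrow> 'a) \<Rightarrow> ('a \<Rightarrow> 'a) \<Rightarrow> 'a \<Rightarrow> 'a" (infixl "\<star>" 70) where
  "S \<star> T \<equiv> S \<otimes>\<^bsub>mp_group M\<^esub> T"

abbreviation iv :: "('a \<Rightarrow> 'a) \<Rightarrow> 'a \<Rightarrow> 'a" where
  "iv T \<equiv> inv\<^bsub>mp_group M\<^esub> T"

abbreviation idm :: "'a \<Rightarrow> 'a" where
  "idm \<equiv> \<one>\<^bsub>mp_group M\<^esub>"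

sublocale mp: group "mp_group M" by (rule group_mp_group)
sublocale cl: group_hom "mp_group M" "Aut M" "cls M" by (rule cls_hom)

text \<open>The argument is carried out pointwise, on representatives. The elements of
  \<open>G\<close> are classes, that is sets of maps, so their union collects all representatives;
  \<open>G_eq\<close> leads back to classes and \<open>Gam_AE\<close> allows changes on null
  sets.\<close>

definition Gam :: "('a \<Rightarrow> 'a) set" where "Gam = \<Union>G"

lemma subgroup_G: "subgroup G (Aut M)"
  using full by (simp add: full_group_def)

lemma Gam_iff: "T \<in> Gam \<longleftrightarrow> T \<in> mp_bijections M \<and> cls M T \<in> G"
proof
  assume "T \<in> Gam"
  then obtain t where t: "t \<in> G" "T \<in> t" by (auto simp: Gam_def)
  then have "t \<in> carrier (Aut M)" using subgroup_G by (meson subgroup.mem_carrier)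
  then obtain T0 where T0: "T0 \<in> mp_bijections M" "t = cls M T0" by (auto simp: carrier_Aut_cls)
  then have "T \<in> mp_bijections M" "AE x in M. T x = T0 x" using t by (auto simp: mem_cls_iff)
  then show "T \<in> mp_bijections M \<and> cls M T \<in> G" using cls_eqI[of T M T0] T0 t by simp
next
  assume "T \<in> mp_bijections M \<and> cls M T \<in> G"
  then show "T \<in> Gam" unfolding Gam_def by (intro UnionI[of "cls M T"]) (auto simp: mem_cls_iff)
qed

lemma Gam_mp: "T \<in> Gam \<Longrightarrow> T \<in> mp_bijections M" by (simp add: Gam_iff)

lemma Gam_carrier: "T \<in> Gam \<Longrightarrow> T \<in> carrier (mp_group M)" by (simp add: Gam_iff mp_group_simps)

lemma G_eq: "G = cls M ` Gam"
  using subgroup.subset[OF subgroup_G] by (auto simp: carrier_Aut_cls Gam_iff)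

lemma Gam_one [simp]: "idm \<in> Gam"
  using subgroup.one_closed[OF subgroup_G] mp.one_closed by (simp add: Gam_iff mp_group_simps(1))

lemma Gam_mul [simp]: "S \<in> Gam \<Longrightarrow> T \<in> Gam \<Longrightarrow> S \<star> T \<in> Gam"
  using subgroup.m_closed[OF subgroup_G] mp.m_closed cl.hom_mult by (simp add: Gam_iff mp_group_simps(1))

lemma Gam_iv [simp]: "T \<in> Gam \<Longrightarrow> iv T \<in> Gam"
  using subgroup.m_inv_closed[OF subgroup_G] mp.inv_closed cl.hom_inv by (simp add: Gam_iff mp_group_simps(1))

lemma Gam_AE: "T \<in> Gam \<Longrightarrow> S \<in> mp_bijections M \<Longrightarrow> AE x in M. S x = T x \<Longrightarrow> S \<in> Gam"
  using cls_eqI[of S M T] by (simp add: Gam_iff)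

text \<open>Equality on the pieces is asked pointwise; for the other representatives of the same
  classes it then holds almost everywhere, which is what \<open>full_group\<close> demands.\<close>

lemma Gam_full:
  assumes T: "T \<in> mp_bijections M" and A: "\<And>n :: nat. A n \<in> sets M" "disjoint_family A" "(\<Union>n. A n) = space M"
    and S: "\<And>n. S n \<in> Gam" and eq: "\<And>n x. x \<in> A n \<Longrightarrow> T x = S n x"
  shows "T \<in> Gam"
proof -
  have "AE x\<in>A n in M. T' x = S' x" if "T' \<in> cls M T" "S' \<in> cls M (S n)" for n T' S'
  proof -
    have "AE x in M. T' x = T x" "AE x in M. S' x = S n x"
      using that T S by (auto simp: mem_cls_iff Gam_mp)
    then show ?thesis by eventually_elim (auto simp: eq)
  qed
  moreover have "cls M T \<in> carrier (Aut M)" using T by (auto simp: carrier_Aut_cls)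
  moreover have "cls M (S n) \<in> G" for n using S by (simp add: Gam_iff)
  moreover have "range A \<subseteq> sets M" using A by auto
  moreover have "\<forall>t\<in>carrier (Aut M). \<forall>A s. range A \<subseteq> sets M \<and> disjoint_family A \<and> (\<Union>n :: nat. A n) = space M \<and>
        (\<forall>n. s n \<in> G \<and> (\<forall>T\<in>t. \<forall>S\<in>s n. AE x\<in>A n in M. T x = S x)) \<longrightarrow> t \<in> G"
    using full unfolding full_group_def by (rule conjunct2)
  ultimately have "cls M T \<in> G"
    using A(2,3) by (elim ballE[of _ _ "cls M T"] allE[of _ A] allE[of _ "\<lambda>n. cls M (S n)"]) auto
  then show ?thesis using T by (simp add: Gam_iff)
qed

lemma Gam_space [simp]: "T \<in> Gam \<Longrightarrow> x \<in> space M \<Longrightarrow> T x \<in> space M"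
  by (rule mp_bijectionsD(4)[OF Gam_mp])

lemma mul_apply [simp]: "S \<in> Gam \<Longrightarrow> T \<in> Gam \<Longrightarrow> x \<in> space M \<Longrightarrow> (S \<star> T) x = S (T x)"
  by (simp add: mp_group_simps Gam_mp compose_def)

lemma idm_apply [simp]: "x \<in> space M \<Longrightarrow> idm x = x"
  by (simp add: mp_group_simps)

lemma iv_apply [simp]:
  assumes "T \<in> Gam" "x \<in> space M" shows "iv T (T x) = x" "T (iv T x) = x"
proof -
  have "(iv T \<star> T) x = x" "(T \<star> iv T) x = x"
    using assms by (simp_all del: mul_apply add: Gam_carrier)
  then show "iv T (T x) = x" "T (iv T x) = x" using assms by simp_all
qed

lemma Gam_eq_iff: "T \<in> Gam \<Longrightarrow> x \<in> space M \<Longrightarrow> y \<in> space M \<Longrightarrow> T x = T y \<longleftrightarrow> x = y"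
  by (metis iv_apply(1))

lemma iv_eqI: "T \<in> Gam \<Longrightarrow> x \<in> space M \<Longrightarrow> T x = y \<Longrightarrow> iv T y = x"
  by auto

lemma Gam_eqI:
  assumes "S \<in> Gam" "T \<in> Gam" "\<And>x. x \<in> space M \<Longrightarrow> S x = T x"
  shows "S = T"
proof
  fix x show "S x = T x"
    using assms mp_bijectionsD(1)[OF Gam_mp[OF assms(1)]] mp_bijectionsD(1)[OF Gam_mp[OF assms(2)]] by (cases "x \<in> space M") (auto simp: Bij_def extensional_def)
qed

lemma Gam_measurable: "T \<in> Gam \<Longrightarrow> T \<in> measurable M M"
  by (rule mp_bijectionsD(3)[OF Gam_mp])

lemma Gam_image [simp]: "T \<in> Gam \<Longrightarrow> A \<in> sets M \<Longrightarrow> T ` A \<in> sets M"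
  by (rule mp_bijectionsD(5)[OF Gam_mp])

lemma Gam_emeasure [simp]: "T \<in> Gam \<Longrightarrow> A \<in> sets M \<Longrightarrow> emeasure M (T ` A) = emeasure M A"
  by (rule mp_bijectionsD(6)[OF Gam_mp])

lemma Gam_vimage [simp]: "T \<in> Gam \<Longrightarrow> A \<in> sets M \<Longrightarrow> T -` A \<inter> space M \<in> sets M"
  using Gam_measurable by (rule measurable_sets)

lemma Gam_inj: "T \<in> Gam \<Longrightarrow> A \<in> sets M \<Longrightarrow> inj_on T A"
  by (rule inj_onI) (metis iv_apply(1) sets.sets_into_space subsetD)

lemma Gam_AE_apply: "T \<in> Gam \<Longrightarrow> AE x in M. P x \<Longrightarrow> AE x in M. P (T x)"
  using AE_mp_bijection Gam_mp by blast

lemma sets_space: "A \<in> sets M \<Longrightarrow> x \<in> A \<Longrightarrow> x \<in> space M"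
  using sets.sets_into_space by blast

text \<open>The elements of the pseudo full group of \<open>G\<close> with domain \<open>C\<close>:\<close>

definition pw :: "'a set \<Rightarrow> ('a \<Rightarrow> 'a) \<Rightarrow> bool" where
  "pw C f \<longleftrightarrow> inj_on f C \<and> (\<exists>(g :: nat \<Rightarrow> 'a \<Rightarrow> 'a) K.
     (\<forall>n. g n \<in> Gam \<and> K n \<in> sets M \<and> (\<forall>x\<in>K n. f x = g n x)) \<and> C = (\<Union>n. K n))"

lemma pwI:
  fixes g :: "'i :: countable \<Rightarrow> 'a \<Rightarrow> 'a"
  assumes "inj_on f C" "\<And>i. g i \<in> Gam" "\<And>i. K i \<in> sets M" "\<And>i x. x \<in> K i \<Longrightarrow> f x = g i x" "C = (\<Union>i. K i)"
  shows "pw C f"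
proof -
  have "(\<Union>i. K i) = (\<Union>n. K (from_nat n))" by (auto intro: exI[of _ "to_nat _"]) (metis from_nat_to_nat)
  then show ?thesis unfolding pw_def using assms
    by (intro conjI exI[of _ "\<lambda>n. g (from_nat n)"] exI[of _ "\<lambda>n. K (from_nat n)"]) auto
qed

lemma pwE:
  assumes "pw C f"
  obtains g :: "nat \<Rightarrow> 'a \<Rightarrow> 'a" and K where "\<forall>n. g n \<in> Gam" "\<forall>n. K n \<in> sets M" "\<forall>n. \<forall>x\<in>K n. f x = g n x" "C = (\<Union>n. K n)"
  using assms unfolding pw_def by metis

text \<open>Countable additivity and \<open>Gam_full\<close> require disjoint pieces. Passing to
  \<open>disjointed\<close> shrinks each piece, so the same group elements still describe
  \<open>f\<close>.\<close>

lemma pwE_disjoint: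
  assumes "pw C f"
  obtains g :: "nat \<Rightarrow> 'a \<Rightarrow> 'a" and K where "\<forall>n. g n \<in> Gam" "\<forall>n. K n \<in> sets M" "\<forall>n. \<forall>x\<in>K n. f x = g n x" "C = (\<Union>n. K n)"
    "disjoint_family K"
proof -
  obtain g K where gK [rule_format]: "\<forall>n. g n \<in> Gam" "\<forall>n :: nat. K n \<in> sets M" "\<forall>n. \<forall>x\<in>K n. f x = g n x" "C = (\<Union>n. K n)"
    by (rule pwE[OF assms])
  have "disjointed K n \<in> sets M" for n
    using sets.range_disjointed_sets[of K M] gK(2) by auto
  moreover have "f x = g n x" if "x \<in> disjointed K n" for n x
    using gK(3) that disjointed_subset[of K n] by blast
  ultimately show ?thesis
    using gK(1,4) UN_disjointed_eq[of K] disjoint_family_disjointed[of K]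
    by (intro that[of g "disjointed K"]) auto
qed

lemma pw_inj: "pw C f \<Longrightarrow> inj_on f C" by (simp add: pw_def)

lemma pw_sets: "pw C f \<Longrightarrow> C \<in> sets M" by (auto simp: pw_def)

lemma pw_cong:
  assumes "pw C f" "\<And>x. x \<in> C \<Longrightarrow> f x = h x"
  shows "pw C h"
proof -
  obtain g K where gK [rule_format]: "\<forall>n. g n \<in> Gam" "\<forall>n :: nat. K n \<in> sets M" "\<forall>n. \<forall>x\<in>K n. f x = g n x" "C = (\<Union>n. K n)"
    by (rule pwE[OF assms(1)])
  have "h x = g n x" if "x \<in> K n" for n x
  proof -
    have "x \<in> C" using that gK(4) by blast
    then show ?thesis using gK(3)[OF that] assms(2) by simp
  qed
  moreover have "inj_on h C" using pw_inj[OF assms(1)] assms(2) by (simp cong: inj_on_cong)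
  ultimately show "pw C h" by (intro pwI[of _ _ g K]) (use gK in auto)
qed

lemma pw_subset:
  assumes "pw C f" "C' \<in> sets M" "C' \<subseteq> C"
  shows "pw C' f"
proof -
  obtain g K where gK [rule_format]: "\<forall>n. g n \<in> Gam" "\<forall>n :: nat. K n \<in> sets M" "\<forall>n. \<forall>x\<in>K n. f x = g n x" "C = (\<Union>n. K n)"
    by (rule pwE[OF assms(1)])
  show ?thesis
    by (rule pwI[of _ _ g "\<lambda>n. K n \<inter> C'"]) (use gK assms inj_on_subset[OF pw_inj[OF assms(1)]] in auto)
qed

lemma pw_Gam: "T \<in> Gam \<Longrightarrow> C \<in> sets M \<Longrightarrow> pw C T"
  by (rule pwI[of _ _ "\<lambda>_ :: nat. T" "\<lambda>_. C"]) (auto intro: Gam_inj)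

lemma pw_ident: "C \<in> sets M \<Longrightarrow> pw C (\<lambda>x. x)"
  by (rule pw_cong[OF pw_Gam[OF Gam_one]]) (auto dest: sets_space)

lemma pw_image_aux:
  assumes "pw C f"
  shows "f ` C \<in> sets M \<and> emeasure M (f ` C) = emeasure M C"
proof -
  obtain g K where gK [rule_format]: "\<forall>n. g n \<in> Gam" "\<forall>n :: nat. K n \<in> sets M" "\<forall>n. \<forall>x\<in>K n. f x = g n x"
    "C = (\<Union>n. K n)" "disjoint_family K"
    by (rule pwE_disjoint[OF assms])
  have im: "f ` K n = g n ` K n" for n using gK(3) by auto
  then have meas: "f ` K n \<in> sets M" "emeasure M (f ` K n) = emeasure M (K n)" for n
    using gK by auto
  have un: "f ` C = (\<Union>n. f ` K n)" using gK(4) by auto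
  have disj: "disjoint_family (\<lambda>n. f ` K n)"
    using gK(5,4) pw_inj[OF assms] unfolding disjoint_family_on_def inj_on_def by blast
  have "emeasure M (f ` C) = (\<Sum>n. emeasure M (f ` K n))"
    unfolding un using meas disj by (intro suminf_emeasure[symmetric]) auto
  also have "\<dots> = emeasure M C"
    unfolding gK(4) using gK meas by (subst suminf_emeasure[symmetric]) auto
  finally show ?thesis using un meas by auto
qed

lemma pw_image: "pw C f \<Longrightarrow> f ` C \<in> sets M"
  and pw_emeasure: "pw C f \<Longrightarrow> emeasure M (f ` C) = emeasure M C"
  using pw_image_aux by blast+

lemma pw_image_subset: "pw C f \<Longrightarrow> A \<in> sets M \<Longrightarrow> A \<subseteq> C \<Longrightarrow> f ` A \<in> sets M"
  using pw_image pw_subset by blast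

lemma pw_compose:
  assumes f: "pw C f" and h: "pw D h" and sub: "f ` C \<subseteq> D"
  shows "pw C (\<lambda>x. h (f x))"
proof -
  obtain g K where gK [rule_format]: "\<forall>n. g n \<in> Gam" "\<forall>n :: nat. K n \<in> sets M" "\<forall>n. \<forall>x\<in>K n. f x = g n x" "C = (\<Union>n. K n)"
    by (rule pwE[OF f])
  obtain g' L where gL [rule_format]: "\<forall>n. g' n \<in> Gam" "\<forall>n :: nat. L n \<in> sets M" "\<forall>n. \<forall>x\<in>L n. h x = g' n x" "D = (\<Union>n. L n)"
    by (rule pwE[OF h])
  show ?thesis
  proof (rule pwI[of _ _ "\<lambda>(m, n). g' m \<star> g n" "\<lambda>(m, n). K n \<inter> (g n -` L m \<inter> space M)"])
    show "inj_on (\<lambda>x. h (f x)) C"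
      using comp_inj_on[OF pw_inj[OF f] inj_on_subset[OF pw_inj[OF h] sub]] by (simp add: comp_def)
    show "C = (\<Union>i. case i of (m, n) \<Rightarrow> K n \<inter> (g n -` L m \<inter> space M))"
    proof safe
      fix x assume "x \<in> C"
      then obtain n where n: "x \<in> K n" using gK by auto
      moreover obtain m where "f x \<in> L m" using \<open>x \<in> C\<close> sub gL by auto
      ultimately have "x \<in> (case (m, n) of (m, n) \<Rightarrow> K n \<inter> (g n -` L m \<inter> space M))"
        using gK(3) sets_space[OF gK(2)] by auto
      then show "x \<in> (\<Union>i. case i of (m, n) \<Rightarrow> K n \<inter> (g n -` L m \<inter> space M))" by blast
    qed (use gK in auto)
  qed (use gK gL in auto)
qed

lemma pw_inv:
  assumes f: "pw C f"
  shows "pw (f ` C) (inv_into C f)"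
proof -
  obtain g K where gK [rule_format]: "\<forall>n. g n \<in> Gam" "\<forall>n :: nat. K n \<in> sets M" "\<forall>n. \<forall>x\<in>K n. f x = g n x" "C = (\<Union>n. K n)"
    by (rule pwE[OF f])
  show ?thesis
  proof (rule pwI[of _ _ "\<lambda>n. iv (g n)" "\<lambda>n. g n ` K n"])
    show "inj_on (inv_into C f) (f ` C)" by (rule inj_on_inv_into) simp
    show "inv_into C f x = iv (g n) x" if x: "x \<in> g n ` K n" for n x
    proof -
      obtain y where y: "y \<in> K n" "x = g n y" using x by blast
      then have "inv_into C f (f y) = y" using gK(4) by (intro inv_into_f_f pw_inj[OF f]) auto
      then show ?thesis using y gK sets_space[OF gK(2)] by auto
    qed
    have "g n ` K n = f ` K n" for n using gK(3) by auto
    then show "f ` C = (\<Union>n. g n ` K n)" using gK(4) by auto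
  qed (use gK in auto)
qed

lemma pw_UN:
  assumes f: "\<And>n :: nat. pw (C n) f" and inj: "inj_on f (\<Union>n. C n)"
  shows "pw (\<Union>n. C n) f"
proof -
  have "\<forall>n. \<exists>g K. (\<forall>m. g m \<in> Gam \<and> K m \<in> sets M \<and> (\<forall>x\<in>K m. f x = g m x)) \<and> C n = (\<Union>m :: nat. K m)"
    using f unfolding pw_def by blast
  then obtain g K where gK: "\<And>n m. g n m \<in> Gam \<and> K n m \<in> sets M \<and> (\<forall>x\<in>K n m. f x = g n m x)"
    "\<And>n. C n = (\<Union>m :: nat. K n m)" by metis
  show ?thesis
    by (rule pwI[of _ _ "\<lambda>(n, m). g n m" "\<lambda>(n, m). K n m"]) (use gK inj in auto)
qed

lemma pw_Un:
  assumes "pw C f" "pw D f" "inj_on f (C \<union> D)"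
  shows "pw (C \<union> D) f"
proof -
  have "C \<union> D = (\<Union>n :: nat. if n = 0 then C else D)" by (auto split: if_splits)
  then show ?thesis using pw_UN[of "\<lambda>n. if n = 0 then C else D" f] assms by auto
qed

text \<open>New elements of \<open>Gam\<close> are produced in this way: the piecewise description
  yields measurability and invariance of the measure, and closure under cutting and pasting yields
  membership.\<close>

lemma Gam_of_pw:
  assumes T: "pw (space M) T" and ext: "T \<in> extensional (space M)" and im: "T ` space M = space M"
  shows "T \<in> Gam"
proof -
  have bij: "bij_betw T (space M) (space M)" using pw_inj[OF T] im by (simp add: bij_betw_def)
  have image: "T ` A \<in> sets M" "emeasure M (T ` A) = emeasure M A" if "A \<in> sets M" for A
    using pw_subset[OF T that] sets.sets_into_space[OF that] pw_image pw_emeasure by blast+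
  have vim: "T -` A \<inter> space M \<in> sets M" if A: "A \<in> sets M" for A
  proof -
    have "T -` A \<inter> space M = inv_into (space M) T ` A"
    proof safe
      fix x assume "x \<in> space M" "T x \<in> A"
      then show "x \<in> inv_into (space M) T ` A" by (intro image_eqI[of _ _ "T x"]) (auto simp: inv_into_f_f[OF pw_inj[OF T]])
    next
      fix x assume "x \<in> A"
      then have "x \<in> T ` space M" using sets_space[OF A] im by simp
      then show "inv_into (space M) T x \<in> T -` A" "inv_into (space M) T x \<in> space M"
        using \<open>x \<in> A\<close> by (auto simp: f_inv_into_f inv_into_into)
    qed
    then show ?thesis
      using pw_image_subset[OF pw_inv[OF T] A] sets.sets_into_space[OF A] by (simp add: im)
  qed
  have "T ` (T -` A \<inter> space M) = A" if "A \<in> sets M" for A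
  proof
    show "A \<subseteq> T ` (T -` A \<inter> space M)"
    proof
      fix y assume y: "y \<in> A"
      then have "y \<in> T ` space M" using im sets_space[OF that] by simp
      then obtain x where "x \<in> space M" "y = T x" by (auto elim: imageE)
      then show "y \<in> T ` (T -` A \<inter> space M)" using y by auto
    qed
  qed auto
  then have vim2: "emeasure M (T -` A \<inter> space M) = emeasure M A" if "A \<in> sets M" for A
    using image(2)[OF vim[OF that]] that by simp
  have "T \<in> measurable M M" using vim bij by (intro measurableI) (auto simp: bij_betw_def)
  then have mp: "T \<in> mp_bijections M"
    using bij ext image vim2 by (auto simp: mp_bijections_def Bij_def)
  obtain g K where gK [rule_format]: "\<forall>n. g n \<in> Gam" "\<forall>n :: nat. K n \<in> sets M" "\<forall>n. \<forall>x\<in>K n. T x = g n x"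
    "space M = (\<Union>n. K n)" "disjoint_family K"
    by (rule pwE_disjoint[OF T])
  show ?thesis by (rule Gam_full[OF mp, of K g]) (use gK in auto)
qed

section \<open>Flips, transport and wandering sets\<close>

lemma Gam_involutionI:
  assumes "pw (space M) T" "T \<in> extensional (space M)" "\<And>x. x \<in> space M \<Longrightarrow> T x \<in> space M" "\<And>x. x \<in> space M \<Longrightarrow> T (T x) = x"
  shows "T \<in> Gam"
  by (rule Gam_of_pw[OF assms(1,2)]) (use assms(3,4) in force)

definition flippable :: "'a set \<Rightarrow> ('a \<Rightarrow> 'a) \<Rightarrow> bool" where
  "flippable C f \<longleftrightarrow> pw C f \<and> C \<inter> f ` C = {}"

text \<open>The restriction to \<open>space M\<close> matches the extensional representatives in
  \<open>Bij\<close>. Under \<open>flippable C f\<close> the map \<open>f\<close> is injective on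
  \<open>C\<close> and the first two cases exclude each other, so the result is an
  involution.\<close>

definition flip :: "'a set \<Rightarrow> ('a \<Rightarrow> 'a) \<Rightarrow> 'a \<Rightarrow> 'a" where
  "flip C f = (\<lambda>x\<in>space M. if x \<in> C then f x else if x \<in> f ` C then inv_into C f x else x)"

lemma flip_props:
  assumes "flippable C f"
  shows flip_Gam: "flip C f \<in> Gam"
    and flip_on: "\<And>x. x \<in> C \<Longrightarrow> flip C f x = f x"
    and flip_image: "\<And>x. x \<in> C \<Longrightarrow> flip C f (f x) = x"
    and flip_off: "\<And>x. x \<in> space M \<Longrightarrow> x \<notin> C \<Longrightarrow> x \<notin> f ` C \<Longrightarrow> flip C f x = x"
    and flip_flip: "\<And>x. x \<in> space M \<Longrightarrow> flip C f (flip C f x) = x"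
proof -
  have pw: "pw C f" and disj: "C \<inter> f ` C = {}" using assms by (auto simp: flippable_def)
  have C: "C \<in> sets M" "f ` C \<in> sets M" using pw pw_sets pw_image by auto
  have CS: "x \<in> space M" if "x \<in> C" for x using that C sets_space by blast
  have fS: "f x \<in> space M" if "x \<in> C" for x using that C(2) sets_space by blast
  show on: "flip C f x = f x" if "x \<in> C" for x using that CS by (simp add: flip_def)
  show im: "flip C f (f x) = x" if "x \<in> C" for x
  proof -
    have "f x \<notin> C" using that disj by blast
    then show ?thesis using that fS pw_inj[OF pw] by (simp add: flip_def inv_into_f_f)
  qed
  show off: "flip C f x = x" if "x \<in> space M" "x \<notin> C" "x \<notin> f ` C" for x using that by (simp add: flip_def)
  show flip2: "flip C f (flip C f x) = x" if "x \<in> space M" for x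
  proof -
    consider "x \<in> C" | y where "y \<in> C" "x = f y" | "x \<notin> C" "x \<notin> f ` C" by blast
    then show ?thesis using that on im off by cases simp_all
  qed
  have sp: "flip C f x \<in> space M" if "x \<in> space M" for x
  proof -
    consider "x \<in> C" | y where "y \<in> C" "x = f y" | "x \<notin> C" "x \<notin> f ` C" by blast
    then show ?thesis using that on im off CS fS by cases simp_all
  qed
  have inj: "inj_on (flip C f) A" if "A \<subseteq> space M" for A
  proof (rule inj_onI)
    fix x y assume "x \<in> A" "y \<in> A" and eq: "flip C f x = flip C f y"
    then have "x \<in> space M" "y \<in> space M" using that by auto
    then have "x = flip C f (flip C f x)" "flip C f (flip C f y) = y" using flip2 by simp_all
    then show "x = y" unfolding eq by (rule trans)
  qed
  \<comment> \<open>On \<open>C\<close>, on its image and on the rest the flip is \<open>f\<close>,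
    the inverse of \<open>f\<close> and the identity; each of these is piecewise in the
    group.\<close>
  have "pw C (flip C f)" using pw on by (auto intro: pw_cong)
  moreover have "pw (f ` C) (flip C f)"
    by (rule pw_cong[OF pw_inv[OF pw]]) (auto simp: im inv_into_f_f[OF pw_inj[OF pw]])
  moreover have "pw (space M - (C \<union> f ` C)) (flip C f)"
    by (rule pw_cong[OF pw_ident]) (use C off in auto)
  ultimately have "pw (C \<union> (f ` C \<union> (space M - (C \<union> f ` C)))) (flip C f)"
    by (intro pw_Un inj) (use CS fS in auto)
  moreover have "C \<union> (f ` C \<union> (space M - (C \<union> f ` C))) = space M" using CS fS by auto
  ultimately have "pw (space M) (flip C f)" by simp
  then show "flip C f \<in> Gam"
    by (rule Gam_involutionI) (use sp flip2 in \<open>auto simp: flip_def\<close>)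
qed

section \<open>Supports of elements of the group\<close>

text \<open>A point is moved exactly when some member of a separating sequence contains it but not
  its image, so the support is a countable union of differences of Borel sets.\<close>

lemma supp_sets: "T \<in> Gam \<Longrightarrow> supp M T \<in> sets M"
proof -
  assume T: "T \<in> Gam"
  obtain U :: "nat \<Rightarrow> 'a set" where U: "\<And>n. U n \<in> sets M"
    "\<And>x y. x \<in> space M \<Longrightarrow> y \<in> space M \<Longrightarrow> x \<noteq> y \<Longrightarrow> \<exists>n. x \<in> U n \<and> y \<notin> U n"
    by (rule ex_separating_sets) auto
  have "supp M T = (\<Union>n. U n - (T -` U n \<inter> space M))"
  proof
    show "supp M T \<subseteq> (\<Union>n. U n - (T -` U n \<inter> space M))"
    proof
      fix x assume "x \<in> supp M T"
      then have "x \<in> space M" "T x \<noteq> x" by (auto simp: supp_def)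
      then obtain n where "x \<in> U n" "T x \<notin> U n" using U(2)[of x "T x"] T by auto
      then show "x \<in> (\<Union>n. U n - (T -` U n \<inter> space M))" by auto
    qed
  next
    show "(\<Union>n. U n - (T -` U n \<inter> space M)) \<subseteq> supp M T"
      using sets_space[OF U(1)] by (auto simp: supp_def)
  qed
  moreover have "U n - (T -` U n \<inter> space M) \<in> sets M" for n
    using U(1) T by (intro sets.Diff Gam_vimage) auto
  ultimately show ?thesis by auto
qed

lemma supp_fix: "supp M T \<subseteq> A \<Longrightarrow> x \<in> space M \<Longrightarrow> x \<notin> A \<Longrightarrow> T x = x"
  by (auto simp: supp_def)

lemma supp_iv: "T \<in> Gam \<Longrightarrow> supp M (iv T) = supp M T"
  unfolding supp_def by (auto; metis iv_apply)

lemma supp_mul: "S \<in> Gam \<Longrightarrow> T \<in> Gam \<Longrightarrow> supp M (S \<star> T) \<subseteq> supp M S \<union> supp M T"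
  by (auto simp: supp_def)

text \<open>If \<open>T x\<close> left \<open>A\<close> it would be a fixed point of
  \<open>T\<close>, and injectivity would give \<open>T x = x\<close>, which lies in
  \<open>A\<close>.\<close>

lemma supp_mem:
  assumes "T \<in> Gam" "supp M T \<subseteq> A" "x \<in> A" "x \<in> space M" shows "T x \<in> A"
proof (rule ccontr)
  assume "T x \<notin> A"
  then have "T (T x) = T x" using supp_fix[OF assms(2), of "T x"] assms by simp
  then have "T x = x" using Gam_eq_iff[OF assms(1), of "T x" x] assms by simp
  then show False using assms \<open>T x \<notin> A\<close> by simp
qed

lemma supp_image:
  assumes T: "T \<in> Gam" and A: "supp M T \<subseteq> A" "A \<subseteq> space M"
  shows "T ` A = A"
proof
  show "T ` A \<subseteq> A" using supp_mem[OF T A(1)] A(2) by auto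
  show "A \<subseteq> T ` A"
  proof
    fix x assume x: "x \<in> A"
    then have "iv T x \<in> A" using supp_mem[of "iv T" A x] T A by (auto simp: supp_iv)
    moreover have "x = T (iv T x)" using x A T by auto
    ultimately show "x \<in> T ` A" by blast
  qed
qed

lemma supp_flip: "flippable C f \<Longrightarrow> supp M (flip C f) \<subseteq> C \<union> f ` C"
  using flip_off unfolding supp_def by blast

lemma supp_conj:
  assumes "S \<in> Gam" "T \<in> Gam" shows "supp M (S \<star> T \<star> iv S) = S ` supp M T"
proof
  show "supp M (S \<star> T \<star> iv S) \<subseteq> S ` supp M T"
  proof
    fix x assume "x \<in> supp M (S \<star> T \<star> iv S)"
    then have x: "x \<in> space M" "S (T (iv S x)) \<noteq> x" using assms by (auto simp: supp_def)
    then have "T (iv S x) \<noteq> iv S x" using assms by auto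
    then show "x \<in> S ` supp M T" using x assms by (intro image_eqI[of _ _ "iv S x"]) (auto simp: supp_def)
  qed
  show "S ` supp M T \<subseteq> supp M (S \<star> T \<star> iv S)"
    using assms by (auto simp: supp_def Gam_eq_iff)
qed

section \<open>Comparison of sets by measure\<close>

lemma pw_glue:
  fixes C :: "nat \<Rightarrow> 'a set"
  assumes pw: "\<And>n. pw (C n) (f n)" and disj: "disjoint_family C" and disj': "disjoint_family (\<lambda>n. f n ` C n)"
  obtains h where "pw (\<Union>n. C n) h" "\<forall>n. \<forall>x\<in>C n. h x = f n x"
proof -
  define h where "h x = f (THE n. x \<in> C n) x" for x
  have the: "(THE n. x \<in> C n) = n" if "x \<in> C n" for x n
    using that disj by (intro the_equality) (auto simp: disjoint_family_on_def)
  have h: "h x = f n x" if "x \<in> C n" for x n using the[OF that] by (simp add: h_def)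
  have "inj_on h (\<Union>n. C n)"
  proof (rule inj_onI)
    fix x y assume "x \<in> (\<Union>n. C n)" "y \<in> (\<Union>n. C n)" and eq: "h x = h y"
    then obtain m n where mn: "x \<in> C m" "y \<in> C n" by auto
    have "f m x = f n y" using eq h mn by simp
    then have "f m x \<in> f m ` C m \<inter> f n ` C n"
      using imageI[OF mn(1), of "f m"] imageI[OF mn(2), of "f n"] by simp
    then have "m = n" using disj' by (auto simp: disjoint_family_on_def)
    then show "x = y" using \<open>f m x = f n y\<close> mn pw_inj[OF pw[of n]] by (auto dest: inj_onD)
  qed
  then have "pw (\<Union>n. C n) h" by (intro pw_UN pw_cong[OF pw]) (simp_all add: h)
  then show ?thesis using that[of h] h by blast
qed

text \<open>This is where ergodicity enters. If no element carried a part of \<open>A\<close> of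
  positive measure into \<open>B\<close>, take a maximal set \<open>U\<close> containing
  \<open>A\<close> with the same defect. Adding the image of \<open>U\<close> under any
  \<open>T\<close> preserves the defect, so \<open>U\<close> is invariant up to null sets. It is not
  null, as it contains \<open>A\<close>, and not conull, as it misses almost all of
  \<open>B\<close>.\<close>

lemma transport:
  assumes A: "A \<in> sets M" "0 < emeasure M A" and B: "B \<in> sets M" "0 < emeasure M B"
  obtains g where "g \<in> Gam" "0 < emeasure M (g ` A \<inter> B)"
proof (rule ccontr)
  assume contr: "\<not> thesis"
  have null: "emeasure M (g ` A \<inter> B) = 0" if "g \<in> Gam" for g
    using contr \<open>\<And>g. \<lbrakk>g \<in> Gam; 0 < emeasure M (g ` A \<inter> B)\<rbrakk> \<Longrightarrow> thesis\<close> that zero_less_iff_neq_zero by blast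
  let ?S = "{U \<in> sets M. \<forall>g\<in>Gam. emeasure M (g ` U \<inter> B) = 0}"
  have "\<exists>U\<in>?S. A \<subseteq> U \<and> (\<forall>V\<in>?S. U \<subseteq> V \<longrightarrow> emeasure M (V - U) = 0)"
  proof (rule ae_maximal[where m = "\<lambda>B. B"])
    show "A \<in> ?S" using A null by auto
    fix s :: "nat \<Rightarrow> 'a set"
    assume s: "\<And>n. s n \<in> ?S" "\<And>n. s n \<subseteq> s (Suc n)"
    have "emeasure M (g ` (\<Union>n. s n) \<inter> B) = 0" if g: "g \<in> Gam" for g
    proof -
      have "g ` s n \<inter> B \<in> null_sets M" for n using s(1)[of n] g B by (auto simp: null_sets_def)
      then have "(\<Union>n. g ` s n \<inter> B) \<in> null_sets M" by (intro null_sets_UN)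
      moreover have "g ` (\<Union>n. s n) \<inter> B = (\<Union>n. g ` s n \<inter> B)" by auto
      ultimately show ?thesis by auto
    qed
    then have "(\<Union>n. s n) \<in> ?S" using s(1) by auto
    then show "\<exists>u\<in>?S. \<forall>n. s n \<subseteq> u" by (rule bexI[rotated]) auto
  qed auto
  then obtain U where "U \<in> ?S" and AU: "A \<subseteq> U" and max: "\<forall>V\<in>?S. U \<subseteq> V \<longrightarrow> emeasure M (V - U) = 0"
    by (elim bexE conjE) (rule that)
  then have U: "U \<in> sets M" "\<And>g. g \<in> Gam \<Longrightarrow> emeasure M (g ` U \<inter> B) = 0" by auto
  have inv: "emeasure M (T ` U - U) = 0" if T: "T \<in> Gam" for T
  proof -
    have "emeasure M (g ` (U \<union> T ` U) \<inter> B) = 0" if g: "g \<in> Gam" for g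
    proof -
      have "g ` U \<inter> B \<in> null_sets M" "(g \<star> T) ` U \<inter> B \<in> null_sets M"
        using U T g B by (auto simp: null_sets_def simp del: mul_apply)
      then have "(g ` U \<inter> B) \<union> ((g \<star> T) ` U \<inter> B) \<in> null_sets M" by (rule null_sets.Un)
      moreover have "(g \<star> T) ` U = g ` T ` U" using T g sets_space[OF U(1)] by (auto simp: image_iff)
      ultimately have "g ` (U \<union> T ` U) \<inter> B \<in> null_sets M" by (simp add: image_Un Int_Un_distrib2)
      then show ?thesis by auto
    qed
    then have "U \<union> T ` U \<in> ?S" using U T by auto
    then have "emeasure M (U \<union> T ` U - U) = 0" using max by blast
    then show ?thesis by (simp add: Un_Diff)
  qed
  have "emeasure M (sym_diff (T ` U) U) = 0" if T: "T \<in> Gam" for T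
  proof -
    \<comment> \<open>Maximality gives only one inclusion up to null sets; the other follows by
      applying it to \<open>iv T\<close>.\<close>
    have "U - T ` U = T ` (iv T ` U - U)"
    proof
      show "U - T ` U \<subseteq> T ` (iv T ` U - U)"
      proof
        fix x assume x: "x \<in> U - T ` U"
        then have sp: "x \<in> space M" using U sets_space by blast
        have "iv T x \<notin> U" using x sp T by (metis DiffD2 image_eqI iv_apply(2))
        then show "x \<in> T ` (iv T ` U - U)" using x sp T by (intro image_eqI[of _ _ "iv T x"]) auto
      qed
      show "T ` (iv T ` U - U) \<subseteq> U - T ` U"
        using T sets_space[OF U(1)] by (auto simp: Gam_eq_iff)
    qed
    then have "emeasure M (U - T ` U) = 0" using inv[of "iv T"] T U sets.Diff[OF Gam_image[of "iv T" U] U(1)] by simp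
    then have "T ` U - U \<in> null_sets M" "U - T ` U \<in> null_sets M" using inv[OF T] T U by (auto simp: null_sets_def)
    then have "(T ` U - U) \<union> (U - T ` U) \<in> null_sets M" by (rule null_sets.Un)
    then show ?thesis by auto
  qed
  then have "\<forall>t\<in>G. \<forall>T\<in>t. emeasure M (sym_diff (T ` U) U) = 0" by (auto simp: Gam_def)
  then have "emeasure M U = 0 \<or> emeasure M (space M - U) = 0"
    using erg U(1) unfolding ergodic_def by blast
  then show False
  proof
    assume "emeasure M U = 0"
    then show False using A emeasure_mono[OF AU U(1)] by simp
  next
    assume "emeasure M (space M - U) = 0"
    then have "space M - U \<in> null_sets M" using U by (auto simp: null_sets_def)
    moreover have "idm ` U \<inter> B \<in> null_sets M" using U(2)[OF Gam_one] U(1) B by (auto simp: null_sets_def)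
    ultimately have "(space M - U) \<union> (idm ` U \<inter> B) \<in> null_sets M" by (rule null_sets.Un)
    moreover have "idm ` U = U" using sets_space[OF U(1)] by force
    then have "B \<subseteq> (space M - U) \<union> (idm ` U \<inter> B)" using sets_space[OF B(1)] by auto
    ultimately have "B \<in> null_sets M" using B(1) by (intro null_sets_subset[where A = B]) auto
    then show False using B by auto
  qed
qed

text \<open>Exhaustion over partial maps ordered by extension. A maximal one omits only a null part
  of \<open>Z\<close>: otherwise a part of \<open>D\<close> of positive measure is also left, and
  \<open>transport\<close> extends the map from one remainder into the other.\<close>

lemma embed_finite:
  assumes Z: "Z \<in> sets M" "emeasure M Z < \<infinity>" and D: "D \<in> sets M" and le: "emeasure M Z \<le> emeasure M D"
  obtains C f where "pw C f" "C \<subseteq> Z" "emeasure M (Z - C) = 0" "f ` C \<subseteq> D"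
proof -
  let ?S = "{(C, f). pw C f \<and> C \<subseteq> Z \<and> f ` C \<subseteq> D}"
  let ?b = "\<lambda>(C, f) (C', f'). C \<subseteq> C' \<and> (\<forall>x\<in>C. f' x = f x)"
  have "\<exists>p\<in>?S. ?b ({}, \<lambda>x. x) p \<and> (\<forall>q\<in>?S. ?b p q \<longrightarrow> emeasure M (fst q - fst p) = 0)"
  proof (rule ae_maximal)
    show "({}, \<lambda>x. x) \<in> ?S" using pw_ident by auto
    show "fst p \<in> sets M" if "p \<in> ?S" for p using that pw_sets by auto
    fix s :: "nat \<Rightarrow> 'a set \<times> ('a \<Rightarrow> 'a)"
    assume s: "\<And>n. s n \<in> ?S" "\<And>n. ?b (s n) (s (Suc n))"
    define C f where "C n = fst (s n)" and "f n = snd (s n)" for n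
    have Cf: "pw (C n) (f n)" "C n \<subseteq> Z" "f n ` C n \<subseteq> D" for n
      using s(1)[of n] by (auto simp: C_def f_def)
    have Suc: "C n \<subseteq> C (Suc n)" "\<And>x. x \<in> C n \<Longrightarrow> f (Suc n) x = f n x" for n
      using s(2)[of n] by (auto simp: C_def f_def split: prod.splits)
    have mono: "C m \<subseteq> C n" if "m \<le> n" for m n using Suc(1) that by (rule lift_Suc_mono_le)
    have agree: "x \<in> C m \<Longrightarrow> f n x = f m x" if "m \<le> n" for m n x
      using that
    proof (induction n rule: dec_induct)
      case (step n)
      then have "x \<in> C n" using mono by blast
      then show ?case using step Suc(2)[of x n] by simp
    qed simp
    \<comment> \<open>Along a chain the maps agree wherever both are defined, so the first stage
      whose domain contains \<open>x\<close> gives the common value.\<close>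
    define h where "h x = f (LEAST n. x \<in> C n) x" for x
    have h: "h x = f n x" if "x \<in> C n" for n x
      using agree[OF Least_le[of "\<lambda>n. x \<in> C n", OF that] LeastI[of "\<lambda>n. x \<in> C n", OF that]] by (simp add: h_def)
    have "inj_on h (\<Union>n. C n)"
    proof (rule inj_onI)
      fix x y assume "x \<in> (\<Union>n. C n)" "y \<in> (\<Union>n. C n)" and eq: "h x = h y"
      then obtain m n where "x \<in> C m" "y \<in> C n" by auto
      then have xy: "x \<in> C (max m n)" "y \<in> C (max m n)" using mono[of m "max m n"] mono[of n "max m n"] by auto
      then show "x = y" using eq h pw_inj[OF Cf(1)] by (metis inj_onD)
    qed
    then have "pw (\<Union>n. C n) h" by (intro pw_UN pw_cong[OF Cf(1)]) (simp_all add: h)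
    moreover have "h x \<in> D" if "x \<in> C n" for n x using h[OF that] Cf(3)[of n] that by auto
    ultimately have "(\<Union>n. C n, h) \<in> ?S" using Cf(2) by auto
    moreover have "?b (s n) (\<Union>n. C n, h)" for n
    proof -
      have "s n = (C n, f n)" by (simp add: C_def f_def)
      then show ?thesis using h by auto
    qed
    ultimately show "\<exists>u\<in>?S. \<forall>n. ?b (s n) u" by (intro bexI[of _ "(\<Union>n. C n, h)"] allI)
  qed (auto split: prod.splits)
  then obtain p where "p \<in> ?S" and max: "\<forall>q\<in>?S. ?b p q \<longrightarrow> emeasure M (fst q - fst p) = 0"
    by (elim bexE conjE) (rule that)
  then obtain C f where p: "p = (C, f)" and Cf: "pw C f" "C \<subseteq> Z" "f ` C \<subseteq> D" by auto
  have C: "C \<in> sets M" "f ` C \<in> sets M" using Cf(1) pw_sets pw_image by auto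
  have "emeasure M (Z - C) = 0"
  proof (rule ccontr)
    assume "emeasure M (Z - C) \<noteq> 0"
    then have pos: "0 < emeasure M (Z - C)" by (simp add: zero_less_iff_neq_zero)
    have eqs: "emeasure M Z = emeasure M C + emeasure M (Z - C)" "emeasure M D = emeasure M C + emeasure M (D - f ` C)"
    proof -
      show "emeasure M Z = emeasure M C + emeasure M (Z - C)"
        using Cf(2) C Z by (subst plus_emeasure) (auto simp: Un_absorb1)
      have "emeasure M D = emeasure M (f ` C) + emeasure M (D - f ` C)"
        using Cf(3) C D by (subst plus_emeasure) (auto simp: Un_absorb1)
      then show "emeasure M D = emeasure M C + emeasure M (D - f ` C)" using pw_emeasure[OF Cf(1)] by simp
    qed
    \<comment> \<open>Finiteness of the measure of \<open>Z\<close> allows the common measure of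
      \<open>C\<close> and its image to be cancelled from
      \<open>emeasure M Z \<le> emeasure M D\<close>.\<close>
    have "emeasure M C \<noteq> \<infinity>" using Z(2) eqs(1) by auto
    then have "emeasure M (Z - C) \<le> emeasure M (D - f ` C)"
      using le unfolding eqs by (simp add: ennreal_add_left_cancel_le)
    then have pos': "0 < emeasure M (D - f ` C)" using pos by simp
    obtain g where g: "g \<in> Gam" "0 < emeasure M (g ` (Z - C) \<inter> (D - f ` C))"
      by (rule transport[OF _ pos _ pos']) (use Z C D in auto)
    define K where "K = (Z - C) \<inter> (g -` (D - f ` C) \<inter> space M)"
    have K: "K \<in> sets M" using Z C D g by (auto simp: K_def)
    have "g ` K = g ` (Z - C) \<inter> (D - f ` C)"
      using sets_space[OF Z(1)] by (auto simp: K_def)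
    then have Kpos: "0 < emeasure M K" using g K Gam_emeasure[OF g(1) K] by simp
    let ?h = "\<lambda>x. if x \<in> C then f x else g x"
    have disj: "C \<inter> K = {}" by (auto simp: K_def)
    have "pw C ?h" by (rule pw_cong[OF Cf(1)]) simp
    moreover have "pw K ?h" by (rule pw_cong[OF pw_Gam[OF g(1) K]]) (use disj in auto)
    moreover have "inj_on ?h (C \<union> K)"
    proof (subst inj_on_Un, intro conjI)
      show "inj_on ?h C" "inj_on ?h K" using pw_inj calculation by auto
      have "?h ` (C - K) \<subseteq> f ` C" by auto
      moreover have "?h ` (K - C) \<subseteq> D - f ` C" by (auto simp: K_def)
      ultimately show "?h ` (C - K) \<inter> ?h ` (K - C) = {}" by blast
    qed
    ultimately have "pw (C \<union> K) ?h" by (rule pw_Un)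
    then have "(C \<union> K, ?h) \<in> ?S" using Cf by (auto simp: K_def)
    then have "emeasure M (fst (C \<union> K, ?h) - fst p) = 0"
      using bspec[OF max, of "(C \<union> K, ?h)"] by (auto simp: p)
    moreover have "C \<union> K - C = K" using disj by auto
    ultimately show False using Kpos by (simp add: p)
  qed
  then show ?thesis using that Cf by blast
qed

text \<open>If \<open>Z\<close> has infinite measure, so has \<open>D\<close>. Then \<open>Z\<close>
  is cut into countably many pieces of finite measure and \<open>D\<close> supplies disjoint sets of
  the same measures, so that the finite case applies piece by piece.\<close>

lemma embed:
  assumes Z: "Z \<in> sets M" and D: "D \<in> sets M" and le: "emeasure M Z \<le> emeasure M D"
  obtains C f where "pw C f" "C \<subseteq> Z" "emeasure M (Z - C) = 0" "f ` C \<subseteq> D"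
proof (cases "emeasure M Z < \<infinity>")
  case True
  show ?thesis by (rule embed_finite[OF Z True D le]) (rule that)
next
  case False
  then have inf: "emeasure M D = \<infinity>" using le by (simp add: not_less top_unique)
  obtain A :: "nat \<Rightarrow> 'a set" where A: "range A \<subseteq> sets M" "(\<Union>i. A i) = space M"
    "\<And>i. emeasure M (A i) \<noteq> \<infinity>" "disjoint_family A"
    using sigma_finite_disjoint by blast
  have fin: "emeasure M (Z \<inter> A n) < \<infinity>" for n
  proof -
    have "emeasure M (Z \<inter> A n) \<le> emeasure M (A n)" using A(1) by (intro emeasure_mono) auto
    then show ?thesis using A(3)[of n] by (simp add: less_top le_less_trans top.not_eq_extremum)
  qed
  obtain E where E: "\<And>n. E n \<in> sets M" "\<And>n. E n \<subseteq> D" "disjoint_family E" "\<And>n. emeasure M (E n) = emeasure M (Z \<inter> A n)"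
    by (rule ex_disjoint_subsets[OF D inf, of "\<lambda>n. emeasure M (Z \<inter> A n)"]) (use fin in auto)
  have "\<exists>p. pw (fst p) (snd p) \<and> fst p \<subseteq> Z \<inter> A n \<and> emeasure M (Z \<inter> A n - fst p) = 0 \<and> snd p ` fst p \<subseteq> E n" for n
    by (rule embed_finite[OF _ fin E(1), of n n]) (use Z A E(4) in auto)
  then have "\<forall>n. \<exists>p. pw (fst p) (snd p) \<and> fst p \<subseteq> Z \<inter> A n \<and> emeasure M (Z \<inter> A n - fst p) = 0 \<and> snd p ` fst p \<subseteq> E n"
    by (rule allI)
  from choice[OF this] obtain p where p: "\<forall>n. pw (fst (p n)) (snd (p n)) \<and> fst (p n) \<subseteq> Z \<inter> A n \<and>
      emeasure M (Z \<inter> A n - fst (p n)) = 0 \<and> snd (p n) ` fst (p n) \<subseteq> E n"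
    by (rule exE)
  define C f where "C n = fst (p n)" and "f n = snd (p n)" for n
  have Cf: "pw (C n) (f n)" "C n \<subseteq> Z \<inter> A n" "emeasure M (Z \<inter> A n - C n) = 0" "f n ` C n \<subseteq> E n" for n
    using spec[OF p, of n] by (simp_all add: C_def f_def)
  have "disjoint_family C" by (rule disjoint_family_subset[OF A(4)]) (use Cf(2) in auto)
  moreover have "disjoint_family (\<lambda>n. f n ` C n)" by (rule disjoint_family_subset[OF E(3) Cf(4)])
  ultimately obtain h where h: "pw (\<Union>n. C n) h" "\<forall>n. \<forall>x\<in>C n. h x = f n x"
    by (rule pw_glue[OF Cf(1)])
  have "Z \<inter> A n - C n \<in> null_sets M" for n
    using Cf(3)[of n] pw_sets[OF Cf(1)] A(1) Z by (intro null_setsI sets.Diff sets.Int) auto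
  then have N: "(\<Union>n. Z \<inter> A n - C n) \<in> null_sets M" by (intro null_sets_UN)
  have "Z - (\<Union>n. C n) \<subseteq> (\<Union>n. Z \<inter> A n - C n)"
  proof
    fix x assume x: "x \<in> Z - (\<Union>n. C n)"
    then have "x \<in> (\<Union>i. A i)" using A(2) sets_space[OF Z] by simp
    then obtain n where "x \<in> A n" by (rule UN_E)
    then show "x \<in> (\<Union>n. Z \<inter> A n - C n)" using x by (intro UN_I[of n]) auto
  qed
  then have "Z - (\<Union>n. C n) \<in> null_sets M"
    using N Z pw_sets[OF h(1)] by (intro null_sets_subset[OF N]) auto
  moreover have "h ` (\<Union>n. C n) \<subseteq> D" using h(2) Cf(4) E(2) by fastforce
  ultimately show ?thesis using that[OF h(1)] Cf(2) by blast
qed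

section \<open>Wandering sets and corrections on null sets\<close>

text \<open>Take a maximal \<open>A\<close> disjoint from its image under \<open>g\<close>. Points
  of the support outside \<open>A\<close> and its images under \<open>g\<close> and
  \<open>iv g\<close> lie in some \<open>U n\<close> that does not contain their image; for each
  \<open>n\<close> they could be added to \<open>A\<close>, so they form a null set. Three sets of
  the measure of \<open>A\<close> thus cover almost all of the support, whence the factor 3.\<close>

lemma wandering:
  assumes g: "g \<in> Gam"
  obtains A where "A \<in> sets M" "A \<inter> g ` A = {}" "emeasure M (supp M g) \<le> 3 * emeasure M A"
proof -
  let ?S = "{A \<in> sets M. A \<inter> g ` A = {}}"
  have "\<exists>A\<in>?S. {} \<subseteq> A \<and> (\<forall>B\<in>?S. A \<subseteq> B \<longrightarrow> emeasure M (B - A) = 0)"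
  proof (rule ae_maximal[where m = "\<lambda>B. B"])
    fix s :: "nat \<Rightarrow> 'a set"
    assume s: "\<And>n. s n \<in> ?S" "\<And>n. s n \<subseteq> s (Suc n)"
    have mono: "s m \<subseteq> s n" if "m \<le> n" for m n using s(2) that by (rule lift_Suc_mono_le)
    have "x \<noteq> g y" if "x \<in> s m" "y \<in> s n" for x y m n
      using mono[of m "max m n"] mono[of n "max m n"] that s(1)[of "max m n"] by auto
    then have "(\<Union>n. s n) \<inter> g ` (\<Union>n. s n) = {}" by blast
    then have "(\<Union>n. s n) \<in> ?S" using s(1) by auto
    then show "\<exists>u\<in>?S. \<forall>n. s n \<subseteq> u" by (rule bexI[rotated]) auto
  qed auto
  then obtain A where "A \<in> ?S" and max: "\<forall>B\<in>?S. A \<subseteq> B \<longrightarrow> emeasure M (B - A) = 0"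
    by (elim bexE conjE) (rule that)
  then have A: "A \<in> sets M" "A \<inter> g ` A = {}" by auto
  obtain U :: "nat \<Rightarrow> 'a set" where U: "\<And>n. U n \<in> sets M"
    "\<And>x y. x \<in> space M \<Longrightarrow> y \<in> space M \<Longrightarrow> x \<noteq> y \<Longrightarrow> \<exists>n. x \<in> U n \<and> y \<notin> U n"
    by (rule ex_separating_sets) auto
  let ?P = "supp M g - (A \<union> g ` A \<union> iv g ` A)"
  have P: "?P \<in> sets M" using supp_sets[OF g] A g by (intro sets.Diff sets.Un) auto
  have "?P \<inter> (U n - (g -` U n \<inter> space M)) \<in> null_sets M" for n
  proof -
    let ?Q = "?P \<inter> (U n - (g -` U n \<inter> space M))"
    have Q: "?Q \<in> sets M" using U(1) g by (intro sets.Int[OF P] sets.Diff Gam_vimage)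
    have "(A \<union> ?Q) \<inter> g ` (A \<union> ?Q) = {}"
    proof -
      have "g x \<notin> A" if "x \<in> ?Q" for x
      proof
        assume "g x \<in> A"
        then have "iv g (g x) \<in> iv g ` A" by blast
        then show False using that g sets_space[OF Q that] by auto
      qed
      moreover have "g x \<notin> ?Q" if "x \<in> ?Q" for x using that sets_space[OF Q that] by auto
      moreover have "g x \<notin> ?Q" if "x \<in> A" for x using that by auto
      ultimately show ?thesis using A(2) by blast
    qed
    then have "A \<union> ?Q \<in> ?S" using A(1) Q by simp
    then have "emeasure M (A \<union> ?Q - A) = 0" using bspec[OF max, of "A \<union> ?Q"] by simp
    moreover have "A \<union> ?Q - A = ?Q" by auto
    ultimately show ?thesis using Q by (simp add: null_sets_def)
  qed
  then have N: "(\<Union>n. ?P \<inter> (U n - (g -` U n \<inter> space M))) \<in> null_sets M" by (intro null_sets_UN)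
  have "?P \<subseteq> (\<Union>n. ?P \<inter> (U n - (g -` U n \<inter> space M)))"
  proof
    fix x assume x: "x \<in> ?P"
    then have "x \<in> space M" "g x \<noteq> x" by (auto simp: supp_def)
    then obtain n where "x \<in> U n" "g x \<notin> U n" using U(2)[of x "g x"] g by auto
    then show "x \<in> (\<Union>n. ?P \<inter> (U n - (g -` U n \<inter> space M)))" using x by blast
  qed
  then have P0: "?P \<in> null_sets M" using P by (intro null_sets_subset[OF N])
  have "emeasure M (supp M g) \<le> emeasure M (?P \<union> (A \<union> g ` A \<union> iv g ` A))"
    using A g by (intro emeasure_mono sets.Un[OF P] sets.Un Gam_image Gam_iv) auto
  also have "\<dots> = emeasure M (A \<union> g ` A \<union> iv g ` A)"
    using A g by (subst Un_commute) (intro emeasure_Un_null_set[OF _ P0] sets.Un Gam_image Gam_iv)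
  also have "\<dots> \<le> emeasure M (A \<union> g ` A) + emeasure M (iv g ` A)"
    using A g by (intro emeasure_subadditive) auto
  also have "\<dots> \<le> (emeasure M A + emeasure M (g ` A)) + emeasure M (iv g ` A)"
    using A g by (intro add_right_mono emeasure_subadditive) auto
  also have "\<dots> = (1 + 1 + 1) * emeasure M A" using A g by (simp only: distrib_right mult_1 Gam_emeasure Gam_iv)
  also have "(1 + 1 + 1 :: ennreal) = 3" by simp
  finally show ?thesis using that A by blast
qed

text \<open>Replacing \<open>T\<close> by the identity on the offending null set alone could destroy
  bijectivity, so the change is made on the union of its images under all powers of
  \<open>T\<close>, which is still null.\<close>

lemma null_modification:
  assumes T: "T \<in> Gam" and Y: "Y \<in> sets M" and null: "emeasure M (supp M T - Y) = 0"
  obtains T' where "T' \<in> Gam" "supp M T' \<subseteq> Y" "AE x in M. T' x = T x"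
proof -
  define E where "E = rec_nat (supp M T - Y) (\<lambda>_ A. A \<union> T ` A \<union> iv T ` A)"
  have E0: "E 0 = supp M T - Y" and ES: "E (Suc n) = E n \<union> T ` E n \<union> iv T ` E n" for n
    by (simp_all add: E_def)
  have En: "E n \<in> null_sets M" for n
  proof (induction n)
    case 0 then show ?case using supp_sets[OF T] Y null by (auto simp: E0 null_sets_def)
  next
    case (Suc n)
    have "T ` E n \<in> null_sets M" "iv T ` E n \<in> null_sets M" using Suc T by (auto simp: null_sets_def)
    then show ?case unfolding ES using Suc by (intro null_sets.Un)
  qed
  define Z where "Z = (\<Union>n. E n)"
  have Z: "Z \<in> null_sets M" unfolding Z_def using En by (intro null_sets_UN)
  then have Zs: "Z \<in> sets M" by auto
  have ZT: "T x \<in> Z" "iv T x \<in> Z" if xZ: "x \<in> Z" for x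
  proof -
    obtain n where "x \<in> E n" using xZ by (auto simp: Z_def)
    then have "T x \<in> E (Suc n)" "iv T x \<in> E (Suc n)" by (auto simp: ES)
    then show "T x \<in> Z" "iv T x \<in> Z" unfolding Z_def by blast+
  qed
  have ZT': "T x \<notin> Z" "iv T x \<notin> Z" if "x \<in> space M" "x \<notin> Z" for x
    using ZT(2)[of "T x"] ZT(1)[of "iv T x"] that T by auto
  let ?T = "\<lambda>x\<in>space M. if x \<in> Z then x else T x"
  have inj: "inj_on ?T (space M)"
    using ZT' T by (auto simp: inj_on_def Gam_eq_iff)
  have "pw Z ?T" by (rule pw_cong[OF pw_ident[OF Zs]]) (use sets_space[OF Zs] in auto)
  moreover have "pw (space M - Z) ?T" by (rule pw_cong[OF pw_Gam[OF T]]) (use Zs in auto)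
  moreover have "Z \<union> (space M - Z) = space M" using sets_space[OF Zs] by auto
  ultimately have "pw (space M) ?T" using inj pw_Un[of Z ?T "space M - Z"] by simp
  moreover have "?T ` space M = space M"
  proof
    show "?T ` space M \<subseteq> space M" using T by auto
    show "space M \<subseteq> ?T ` space M"
    proof
      fix x assume x: "x \<in> space M"
      show "x \<in> ?T ` space M"
      proof (cases "x \<in> Z")
        case True then show ?thesis using x by (intro image_eqI[of _ _ x]) auto
      next
        case False
        then show ?thesis using x T ZT'(2)[OF x] by (intro image_eqI[of _ _ "iv T x"]) auto
      qed
    qed
  qed
  ultimately have G: "?T \<in> Gam" by (intro Gam_of_pw) auto
  moreover have "supp M ?T \<subseteq> Y"
  proof
    fix x assume "x \<in> supp M ?T"
    then have x: "x \<in> space M" "x \<notin> Z" "T x \<noteq> x" by (auto simp: supp_def split: if_splits)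
    then have "x \<notin> E 0" by (auto simp: Z_def)
    then show "x \<in> Y" using x by (auto simp: E0 supp_def)
  qed
  moreover have "AE x in M. ?T x = T x"
    by (rule AE_I'[OF Z]) auto
  ultimately show ?thesis by (rule that)
qed

section \<open>Commutators and the swindle\<close>

text \<open>With \<open>a = g \<star> iv h \<star> iv g\<close> one has
  \<open>c = a \<star> h\<close>. The support of \<open>a\<close> lies in the image of
  \<open>A\<close> under \<open>g\<close>, hence is disjoint from the supports of \<open>h\<close>
  and \<open>w\<close>; so \<open>a\<close> commutes with both and cancels from the commutator of
  \<open>c\<close> and \<open>w\<close>. The bracketing displays \<open>c\<close> as
  \<open>g\<close> times a conjugate of \<open>iv g\<close>.\<close>

lemma commutator_identity:
  assumes g: "g \<in> Gam" and A: "A \<in> sets M" "A \<inter> g ` A = {}"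
    and h: "h \<in> Gam" "supp M h \<subseteq> A" and w: "w \<in> Gam" "supp M w \<subseteq> A"
  defines "c \<equiv> g \<star> (iv h \<star> iv g \<star> h)"
  shows "c \<star> (w \<star> iv c \<star> iv w) = h \<star> w \<star> iv h \<star> iv w"
proof -
  define a where "a = g \<star> iv h \<star> iv g"
  have a: "a \<in> Gam" using g h by (simp add: a_def)
  have c: "c = a \<star> h" unfolding c_def a_def
    using g h by (simp add: mp.m_assoc Gam_carrier)
  have ivc: "iv c = iv h \<star> iv a" unfolding c using a h by (simp add: mp.inv_mult_group Gam_carrier)
  have "supp M a = g ` supp M (iv h)" unfolding a_def using g h by (intro supp_conj) auto
  then have sa: "supp M a \<subseteq> g ` A" using h by (auto simp: supp_iv)
  have sia: "supp M (iv a) \<subseteq> g ` A" using sa a by (simp add: supp_iv)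
  have sih: "supp M (iv h) \<subseteq> A" using h by (simp add: supp_iv)
  have gA: "g ` A \<in> sets M" using g A by simp
  have key: "a (h (w (iv h (iv a y)))) = h (w (iv h y))" if y: "y \<in> space M" for y
  proof (cases "y \<in> g ` A")
    case True
    then have ay: "iv a y \<in> g ` A" using supp_mem[OF _ sia _ y] a by simp
    then have ay': "iv a y \<notin> A" "iv a y \<in> space M" "y \<notin> A" using A(2) y a True by auto
    then have "iv h (iv a y) = iv a y" "w (iv a y) = iv a y" "h (iv a y) = iv a y"
      "iv h y = y" "w y = y" "h y = y"
      using y supp_fix[OF sih] supp_fix[OF w(2)] supp_fix[OF h(2)] by auto
    then show ?thesis using a y by simp
  next
    case False
    let ?z = "h (w (iv h y))"
    have "?z \<notin> g ` A"
    proof (cases "y \<in> A")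
      case True
      have "iv h y \<in> A" using supp_mem[OF _ sih True y] h by simp
      then have "w (iv h y) \<in> A" using supp_mem[OF w(1,2)] y h by simp
      then have "?z \<in> A" using supp_mem[OF h(1,2)] y h w by simp
      then show ?thesis using A(2) by blast
    next
      case F: False
      then have "iv h y = y" "w y = y" "h y = y"
        using y supp_fix[OF sih] supp_fix[OF w(2)] supp_fix[OF h(2)] by auto
      then show ?thesis using False by simp
    qed
    then have "a ?z = ?z" using supp_fix[OF sa] y h w by simp
    moreover have "iv a y = y" using supp_fix[OF sia y False] .
    ultimately show ?thesis by simp
  qed
  show ?thesis
  proof (rule Gam_eqI)
    show "c \<star> (w \<star> iv c \<star> iv w) \<in> Gam" unfolding c using a h w by simp
    show "h \<star> w \<star> iv h \<star> iv w \<in> Gam" using h w by simp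
    fix x assume x: "x \<in> space M"
    have "(c \<star> (w \<star> iv c \<star> iv w)) x = a (h (w (iv h (iv a (iv w x)))))"
      unfolding ivc unfolding c using a h w x by simp
    then show "(c \<star> (w \<star> iv c \<star> iv w)) x = (h \<star> w \<star> iv h \<star> iv w) x"
      using key[of "iv w x"] h w x by simp
  qed
qed

section \<open>Countably many copies and the shift between them\<close>

text \<open>Sources and targets are both parametrised by \<open>Y n\<close>, so that one flip makes
  countably many exchanges and its values can be read off without inverse functions.\<close>

lemma flip_family:
  fixes Y :: "nat \<Rightarrow> 'a set"
  assumes a: "\<And>n. pw (Y n) (\<alpha> n)" "disjoint_family (\<lambda>n. \<alpha> n ` Y n)"
    and b: "\<And>n. pw (Y n) (\<beta> n)" "disjoint_family (\<lambda>n. \<beta> n ` Y n)"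
    and ab: "\<And>m n. \<alpha> m ` Y m \<inter> \<beta> n ` Y n = {}"
  obtains f where "flippable (\<Union>n. \<alpha> n ` Y n) f" "\<forall>n. \<forall>y\<in>Y n. f (\<alpha> n y) = \<beta> n y"
    "f ` (\<Union>n. \<alpha> n ` Y n) = (\<Union>n. \<beta> n ` Y n)"
proof -
  let ?f = "\<lambda>n x. \<beta> n (inv_into (Y n) (\<alpha> n) x)"
  have f: "?f n (\<alpha> n y) = \<beta> n y" if "y \<in> Y n" for n y
    using that pw_inj[OF a(1)] by (simp add: inv_into_f_f)
  have pw: "pw (\<alpha> n ` Y n) (?f n)" for n
    by (rule pw_compose[OF pw_inv[OF a(1)] b(1)]) (auto simp: inv_into_f_f[OF pw_inj[OF a(1)]])
  have im: "?f n ` \<alpha> n ` Y n = \<beta> n ` Y n" for n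
    using f by (force simp: image_image)
  obtain h where h: "pw (\<Union>n. \<alpha> n ` Y n) h" "\<forall>n. \<forall>x\<in>\<alpha> n ` Y n. h x = ?f n x"
    by (rule pw_glue[OF pw a(2)]) (use b(2) im in auto)
  have hf: "h (\<alpha> n y) = \<beta> n y" if "y \<in> Y n" for n y using h(2) f that by auto
  have him: "h ` (\<Union>n. \<alpha> n ` Y n) = (\<Union>n. \<beta> n ` Y n)"
    using hf by (force simp: image_UN image_image)
  have "flippable (\<Union>n. \<alpha> n ` Y n) h" unfolding flippable_def him using h(1) ab by blast
  then show ?thesis using that hf him by blast
qed

text \<open>This is the infinite product of the \<open>h n\<close>, each transferred to its own
  copy. Since \<open>Y n\<close> contains the support of \<open>h n\<close>, it is permuted by
  \<open>h n\<close>, so the transferred maps permute disjoint copies.\<close>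

lemma glue_conjugates:
  fixes Y :: "nat \<Rightarrow> 'a set"
  assumes \<phi>: "\<And>n. pw (Y n) (\<phi> n)" "disjoint_family (\<lambda>n. \<phi> n ` Y n)"
    and h: "\<And>n. h n \<in> Gam" "\<And>n. supp M (h n) \<subseteq> Y n"
  obtains P where "P \<in> Gam" "\<forall>n. \<forall>y\<in>Y n. P (\<phi> n y) = \<phi> n (h n y)" "supp M P \<subseteq> (\<Union>n. \<phi> n ` Y n)"
proof -
  let ?D = "\<Union>n. \<phi> n ` Y n"
  have Y: "Y n \<in> sets M" for n using pw_sets[OF \<phi>(1)] .
  have hY: "h n ` Y n = Y n" for n
    using supp_image[OF h(1) h(2)] sets.sets_into_space[OF Y] by simp
  have hYmem: "h n y \<in> Y n" if "y \<in> Y n" for n y using imageI[OF that, of "h n"] by (simp only: hY)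
  let ?f = "\<lambda>n x. \<phi> n (h n (inv_into (Y n) (\<phi> n) x))"
  have f: "?f n (\<phi> n y) = \<phi> n (h n y)" if "y \<in> Y n" for n y
    using that pw_inj[OF \<phi>(1)] by (simp add: inv_into_f_f)
  have "pw (\<phi> n ` Y n) (\<lambda>x. h n (inv_into (Y n) (\<phi> n) x))" for n
    by (rule pw_compose[OF pw_inv[OF \<phi>(1)] pw_Gam[OF h(1) Y]]) (auto simp: inv_into_f_f[OF pw_inj[OF \<phi>(1)]])
  then have pw: "pw (\<phi> n ` Y n) (?f n)" for n
    by (rule pw_compose[OF _ \<phi>(1)]) (auto simp: inv_into_f_f[OF pw_inj[OF \<phi>(1)]] hYmem)
  have im: "?f n ` \<phi> n ` Y n = \<phi> n ` Y n" for n
  proof -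
    have "?f n ` \<phi> n ` Y n = \<phi> n ` h n ` Y n" using f by (force simp: image_image)
    then show ?thesis by (simp add: hY)
  qed
  obtain k where k: "pw ?D k" "\<forall>n. \<forall>x\<in>\<phi> n ` Y n. k x = ?f n x"
    by (rule pw_glue[OF pw \<phi>(2)]) (use \<phi>(2) im in auto)
  have "k ` ?D = (\<Union>n. ?f n ` \<phi> n ` Y n)" using k(2) by (force simp: image_UN)
  then have kim: "k ` ?D = ?D" by (simp only: im)
  have D: "?D \<in> sets M" using pw_sets[OF k(1)] .
  define P where "P = (\<lambda>x\<in>space M. if x \<in> ?D then k x else x)"
  have DS: "x \<in> space M" if "x \<in> ?D" for x using sets_space[OF D that] .
  have PD: "P x = k x" if "x \<in> ?D" for x using that DS[OF that] by (simp add: P_def)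
  have Pn: "P x = x" if "x \<in> space M" "x \<notin> ?D" for x using that by (simp add: P_def)
  have "P ` ?D = k ` ?D" using PD by (rule image_cong[OF refl])
  then have imD: "P ` ?D = ?D" using kim by simp
  have "P ` (space M - ?D) = (\<lambda>x. x) ` (space M - ?D)" using Pn by (intro image_cong) auto
  then have imn: "P ` (space M - ?D) = space M - ?D" by simp
  have sp: "?D \<union> (space M - ?D) = space M" using DS by blast
  have p1: "pw ?D P" by (rule pw_cong[OF k(1)]) (simp only: PD)
  have p2: "pw (space M - ?D) P" by (rule pw_cong[OF pw_ident]) (use D Pn in auto)
  have "inj_on P (?D \<union> (space M - ?D))"
  proof (rule inj_onI)
    fix x y assume "x \<in> ?D \<union> (space M - ?D)" "y \<in> ?D \<union> (space M - ?D)" and eq: "P x = P y"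
    then have xy: "x \<in> space M" "y \<in> space M" by (simp_all only: sp)
    have mem: "P z \<in> ?D \<longleftrightarrow> z \<in> ?D" if "z \<in> space M" for z
    proof (cases "z \<in> ?D")
      case True then show ?thesis using imageI[OF True, of P] by (simp only: imD)
    next
      case False then show ?thesis by (simp only: Pn[OF that False])
    qed
    show "x = y"
    proof (cases "x \<in> ?D")
      case True
      then have "y \<in> ?D" using mem[OF xy(1)] mem[OF xy(2)] eq by (simp only:)
      then show ?thesis using inj_onD[OF pw_inj[OF p1] eq True] by (simp only:)
    next
      case False
      then have "y \<notin> ?D" using mem[OF xy(1)] mem[OF xy(2)] eq by (simp only: not_False_eq_True)
      then show ?thesis using eq unfolding Pn[OF xy(1) False] Pn[OF xy(2) \<open>y \<notin> ?D\<close>] by blast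
    qed
  qed
  then have "pw (space M) P" using pw_Un[OF p1 p2] sp by simp
  moreover have "P ` space M = space M"
  proof -
    have "P ` (?D \<union> (space M - ?D)) = ?D \<union> (space M - ?D)" by (simp only: image_Un imD imn)
    then show ?thesis by (simp only: sp)
  qed
  moreover have "P \<in> extensional (space M)" by (auto simp: P_def)
  ultimately have G: "P \<in> Gam" by (intro Gam_of_pw)
  have "P (\<phi> n y) = \<phi> n (h n y)" if "y \<in> Y n" for n y
  proof -
    have "\<phi> n y \<in> ?D" using that by blast
    then have "P (\<phi> n y) = k (\<phi> n y)" by (rule PD)
    also have "\<dots> = \<phi> n (h n y)" using k(2) f[OF that] that by simp
    finally show ?thesis .
  qed
  moreover have "supp M P \<subseteq> ?D"
  proof
    fix x assume x: "x \<in> supp M P"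
    show "x \<in> ?D"
    proof (rule ccontr)
      assume nx: "x \<notin> ?D"
      have "x \<in> space M" "P x \<noteq> x" using x by (simp_all add: supp_def)
      show False by (rule notE[OF \<open>P x \<noteq> x\<close> Pn[OF \<open>x \<in> space M\<close> nx]])
    qed
  qed
  ultimately show ?thesis using that[OF G] by blast
qed

text \<open>An element \<open>V\<close> shifts the copy of \<open>Y (Suc n)\<close> with index
  \<open>n\<close> to the one with index \<open>Suc n\<close>. Conjugating \<open>Q\<close> by
  \<open>V\<close> yields \<open>P\<close> without its action on copy 0, so \<open>P0\<close> is the
  quotient of the two. Sources and targets of the shift overlap, hence it is no flip; a detour
  through the copies given by \<psi> writes it as two flips.\<close>

lemma swindle:
  fixes Y :: "nat \<Rightarrow> 'a set"
  assumes Y: "\<And>n. Y (Suc n) \<subseteq> Y n"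
    and \<phi>: "\<And>n. pw (Y n) (\<phi> n)" "disjoint_family (\<lambda>n. \<phi> n ` Y n)"
    and \<psi>: "\<And>n. pw (Y n) (\<psi> n)" "disjoint_family (\<lambda>n. \<psi> n ` Y n)"
    and \<phi>\<psi>: "\<And>m n. \<phi> m ` Y m \<inter> \<psi> n ` Y n = {}"
    and h: "\<And>n. h n \<in> Gam" "\<And>n. supp M (h n) \<subseteq> Y n"
    and P0: "P0 \<in> Gam" "\<And>y. y \<in> Y 0 \<Longrightarrow> P0 (\<phi> 0 y) = \<phi> 0 (h 0 y)" "supp M P0 \<subseteq> \<phi> 0 ` Y 0"
    and P: "P \<in> Gam" "\<And>n y. y \<in> Y n \<Longrightarrow> P (\<phi> n y) = \<phi> n (h n y)" "supp M P \<subseteq> (\<Union>n. \<phi> n ` Y n)"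
    and Q: "Q \<in> Gam" "\<And>n y. y \<in> Y (Suc n) \<Longrightarrow> Q (\<phi> n y) = \<phi> n (h (Suc n) y)" "supp M Q \<subseteq> (\<Union>n. \<phi> n ` Y (Suc n))"
  obtains C1 f1 C2 f2 where "flippable C1 f1" "flippable C2 f2"
    "C1 \<union> f1 ` C1 \<union> C2 \<union> f2 ` C2 \<subseteq> (\<Union>n. \<phi> n ` Y n \<union> \<psi> n ` Y n)"
    "P0 = P \<star> (flip C2 f2 \<star> flip C1 f1) \<star> iv Q \<star> iv (flip C2 f2 \<star> flip C1 f1)"
proof -
  have Ys: "Y n \<in> sets M" for n using pw_sets[OF \<phi>(1)] .
  have sub: "pw (Y (Suc n)) (\<phi> n)" for n using pw_subset[OF \<phi>(1) Ys Y] .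
  have d\<phi>: "disjoint_family (\<lambda>n. \<phi> n ` Y (Suc n))"
    by (rule disjoint_family_subset[OF \<phi>(2)]) (use Y in auto)
  have d\<phi>': "disjoint_family (\<lambda>n. \<phi> (Suc n) ` Y (Suc n))" "disjoint_family (\<lambda>n. \<psi> (Suc n) ` Y (Suc n))"
    using \<phi>(2) \<psi>(2) by (auto simp: disjoint_family_on_def)
  have e1: "\<phi> m ` Y (Suc m) \<inter> \<psi> (Suc n) ` Y (Suc n) = {}" for m n using \<phi>\<psi>[of m "Suc n"] Y[of m] by blast
  have e2: "\<psi> (Suc m) ` Y (Suc m) \<inter> \<phi> (Suc n) ` Y (Suc n) = {}" for m n using \<phi>\<psi>[of "Suc n" "Suc m"] by blast
  let ?C1 = "\<Union>n. \<phi> n ` Y (Suc n)" and ?C2 = "\<Union>n. \<psi> (Suc n) ` Y (Suc n)"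
  obtain f1 where f1: "flippable ?C1 f1" "\<forall>n. \<forall>y\<in>Y (Suc n). f1 (\<phi> n y) = \<psi> (Suc n) y" "f1 ` ?C1 = ?C2"
    by (rule flip_family[OF sub d\<phi> \<psi>(1) d\<phi>'(2) e1])
  obtain f2 where f2: "flippable ?C2 f2" "\<forall>n. \<forall>y\<in>Y (Suc n). f2 (\<psi> (Suc n) y) = \<phi> (Suc n) y"
    "f2 ` ?C2 = (\<Union>n. \<phi> (Suc n) ` Y (Suc n))"
    by (rule flip_family[OF \<psi>(1) d\<phi>'(2) \<phi>(1) d\<phi>'(1) e2])
  define V where "V = flip ?C2 f2 \<star> flip ?C1 f1"
  have V: "V \<in> Gam" unfolding V_def using f1 f2 flip_Gam by simp
  have \<phi>S: "\<phi> n y \<in> space M" if "y \<in> Y n" for n y using that sets_space[OF pw_image[OF \<phi>(1)]] by blast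
  have V\<phi>: "V (\<phi> n y) = \<phi> (Suc n) y" if y: "y \<in> Y (Suc n)" for n y
  proof -
    have "\<phi> n y \<in> space M" using \<phi>S y Y by blast
    then have "V (\<phi> n y) = flip ?C2 f2 (flip ?C1 f1 (\<phi> n y))"
      unfolding V_def using flip_Gam f1(1) f2(1) by simp
    also have "flip ?C1 f1 (\<phi> n y) = \<psi> (Suc n) y" using flip_on[OF f1(1), of "\<phi> n y"] f1(2) y by auto
    also have "flip ?C2 f2 (\<psi> (Suc n) y) = \<phi> (Suc n) y" using flip_on[OF f2(1), of "\<psi> (Suc n) y"] f2(2) y by auto
    finally show ?thesis .
  qed
  have PP0: "P0 z = P z" if z: "z \<in> space M" "z \<notin> (\<Union>n. \<phi> (Suc n) ` Y (Suc n))" for z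
  proof (cases "z \<in> \<phi> 0 ` Y 0")
    case True then show ?thesis using P0(2) P(2)[of _ 0] by auto
  next
    case False
    have "z \<notin> \<phi> n ` Y n" for n using False z(2) by (cases n) auto
    then have "z \<notin> (\<Union>n. \<phi> n ` Y n)" by blast
    then show ?thesis using supp_fix[OF P(3) z(1)] supp_fix[OF P0(3) z(1) False] by simp
  qed
  have hY: "h (Suc n) y \<in> Y (Suc n)" if "y \<in> Y (Suc n)" for n y
    using supp_mem[OF h(1,2) that] sets_space[OF Ys that] by simp
  \<comment> \<open>On the domain of the shift both sides send \<open>\<phi> n y\<close> to
    \<open>\<phi> (Suc n) (h (Suc n) y)\<close>. Elsewhere \<open>Q\<close> is trivial and
    \<open>V\<close> avoids the copies of positive index, off which \<open>P0\<close> and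
    \<open>P\<close> agree.\<close>
  have "P0 \<star> V \<star> Q = P \<star> V"
  proof (rule Gam_eqI)
    fix x assume x: "x \<in> space M"
    show "(P0 \<star> V \<star> Q) x = (P \<star> V) x"
    proof (cases "x \<in> ?C1")
      case True
      then obtain n y where y: "y \<in> Y (Suc n)" "x = \<phi> n y" by auto
      have "P0 (\<phi> (Suc n) y') = \<phi> (Suc n) y'" if "y' \<in> Y (Suc n)" for y'
      proof (rule supp_fix[OF P0(3)])
        show "\<phi> (Suc n) y' \<in> space M" using \<phi>S that by blast
        have "\<phi> (Suc n) ` Y (Suc n) \<inter> \<phi> 0 ` Y 0 = {}" using \<phi>(2) unfolding disjoint_family_on_def by blast
        then show "\<phi> (Suc n) y' \<notin> \<phi> 0 ` Y 0" using that by blast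
      qed
      then have "P0 (V (Q x)) = \<phi> (Suc n) (h (Suc n) y)"
        using y Q(2) V\<phi> hY by simp
      moreover have "P (V x) = \<phi> (Suc n) (h (Suc n) y)" using y V\<phi> P(2) by simp
      ultimately show ?thesis using x V P0 P Q by simp
    next
      case False
      then have Qx: "Q x = x" using supp_fix[OF Q(3) x] by simp
      have "V x \<notin> (\<Union>n. \<phi> (Suc n) ` Y (Suc n))"
      proof
        assume "V x \<in> (\<Union>n. \<phi> (Suc n) ` Y (Suc n))"
        then obtain n y where y: "y \<in> Y (Suc n)" "V x = \<phi> (Suc n) y" by auto
        then have "V x = V (\<phi> n y)" using V\<phi> by simp
        moreover have "\<phi> n y \<in> space M" using y \<phi>S Y by blast
        ultimately have "x = \<phi> n y" using Gam_eq_iff[OF V x] by simp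
        then show False using False y by blast
      qed
      then show ?thesis using PP0[of "V x"] Qx x V P0 P Q by simp
    qed
  qed (use P0 P Q V in auto)
  then have "P0 \<star> (V \<star> Q) = P \<star> V" using P0 P Q V by (simp add: mp.m_assoc Gam_carrier)
  moreover have "P0 = P \<star> V \<star> iv (V \<star> Q) \<longleftrightarrow> P \<star> V = P0 \<star> (V \<star> Q)"
    using P0(1) P(1) Q(1) V by (intro mp.inv_solve_right Gam_carrier Gam_mul)
  ultimately have "P0 = P \<star> V \<star> iv (V \<star> Q)" by simp
  also have "\<dots> = P \<star> V \<star> iv Q \<star> iv V" using P Q V by (simp add: mp.inv_mult_group mp.m_assoc Gam_carrier)
  finally have eq: "P0 = P \<star> V \<star> iv Q \<star> iv V" .
  have sub: "?C1 \<union> f1 ` ?C1 \<union> ?C2 \<union> f2 ` ?C2 \<subseteq> (\<Union>n. \<phi> n ` Y n \<union> \<psi> n ` Y n)"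
  proof -
    have s1: "?C1 \<subseteq> (\<Union>n. \<phi> n ` Y n)" by (rule UN_mono) (use Y in auto)
    have s2: "?C2 \<subseteq> (\<Union>n. \<psi> n ` Y n)"
      by (rule UN_least) (rule UN_upper[OF UNIV_I, of "\<lambda>n. \<psi> n ` Y n"])
    have s3: "(\<Union>n. \<phi> (Suc n) ` Y (Suc n)) \<subseteq> (\<Union>n. \<phi> n ` Y n)"
      by (rule UN_least) (rule UN_upper[OF UNIV_I, of "\<lambda>n. \<phi> n ` Y n"])
    show ?thesis unfolding f1(3) f2(3) UN_Un_distrib
      by (rule Un_least[OF Un_least[OF Un_least[OF le_supI1[OF s1] le_supI2[OF s2]] le_supI2[OF s2]] le_supI1[OF s3]])
  qed
  show ?thesis by (rule that[OF f1(1) f2(1) sub eq[unfolded V_def]])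
qed

section \<open>Manipulating flips\<close>

text \<open>Common values cancel in the quotient; this is how a set \<open>C\<close> is removed from
  a support.\<close>

lemma supp_iv_mul_fixed:
  assumes "S \<in> Gam" "T \<in> Gam" "\<And>x. x \<in> C \<Longrightarrow> S x = T x" "supp M S \<subseteq> Y" "supp M T \<subseteq> Y"
  shows "supp M (iv S \<star> T) \<subseteq> Y - C"
proof
  fix x assume "x \<in> supp M (iv S \<star> T)"
  then have x: "x \<in> space M" "iv S (T x) \<noteq> x" using assms(1,2) by (auto simp: supp_def)
  have "x \<notin> C"
  proof
    assume "x \<in> C"
    then have "T x = S x" using assms(3) by simp
    then show False using x assms(1) by simp
  qed
  moreover have "x \<in> Y"
  proof (rule ccontr)
    assume "x \<notin> Y"
    then have "T x = x" "S x = x" using supp_fix[OF assms(4) x(1)] supp_fix[OF assms(5) x(1)] by auto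
    then show False using x assms(1) iv_apply(1)[OF assms(1) x(1)] by simp
  qed
  ultimately show "x \<in> Y - C" by simp
qed

text \<open>As \<open>C\<close> may meet its image under \<open>T\<close>, a single flip cannot in
  general agree with \<open>T\<close> on \<open>C\<close>. The image of \<open>C\<close> under
  \<open>k\<close> is disjoint from both and serves as an intermediate stop.\<close>

lemma two_flips:
  assumes T: "T \<in> Gam" and k: "pw C k" and disj: "k ` C \<inter> C = {}" "k ` C \<inter> T ` C = {}"
  obtains f where "flippable C k" "flippable (k ` C) f" "f ` k ` C = T ` C"
    "\<And>x. x \<in> C \<Longrightarrow> (flip (k ` C) f \<star> flip C k) x = T x"
proof -
  let ?f = "\<lambda>x. T (inv_into C k x)"
  have C: "C \<in> sets M" using pw_sets[OF k] .
  have inv: "inv_into C k (k x) = x" if "x \<in> C" for x using inv_into_f_f[OF pw_inj[OF k] that] .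
  have "pw (k ` C) ?f" by (rule pw_compose[OF pw_inv[OF k] pw_Gam[OF T C]]) (auto simp: inv)
  moreover have im: "?f ` k ` C = T ` C" by (auto simp: inv image_iff)
  ultimately have f2: "flippable (k ` C) ?f" using disj by (simp only: flippable_def im)
  have f1: "flippable C k" using k disj by (auto simp: flippable_def)
  have "(flip (k ` C) ?f \<star> flip C k) x = T x" if x: "x \<in> C" for x
    using flip_Gam[OF f1] flip_Gam[OF f2] flip_on[OF f1 x] flip_on[OF f2, of "k x"] x sets_space[OF C x] inv[OF x] by simp
  then show ?thesis using that[OF f1 f2 im] by blast
qed

text \<open>A null part of the domain has a null image, so dropping it changes the flip on a null
  set only.\<close>

lemma flip_AE:
  assumes f: "flippable C f" and C': "C' \<in> sets M" "C' \<subseteq> C" and null: "emeasure M (C - C') = 0"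
  shows "flippable C' f" "AE x in M. flip C' f x = flip C f x"
proof -
  have pw: "pw C f" and disj: "C \<inter> f ` C = {}" using f by (auto simp: flippable_def)
  show f': "flippable C' f" unfolding flippable_def using pw_subset[OF pw C'] disj C' by blast
  have C: "C \<in> sets M" using pw_sets[OF pw] .
  have "pw (C - C') f" using pw_subset[OF pw] C C' by auto
  then have "f ` (C - C') \<in> null_sets M"
    using pw_image[of "C - C'" f] pw_emeasure[of "C - C'" f] null by (auto simp: null_sets_def)
  moreover have "C - C' \<in> null_sets M" using null C C' by auto
  ultimately have N: "(C - C') \<union> f ` (C - C') \<in> null_sets M" by (rule null_sets.Un[rotated])
  show "AE x in M. flip C' f x = flip C f x"
  proof (rule AE_I'[OF N], rule subsetI)
    fix x assume "x \<in> {x \<in> space M. flip C' f x \<noteq> flip C f x}"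
    then have x: "x \<in> space M" "flip C' f x \<noteq> flip C f x" by auto
    show "x \<in> (C - C') \<union> f ` (C - C')"
    proof (rule ccontr)
      assume n: "x \<notin> (C - C') \<union> f ` (C - C')"
      consider "x \<in> C'" | y where "y \<in> C'" "x = f y" | "x \<notin> C" "x \<notin> f ` C" using n by blast
      then show False
      proof cases
        case 1 then show False using x flip_on[OF f] flip_on[OF f'] C' by auto
      next
        case 2 then show False using x flip_image[OF f] flip_image[OF f'] C' by auto
      next
        case 3
        then have "x \<notin> C'" "x \<notin> f ` C'" using C' by auto
        then show False using x 3 flip_off[OF f] flip_off[OF f'] by auto
      qed
    qed
  qed
qed

lemma flip_conj:
  assumes f: "flippable C f" and \<phi>: "\<phi> \<in> Gam"
  defines "F \<equiv> \<lambda>x. \<phi> (f (iv \<phi> x))"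
  shows "flippable (\<phi> ` C) F" "F ` \<phi> ` C = \<phi> ` f ` C" "flip C f = iv \<phi> \<star> flip (\<phi> ` C) F \<star> \<phi>"
proof -
  have pw: "pw C f" and disj: "C \<inter> f ` C = {}" using f by (auto simp: flippable_def)
  have C: "C \<in> sets M" "f ` C \<in> sets M" using pw_sets[OF pw] pw_image[OF pw] .
  have CS: "x \<in> space M" "f x \<in> space M" if "x \<in> C" for x using that sets_space[OF C(1)] sets_space[OF C(2)] by auto
  have F: "F (\<phi> x) = \<phi> (f x)" if "x \<in> C" for x using CS[OF that] \<phi> by (simp add: F_def)
  show im: "F ` \<phi> ` C = \<phi> ` f ` C" using F by (auto simp: image_iff)
  have ivim: "iv \<phi> ` \<phi> ` C = C" using CS \<phi> by (force simp: image_image)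
  have "pw (\<phi> ` C) (\<lambda>x. f (iv \<phi> x))"
    by (rule pw_compose[OF pw_Gam pw]) (use \<phi> C ivim in auto)
  then have "pw (\<phi> ` C) F" unfolding F_def
    by (rule pw_compose[OF _ pw_Gam[OF \<phi> C(2)]]) (use CS \<phi> in auto)
  moreover have "\<phi> ` C \<inter> \<phi> ` f ` C = {}"
  proof -
    have "inj_on \<phi> (space M)" by (rule Gam_inj[OF \<phi>]) simp
    then show ?thesis using disj CS by (auto dest: inj_onD)
  qed
  ultimately show fF: "flippable (\<phi> ` C) F" by (simp add: flippable_def im)
  show "flip C f = iv \<phi> \<star> flip (\<phi> ` C) F \<star> \<phi>"
  proof (rule Gam_eqI)
    fix x assume x: "x \<in> space M"
    have "flip (\<phi> ` C) F (\<phi> x) = \<phi> (flip C f x)"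
    proof -
      consider "x \<in> C" | y where "y \<in> C" "x = f y" | "x \<notin> C" "x \<notin> f ` C" by blast
      then show ?thesis
      proof cases
        case 1 then show ?thesis using flip_on[OF fF, of "\<phi> x"] flip_on[OF f] F by simp
      next
        case 2
        then show ?thesis using flip_image[OF fF, of "\<phi> y"] flip_image[OF f] F by simp
      next
        case 3
        have "\<phi> x \<notin> \<phi> ` C" "\<phi> x \<notin> \<phi> ` f ` C" using 3 x CS \<phi> by (auto simp: Gam_eq_iff)
        then show ?thesis using flip_off[OF fF, of "\<phi> x"] flip_off[OF f x] 3 x \<phi> im by simp
      qed
    qed
    then show "flip C f x = (iv \<phi> \<star> flip (\<phi> ` C) F \<star> \<phi>) x"
      using x \<phi> flip_Gam[OF f] flip_Gam[OF fF] by simp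
  qed (use \<phi> flip_Gam[OF f] flip_Gam[OF fF] in auto)
qed

lemma flip_split:
  assumes f: "flippable C f" and C': "C' \<in> sets M" "C' \<subseteq> C"
  shows "flippable C' f" "flippable (C - C') f" "flip C f = flip C' f \<star> flip (C - C') f"
proof -
  have pw: "pw C f" and disj: "C \<inter> f ` C = {}" using f by (auto simp: flippable_def)
  have C: "C \<in> sets M" using pw_sets[OF pw] .
  show f1: "flippable C' f" unfolding flippable_def using pw_subset[OF pw C'] disj C' by blast
  have "C - C' \<in> sets M" using C C' by auto
  then have "pw (C - C') f" by (rule pw_subset[OF pw]) auto
  then show f2: "flippable (C - C') f" unfolding flippable_def using disj by blast
  have inj: "f x \<noteq> f y" if "x \<in> C" "y \<in> C" "x \<noteq> y" for x y using that inj_onD[OF pw_inj[OF pw]] by blast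
  have CS: "x \<in> space M" "f x \<in> space M" if "x \<in> C" for x
    using that sets_space[OF C] sets_space[OF pw_image[OF pw]] by auto
  show "flip C f = flip C' f \<star> flip (C - C') f"
  proof (rule Gam_eqI)
    fix x assume x: "x \<in> space M"
    consider "x \<in> C'" | "x \<in> C - C'" | y where "y \<in> C'" "x = f y" | y where "y \<in> C - C'" "x = f y"
      | "x \<notin> C" "x \<notin> f ` C" by blast
    then have "flip C f x = flip C' f (flip (C - C') f x)"
    proof cases
      case 1
      have "x \<notin> f ` (C - C')" using 1 disj C' by blast
      then show ?thesis using 1 x C' flip_on[OF f, of x] flip_on[OF f1 1] flip_off[OF f2 x] by auto
    next
      case 2
      then have "f x \<notin> C'" "f x \<notin> f ` C'" using disj C' inj[of x] by auto
      then show ?thesis using 2 CS[of x] flip_on[OF f, of x] flip_on[OF f2 2] flip_off[OF f1, of "f x"] by simp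
    next
      case 3
      then have "x \<notin> C - C'" "x \<notin> f ` (C - C')" using disj C' inj[of y] by auto
      then show ?thesis using 3 x C' flip_image[OF f, of y] flip_image[OF f1, of y] flip_off[OF f2 x] by auto
    next
      case 4
      then have "y \<notin> C'" "y \<notin> f ` C'" using disj C' by auto
      then show ?thesis using 4 CS[of y] flip_image[OF f, of y] flip_image[OF f2, of y] flip_off[OF f1, of y] by simp
    next
      case 5
      then have "x \<notin> C - C'" "x \<notin> f ` (C - C')" "x \<notin> C'" "x \<notin> f ` C'" using C' by auto
      then show ?thesis using 5 x flip_off[OF f x] flip_off[OF f1 x] flip_off[OF f2 x] by simp
    qed
    then show "flip C f x = (flip C' f \<star> flip (C - C') f) x"
      using x flip_Gam[OF f1] flip_Gam[OF f2] by simp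
  qed (use flip_Gam[OF f] flip_Gam[OF f1] flip_Gam[OF f2] in auto)
qed

text \<open>The flip carries the action of \<open>T\<close> from \<open>X\<close> to its image under
  \<open>f\<close>. The double inverse in the last claim has the form of a conjugation by
  \<open>iv (flip X f)\<close>, so that membership of \<open>P\<close> in a conjugation invariant
  set passes back to \<open>T\<close>.\<close>

lemma conj_flip:
  assumes T: "T \<in> Gam" "supp M T \<subseteq> X" and f: "flippable X f"
  defines "P \<equiv> flip X f \<star> T \<star> iv (flip X f)"
  shows "P \<in> Gam" "\<And>y. y \<in> X \<Longrightarrow> P (f y) = f (T y)" "supp M P \<subseteq> f ` X" "T = iv (flip X f) \<star> P \<star> iv (iv (flip X f))"
proof -
  have F: "flip X f \<in> Gam" using flip_Gam[OF f] .
  have X: "X \<in> sets M" using f pw_sets by (auto simp: flippable_def)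
  show P: "P \<in> Gam" using F T by (simp add: P_def)
  show "P (f y) = f (T y)" if y: "y \<in> X" for y
  proof -
    have ys: "y \<in> space M" using sets_space[OF X y] .
    then have fy: "flip X f y = f y" "f y \<in> space M" using flip_on[OF f y] F Gam_space[OF F ys] by auto
    then have "iv (flip X f) (f y) = y" using iv_eqI[OF F ys] by simp
    then show ?thesis using fy F T ys flip_on[OF f supp_mem[OF T y ys]] by (simp add: P_def)
  qed
  have "supp M P = flip X f ` supp M T" unfolding P_def using F T by (intro supp_conj) auto
  then show "supp M P \<subseteq> f ` X" using T(2) flip_on[OF f] by auto
  have "iv (flip X f) \<star> P \<star> iv (iv (flip X f)) = iv (flip X f) \<star> P \<star> flip X f"
    using F by (simp add: Gam_carrier)
  also have "\<dots> = T"
    by (rule Gam_eqI) (use F T P in \<open>auto simp: P_def\<close>)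
  finally show "T = iv (flip X f) \<star> P \<star> iv (iv (flip X f))" by simp
qed

text \<open>Two disjoint copies of each \<open>Y n\<close>; the swindle uses the second as an intermediate stop.\<close>

lemma copies:
  fixes Y D :: "nat \<Rightarrow> 'a set"
  assumes Y: "\<And>n. Y n \<in> sets M" and D: "\<And>k. D k \<in> sets M" "disjoint_family D"
    and le: "\<And>k. emeasure M (Y (k div 2)) \<le> emeasure M (D k)"
  obtains R \<phi> \<psi> where "R \<in> null_sets M"
    "\<forall>n. pw (Y n - R) (\<phi> n) \<and> pw (Y n - R) (\<psi> n) \<and> \<phi> n ` (Y n - R) \<subseteq> D (2 * n) \<and> \<psi> n ` (Y n - R) \<subseteq> D (2 * n + 1)"
    "disjoint_family (\<lambda>n. \<phi> n ` (Y n - R))" "disjoint_family (\<lambda>n. \<psi> n ` (Y n - R))"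
    "\<forall>m n. \<phi> m ` (Y m - R) \<inter> \<psi> n ` (Y n - R) = {}"
proof -
  have "\<exists>p. pw (fst p) (snd p) \<and> fst p \<subseteq> Y (k div 2) \<and> emeasure M (Y (k div 2) - fst p) = 0 \<and> snd p ` fst p \<subseteq> D k" for k
    by (rule embed[OF Y D(1) le, of k]) auto
  then have "\<forall>k. \<exists>p. pw (fst p) (snd p) \<and> fst p \<subseteq> Y (k div 2) \<and> emeasure M (Y (k div 2) - fst p) = 0 \<and> snd p ` fst p \<subseteq> D k"
    by (rule allI)
  from choice[OF this] obtain p where p: "\<forall>k. pw (fst (p k)) (snd (p k)) \<and> fst (p k) \<subseteq> Y (k div 2) \<and>
      emeasure M (Y (k div 2) - fst (p k)) = 0 \<and> snd (p k) ` fst (p k) \<subseteq> D k"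
    by (rule exE)
  define C f where "C k = fst (p k)" and "f k = snd (p k)" for k
  have Cf: "pw (C k) (f k)" "C k \<subseteq> Y (k div 2)" "emeasure M (Y (k div 2) - C k) = 0" "f k ` C k \<subseteq> D k" for k
    using spec[OF p, of k] by (simp_all add: C_def f_def)
  \<comment> \<open>One null set serves all indices, so that the sets \<open>Y n - R\<close> stay
    nested whenever the \<open>Y n\<close> are. The members of \<open>D\<close> with even index
    receive the first copies and those with odd index the second, whence
    \<open>k div 2\<close>.\<close>
  define R where "R = (\<Union>k. Y (k div 2) - C k)"
  have R: "R \<in> null_sets M" unfolding R_def
    using Cf(3) pw_sets[OF Cf(1)] Y by (intro null_sets_UN null_setsI sets.Diff)
  have sub: "Y (k div 2) - R \<subseteq> C k" for k unfolding R_def by blast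
  have YR: "Y n - R \<in> sets M" for n using Y R by auto
  have a: "pw (Y (k div 2) - R) (f k)" "f k ` (Y (k div 2) - R) \<subseteq> D k" for k
  proof -
    show "pw (Y (k div 2) - R) (f k)" by (rule pw_subset[OF Cf(1) YR sub])
    show "f k ` (Y (k div 2) - R) \<subseteq> D k" using image_mono[OF sub, of "f k" k] Cf(4)[of k] by (rule order_trans)
  qed
  have b: "pw (Y n - R) (f (2 * n))" "f (2 * n) ` (Y n - R) \<subseteq> D (2 * n)"
    "pw (Y n - R) (f (2 * n + 1))" "f (2 * n + 1) ` (Y n - R) \<subseteq> D (2 * n + 1)" for n
    using a[of "2 * n"] a[of "2 * n + 1"] by simp_all
  have disj: "D i \<inter> D j = {}" if "i \<noteq> j" for i j using D(2) that by (auto simp: disjoint_family_on_def)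
  show ?thesis
  proof (rule that[OF R, of "\<lambda>n. f (2 * n)" "\<lambda>n. f (2 * n + 1)"])
    show "disjoint_family (\<lambda>n. f (2 * n) ` (Y n - R))"
      by (rule disjoint_family_subset[OF _ b(2)]) (auto simp: disjoint_family_on_def disj)
    show "disjoint_family (\<lambda>n. f (2 * n + 1) ` (Y n - R))"
      by (rule disjoint_family_subset[OF _ b(4)]) (auto simp: disjoint_family_on_def disj)
    show "\<forall>m n. f (2 * m) ` (Y m - R) \<inter> f (2 * n + 1) ` (Y n - R) = {}"
    proof (intro allI)
      fix m n :: nat
      have "2 * m \<noteq> 2 * n + 1" by presburger
      then show "f (2 * m) ` (Y m - R) \<inter> f (2 * n + 1) ` (Y n - R) = {}"
        using disj[of "2 * m" "2 * n + 1"] b(2)[of m] b(4)[of n] by blast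
    qed
    show "\<forall>n. pw (Y n - R) (f (2 * n)) \<and> pw (Y n - R) (f (2 * n + 1)) \<and>
       f (2 * n) ` (Y n - R) \<subseteq> D (2 * n) \<and> f (2 * n + 1) ` (Y n - R) \<subseteq> D (2 * n + 1)"
      using b by blast
  qed
qed

lemma split_measure:
  assumes "C \<in> sets M" "emeasure M C = ennreal r" "0 \<le> s" "s \<le> r"
  obtains C' where "C' \<in> sets M" "C' \<subseteq> C" "emeasure M C' = ennreal s" "emeasure M (C - C') = ennreal (r - s)"
proof -
  obtain C' where C': "C' \<in> sets M" "C' \<subseteq> C" "emeasure M C' = ennreal s"
    by (rule ex_subset_emeasure[OF assms(1), of "ennreal s"]) (use assms in \<open>auto intro: ennreal_leI\<close>)
  moreover have "emeasure M (C - C') = ennreal (r - s)"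
    using C' assms by (subst emeasure_Diff) (auto simp: ennreal_minus)
  ultimately show ?thesis by (rule that)
qed

text \<open>Flips on different copies move disjoint sets, so their infinite product is again a
  single flip, to which membership results about flips apply.\<close>

lemma flip_glue:
  fixes Y C :: "nat \<Rightarrow> 'a set"
  assumes \<phi>: "\<And>n. pw (Y n) (\<phi> n)" "disjoint_family (\<lambda>n. \<phi> n ` Y n)"
    and f: "\<And>n. flippable (C n) (f n)" "\<And>n. C n \<union> f n ` C n \<subseteq> Y n"
  obtains D F where "flippable D F" "D \<union> F ` D \<subseteq> (\<Union>n. \<phi> n ` Y n)"
    "\<forall>n. \<forall>y\<in>Y n. flip D F (\<phi> n y) = \<phi> n (flip (C n) (f n) y)"
proof -
  have pw: "pw (C n) (f n)" and disj: "C n \<inter> f n ` C n = {}" for n using f(1)[of n] by (auto simp: flippable_def)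
  have C: "C n \<in> sets M" "C n \<subseteq> Y n" "f n ` C n \<subseteq> Y n" for n using pw_sets[OF pw] f(2)[of n] by auto
  have inj: "\<phi> n x = \<phi> n y \<longleftrightarrow> x = y" if "x \<in> Y n" "y \<in> Y n" for n x y
    using inj_on_eq_iff[OF pw_inj[OF \<phi>(1)[of n]] that] .
  have dis: "\<phi> m x \<noteq> \<phi> n y" if "x \<in> Y m" "y \<in> Y n" "m \<noteq> n" for m n x y
  proof -
    have "\<phi> m ` Y m \<inter> \<phi> n ` Y n = {}" using \<phi>(2) that(3) by (auto simp: disjoint_family_on_def)
    then show ?thesis using that(1,2) by blast
  qed
  have p1: "pw (C n) (\<phi> n)" for n using pw_subset[OF \<phi>(1) C(1,2)] .
  have p2: "pw (C n) (\<lambda>y. \<phi> n (f n y))" for n by (rule pw_compose[OF pw \<phi>(1) C(3)])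
  have s2: "(\<lambda>y. \<phi> n (f n y)) ` C n \<subseteq> \<phi> n ` Y n" for n using C(3)[of n] by blast
  have d1: "disjoint_family (\<lambda>n. \<phi> n ` C n)" by (rule disjoint_family_subset[OF \<phi>(2)]) (use C in blast)
  have d2: "disjoint_family (\<lambda>n. (\<lambda>y. \<phi> n (f n y)) ` C n)" by (rule disjoint_family_subset[OF \<phi>(2) s2])
  have d12: "\<phi> m ` C m \<inter> (\<lambda>y. \<phi> n (f n y)) ` C n = {}" for m n
  proof (cases "m = n")
    case True
    have "\<phi> n x \<noteq> \<phi> n (f n y)" if "x \<in> C n" "y \<in> C n" for x y
    proof -
      have "x \<in> Y n" "f n y \<in> Y n" "x \<noteq> f n y" using that C(2)[of n] C(3)[of n] disj[of n] by blast+
      then show ?thesis using inj by simp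
    qed
    then show ?thesis using True by auto
  next
    case False
    have "\<phi> m ` Y m \<inter> \<phi> n ` Y n = {}" using \<phi>(2) False by (auto simp: disjoint_family_on_def)
    then show ?thesis using s2[of n] C(2)[of m] by blast
  qed
  let ?D = "\<Union>n. \<phi> n ` C n"
  obtain F where F: "flippable ?D F" "\<forall>n. \<forall>y\<in>C n. F (\<phi> n y) = \<phi> n (f n y)" "F ` ?D = (\<Union>n. (\<lambda>y. \<phi> n (f n y)) ` C n)"
    by (rule flip_family[OF p1 d1 p2 d2 d12])
  have "flip ?D F (\<phi> n y) = \<phi> n (flip (C n) (f n) y)" if y: "y \<in> Y n" for n y
  proof -
    have ys: "y \<in> space M" using sets_space[OF pw_sets[OF \<phi>(1)] y] .
    have \<phi>ys: "\<phi> n y \<in> space M" using sets_space[OF pw_image[OF \<phi>(1)[of n]]] y by blast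
    consider "y \<in> C n" | z where "z \<in> C n" "y = f n z" | "y \<notin> C n" "y \<notin> f n ` C n" by blast
    then show ?thesis
    proof cases
      case 1
      then have "\<phi> n y \<in> ?D" by blast
      then show ?thesis using flip_on[OF F(1)] flip_on[OF f(1) 1] F(2) 1 by simp
    next
      case 2
      then have "\<phi> n z \<in> ?D" by blast
      then have "flip ?D F (F (\<phi> n z)) = \<phi> n z" by (rule flip_image[OF F(1)])
      then show ?thesis using flip_image[OF f(1) 2(1)] F(2) 2 by simp
    next
      case 3
      have "\<phi> n y \<notin> ?D"
      proof
        assume "\<phi> n y \<in> ?D"
        then obtain m x where m: "x \<in> C m" "\<phi> n y = \<phi> m x" by blast
        then have "x \<in> Y m" using C(2) by blast
        then have "m = n" using dis[OF y, of x m] m by blast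
        then show False using inj[OF y, of x] \<open>x \<in> Y m\<close> m 3 by simp
      qed
      moreover have "\<phi> n y \<notin> F ` ?D"
      proof
        assume "\<phi> n y \<in> F ` ?D"
        then obtain m x where m: "x \<in> C m" "\<phi> n y = \<phi> m (f m x)" unfolding F(3) by blast
        then have "f m x \<in> Y m" using C(3) by blast
        then have "m = n" using dis[OF y, of "f m x" m] m by blast
        then show False using inj[OF y, of "f m x"] \<open>f m x \<in> Y m\<close> m 3 by simp
      qed
      ultimately show ?thesis using flip_off[OF F(1) \<phi>ys] flip_off[OF f(1) ys 3] by simp
    qed
  qed
  moreover have "?D \<union> F ` ?D \<subseteq> (\<Union>n. \<phi> n ` Y n)"
  proof -
    have "?D \<subseteq> (\<Union>n. \<phi> n ` Y n)" by (rule UN_mono) (use C(2) in auto)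
    moreover have "F ` ?D \<subseteq> (\<Union>n. \<phi> n ` Y n)" unfolding F(3) by (rule UN_mono) (use s2 in auto)
    ultimately show ?thesis by (rule Un_least)
  qed
  ultimately show ?thesis using that[OF F(1)] by blast
qed

end

section \<open>Invariant subgroups\<close>

text \<open>
  Here \<open>N\<close> consists of the representatives of a normal subgroup of \<open>G\<close> or of its finite support
  part, and \<open>K\<close> of the representatives of the group in which it is normal.
\<close>

locale invariant_subgroup = ergodic_full_group M G for M :: "'a measure" and G +
  fixes K N :: "('a \<Rightarrow> 'a) set"
  assumes K_Gam: "K \<subseteq> Gam"
    and K_iv: "\<And>k. k \<in> K \<Longrightarrow> iv k \<in> K"
    and K_fin: "\<And>T. T \<in> Gam \<Longrightarrow> emeasure M (supp M T) < \<infinity> \<Longrightarrow> T \<in> K"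
    and N_Gam: "N \<subseteq> Gam"
    and N_mul: "\<And>S T. S \<in> N \<Longrightarrow> T \<in> N \<Longrightarrow> S \<star> T \<in> N"
    and N_iv: "\<And>T. T \<in> N \<Longrightarrow> iv T \<in> N"
    and N_AE: "\<And>S T. T \<in> N \<Longrightarrow> S \<in> Gam \<Longrightarrow> AE x in M. S x = T x \<Longrightarrow> S \<in> N"
    and N_conj: "\<And>k T. k \<in> K \<Longrightarrow> T \<in> N \<Longrightarrow> k \<star> T \<star> iv k \<in> N"
begin

lemma N_in_Gam: "T \<in> N \<Longrightarrow> T \<in> Gam" and K_in_Gam: "T \<in> K \<Longrightarrow> T \<in> Gam"
  using N_Gam K_Gam by auto

section \<open>Flips of finite support in an invariant subgroup\<close>

text \<open>By \<open>commutator_identity\<close> the commutator of \<open>h\<close> and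
  \<open>w\<close> equals \<open>c\<close> times a conjugate of \<open>iv c\<close>, where
  \<open>c\<close> lies in \<open>N\<close> as the product of \<open>g\<close> and a conjugate of
  its inverse.\<close>

lemma commutator_in_N:
  assumes g: "g \<in> N" and A: "A \<in> sets M" "A \<inter> g ` A = {}"
    and h: "h \<in> K" "supp M h \<subseteq> A" and w: "w \<in> K" "supp M w \<subseteq> A"
  shows "h \<star> w \<star> iv h \<star> iv w \<in> N"
proof -
  have "iv h \<star> iv g \<star> iv (iv h) \<in> N" using N_conj[OF K_iv N_iv] h g by blast
  then have "iv h \<star> iv g \<star> h \<in> N" using h K_in_Gam by (simp add: Gam_carrier)
  then have c: "g \<star> (iv h \<star> iv g \<star> h) \<in> N" using N_mul g by blast
  then have "(g \<star> (iv h \<star> iv g \<star> h)) \<star> (w \<star> iv (g \<star> (iv h \<star> iv g \<star> h)) \<star> iv w) \<in> N"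
    using N_mul N_conj[OF w(1) N_iv] by blast
  then show ?thesis
    using commutator_identity[OF _ A _ h(2) _ w(2)] g h w N_in_Gam K_in_Gam by simp
qed

text \<open>Up to null sets \<open>C\<close> is halved into \<open>E\<close> and its image under
  \<open>k\<close>. Let \<open>h\<close> flip \<open>E\<close> by \<open>f\<close>, and let
  \<open>w\<close> exchange \<open>E\<close> and its image under \<open>f\<close> with the
  corresponding sets of the other half. Then \<open>w\<close> conjugates \<open>h\<close> to the
  flip of the other half; as \<open>h\<close> is an involution, the commutator of \<open>h\<close>
  and \<open>w\<close> is the product of both half flips, almost everywhere equal to the flip of
  \<open>C\<close>.\<close>

lemma flip_in_N_of_wandering:
  assumes g: "g \<in> N" and A: "A \<in> sets M" "A \<inter> g ` A = {}"
    and f: "flippable C f" "C \<union> f ` C \<subseteq> A" and fin: "emeasure M C < \<infinity>"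
  shows "flip C f \<in> N"
proof -
  have pw: "pw C f" and disj: "C \<inter> f ` C = {}" using f(1) by (auto simp: flippable_def)
  have C: "C \<in> sets M" using pw_sets[OF pw] .
  obtain r where r: "emeasure M C = ennreal r" "0 \<le> r" using fin by (cases "emeasure M C") auto
  obtain C1 where C1: "C1 \<in> sets M" "C1 \<subseteq> C" "emeasure M C1 = ennreal (r / 2)" "emeasure M (C - C1) = ennreal (r - r / 2)"
    by (rule split_measure[OF C r(1), of "r / 2"]) (use r in auto)
  then have C2: "C - C1 \<in> sets M" "emeasure M (C - C1) = ennreal (r / 2)" using C by auto
  obtain E k where k: "pw E k" "E \<subseteq> C1" "emeasure M (C1 - E) = 0" "k ` E \<subseteq> C - C1"
    by (rule embed[OF C1(1) C2(1)]) (use C1(3) C2(2) in auto)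
  have E: "E \<in> sets M" "k ` E \<in> sets M" using pw_sets[OF k(1)] pw_image[OF k(1)] .
  have kE: "k x \<in> C" "k x \<notin> E" if "x \<in> E" for x using k that by auto
  have EC: "x \<in> C" if "x \<in> E" for x using k(2) C1(2) that by blast
  have fC: "f x \<notin> C" if "x \<in> C" for x using disj that by blast
  have finj: "f x = f y \<longleftrightarrow> x = y" if "x \<in> C" "y \<in> C" for x y using inj_on_eq_iff[OF pw_inj[OF pw] that] .
  have CS: "x \<in> space M" "f x \<in> space M" if "x \<in> C" for x
    using that sets_space[OF C] sets_space[OF pw_image[OF pw]] by auto
  have kdisj: "E \<inter> k ` E = {}" using kE by blast
  let ?U = "E \<union> k ` E"
  have U: "?U \<in> sets M" "?U \<subseteq> C" using E kE EC by auto
  have "emeasure M (C - ?U) = 0"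
  proof -
    have "emeasure M E = emeasure M C1"
    proof -
      have "C1 - E \<in> null_sets M" using k(3) C1(1) E by auto
      then have "emeasure M (E \<union> (C1 - E)) = emeasure M E" using E by (intro emeasure_Un_null_set)
      then show ?thesis using k(2) by (simp add: Un_absorb1)
    qed
    then have kEm: "emeasure M (k ` E) = ennreal (r / 2)" using pw_emeasure[OF k(1)] C1(3) by simp
    have "emeasure M ((C - C1) - k ` E) = 0"
      using kEm C2 E k(4) r by (subst emeasure_Diff) (auto simp: ennreal_minus)
    then have "(C - C1 - k ` E) \<union> (C1 - E) \<in> null_sets M"
      using k(3) C2 C1 E by (intro null_sets.Un null_setsI) auto
    then have "C - ?U \<in> null_sets M" by (rule null_sets_subset) (use C U in auto)
    then show ?thesis by auto
  qed
  note flU = flip_AE[OF f(1) U this]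
  have fE: "pw E f" using pw_subset[OF pw E(1)] EC by blast
  have fkE: "pw E (\<lambda>x. f (k x))" by (rule pw_compose[OF k(1) pw]) (use kE in auto)
  \<comment> \<open>Two exchanges, of \<open>E\<close> with its image under \<open>k\<close> and of
    the image of \<open>E\<close> under \<open>f\<close> with that under \<open>f \<circ> k\<close>,
    written as a family over \<open>nat\<close> whose other members are empty.\<close>
  let ?Y = "\<lambda>n :: nat. if n < 2 then E else {}"
  let ?\<alpha> = "\<lambda>n :: nat. if n = 0 then (\<lambda>x. x) else f"
  let ?\<beta> = "\<lambda>n :: nat. if n = 0 then k else (\<lambda>x. f (k x))"
  have p1: "pw (?Y n) (?\<alpha> n)" and p2: "pw (?Y n) (?\<beta> n)" for n
    using fE fkE k(1) pw_ident[OF E(1)] pw_subset[OF k(1), of "{}"] pw_subset[OF fE, of "{}"] pw_subset[OF fkE, of "{}"] by auto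
  have d1: "disjoint_family (\<lambda>n. ?\<alpha> n ` ?Y n)"
    using fC EC by (auto simp: disjoint_family_on_def less_2_cases_iff split: if_splits)
  have d2: "disjoint_family (\<lambda>n. ?\<beta> n ` ?Y n)"
    using fC kE by (auto simp: disjoint_family_on_def less_2_cases_iff split: if_splits) metis+
  have d12: "?\<alpha> m ` ?Y m \<inter> ?\<beta> n ` ?Y n = {}" for m n
  proof -
    have "x \<noteq> k y" "x \<noteq> f (k y)" "f x \<noteq> k y" "f x \<noteq> f (k y)" if "x \<in> E" "y \<in> E" for x y
      using that kE fC EC finj by metis+
    then show ?thesis by auto
  qed
  obtain \<kappa> where \<kappa>: "flippable (\<Union>n. ?\<alpha> n ` ?Y n) \<kappa>" "\<forall>n. \<forall>y\<in>?Y n. \<kappa> (?\<alpha> n y) = ?\<beta> n y"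
    "\<kappa> ` (\<Union>n. ?\<alpha> n ` ?Y n) = (\<Union>n. ?\<beta> n ` ?Y n)"
    by (rule flip_family[OF p1 d1 p2 d2 d12])
  have UNeq: "(\<Union>n. ?\<alpha> n ` ?Y n) = E \<union> f ` E" "(\<Union>n. ?\<beta> n ` ?Y n) = k ` E \<union> (\<lambda>x. f (k x)) ` E"
  proof -
    have "(\<Union>n. B n) = B 0 \<union> B (Suc 0)" if "\<And>n. n \<ge> 2 \<Longrightarrow> B n = {}" for B :: "nat \<Rightarrow> 'a set"
    proof
      show "(\<Union>n. B n) \<subseteq> B 0 \<union> B (Suc 0)"
      proof
        fix x assume "x \<in> (\<Union>n. B n)"
        then obtain n where n: "x \<in> B n" by blast
        then have "n < 2" using that[of n] by (cases "n < 2") auto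
        then show "x \<in> B 0 \<union> B (Suc 0)" using n by (auto simp: less_2_cases_iff)
      qed
    qed blast
    from this[of "\<lambda>n. ?\<alpha> n ` ?Y n"] this[of "\<lambda>n. ?\<beta> n ` ?Y n"]
    show "(\<Union>n. ?\<alpha> n ` ?Y n) = E \<union> f ` E" "(\<Union>n. ?\<beta> n ` ?Y n) = k ` E \<union> (\<lambda>x. f (k x)) ` E" by simp_all
  qed
  have k1: "\<kappa> x = k x" "\<kappa> (f x) = f (k x)" if "x \<in> E" for x
    using spec[OF \<kappa>(2), of 0] spec[OF \<kappa>(2), of 1] that by auto
  have fl\<kappa>: "flippable (E \<union> f ` E) \<kappa>" "\<kappa> ` (E \<union> f ` E) = k ` E \<union> (\<lambda>x. f (k x)) ` E"
    using \<kappa>(1,3) unfolding UNeq by auto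
  have flE: "flippable E f" using fE disj EC by (auto simp: flippable_def)
  define h where "h = flip E f"
  define w where "w = flip (E \<union> f ` E) \<kappa>"
  have hG: "h \<in> Gam" and wG: "w \<in> Gam" using flip_Gam flE fl\<kappa>(1) by (auto simp: h_def w_def)
  have hA: "supp M h \<subseteq> C \<union> f ` C" using supp_flip[OF flE] EC by (auto simp: h_def)
  have wA: "supp M w \<subseteq> C \<union> f ` C" using supp_flip[OF fl\<kappa>(1)] EC kE(1) unfolding fl\<kappa>(2) by (auto simp: w_def)
  have CfC: "C \<union> f ` C \<in> sets M" "emeasure M (C \<union> f ` C) < \<infinity>"
  proof -
    show "C \<union> f ` C \<in> sets M" using C pw_image[OF pw] by auto
    have "emeasure M (C \<union> f ` C) \<le> emeasure M C + emeasure M (f ` C)"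
      using C pw_image[OF pw] by (rule emeasure_subadditive)
    also have "\<dots> < \<infinity>" using fin pw_emeasure[OF pw] by simp
    finally show "emeasure M (C \<union> f ` C) < \<infinity>" .
  qed
  have hK: "h \<in> K"
    by (rule K_fin[OF hG le_less_trans[OF emeasure_mono[OF hA CfC(1)] CfC(2)]])
  have wK: "w \<in> K"
    by (rule K_fin[OF wG le_less_trans[OF emeasure_mono[OF wA CfC(1)] CfC(2)]])
  have comm: "h \<star> w \<star> iv h \<star> iv w \<in> N"
    by (rule commutator_in_N[OF g A hK _ wK]) (use order_trans[OF hA f(2)] order_trans[OF wA f(2)] in simp_all)
  have ivh: "iv h x = h x" and ivw: "iv w x = w x" if "x \<in> space M" for x
    using flip_flip[OF flE that] flip_flip[OF fl\<kappa>(1) that] hG wG that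
    by (auto intro!: iv_eqI simp: h_def[symmetric] w_def[symmetric])
  have h1: "h x = f x" "h (f x) = x" if "x \<in> E" for x
    using flip_on[OF flE that] flip_image[OF flE that] by (auto simp: h_def)
  have h0: "h x = x" if "x \<in> space M" "x \<notin> E" "x \<notin> f ` E" for x
    using flip_off[OF flE that] by (simp add: h_def)
  have w1: "w x = k x" "w (f x) = f (k x)" "w (k x) = x" "w (f (k x)) = f x" if "x \<in> E" for x
    using that flip_on[OF fl\<kappa>(1), of x] flip_on[OF fl\<kappa>(1), of "f x"] flip_image[OF fl\<kappa>(1), of x] flip_image[OF fl\<kappa>(1), of "f x"] k1[OF that]
    by (auto simp: w_def)
  have w0: "w x = x" if "x \<in> space M" "x \<notin> E" "x \<notin> f ` E" "x \<notin> k ` E" "x \<notin> (\<lambda>x. f (k x)) ` E" for x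
    using flip_off[OF fl\<kappa>(1) that(1)] that unfolding fl\<kappa>(2) by (auto simp: w_def)
  have off: "k x \<notin> f ` E" "f (k x) \<notin> E" "f (k x) \<notin> f ` E" if "x \<in> E" for x
    using that kE fC EC finj by (auto, metis)
  have hk: "h (k x) = k x" "h (f (k x)) = f (k x)" if "x \<in> E" for x
    using that h0 off kE CS by auto
  have "(h \<star> w \<star> iv h \<star> iv w) x = flip ?U f x" if x: "x \<in> space M" for x
  proof -
    have lhs: "(h \<star> w \<star> iv h \<star> iv w) x = h (w (h (w x)))"
      using x hG wG ivw[OF x] ivh[of "w x"] by simp
    consider y where "y \<in> E" "x = y" | y where "y \<in> E" "x = k y" | y where "y \<in> E" "x = f y" | y where "y \<in> E" "x = f (k y)"
      | "x \<notin> ?U" "x \<notin> f ` ?U" by auto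
    then have "h (w (h (w x))) = flip ?U f x"
    proof cases
      case 1 then show ?thesis using flip_on[OF flU(1), of y] by (simp add: w1 h1 hk)
    next
      case 2 then show ?thesis using flip_on[OF flU(1), of "k y"] by (simp add: w1 h1 hk)
    next
      case 3 then show ?thesis using flip_image[OF flU(1), of y] by (simp add: w1 h1 hk)
    next
      case 4 then show ?thesis using flip_image[OF flU(1), of "k y"] by (simp add: w1 h1 hk)
    next
      case 5
      then have "w x = x" "h x = x" using x by (auto intro!: w0 h0)
      then show ?thesis using flip_off[OF flU(1) x 5] by simp
    qed
    then show ?thesis using lhs by simp
  qed
  then have "AE x in M. flip C f x = (h \<star> w \<star> iv h \<star> iv w) x"
    using flU(2) by (intro AE_mp[OF flU(2) AE_I2]) simp
  then show ?thesis using N_AE[OF comm flip_Gam[OF f(1)]] by blast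
qed

lemma conj_cancel:
  assumes "T = iv F \<star> P \<star> iv (iv F)" "F \<in> K" "P \<in> N"
  shows "T \<in> N"
  using assms N_conj[OF K_iv] by blast

text \<open>A flip small enough to fit into a wandering set of finite measure is conjugated into it,
  where \<open>flip_in_N_of_wandering\<close> applies. Any flip with domain of finite measure is a
  product of finitely many small ones, by repeated halving of the domain.\<close>

lemma finite_flip_in_N:
  assumes g: "g \<in> N" "0 < emeasure M (supp M g)"
    and f: "flippable C f" and fin: "emeasure M C < \<infinity>"
  shows "flip C f \<in> N"
proof -
  obtain A where A: "A \<in> sets M" "A \<inter> g ` A = {}" "emeasure M (supp M g) \<le> 3 * emeasure M A"
    by (rule wandering[OF N_in_Gam[OF g(1)]])
  then have "0 < emeasure M A" using g(2) by (auto simp: zero_less_iff_neq_zero)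
  then obtain B where B: "B \<in> sets M" "B \<subseteq> A" "0 < emeasure M B" "emeasure M B < \<infinity>"
    by (rule ex_finite_subset[OF A(1)])
  have Bg: "B \<inter> g ` B = {}" using A(2) B(2) by blast
  obtain b where b: "emeasure M B = ennreal b" "0 < b" using B(3,4) by (cases "emeasure M B") auto
  have small: "flip C f \<in> N" if f: "flippable C f" and le: "emeasure M C \<le> ennreal (b / 2)" for C f
  proof -
    have pw: "pw C f" and disj: "C \<inter> f ` C = {}" using f by (auto simp: flippable_def)
    let ?P = "C \<union> f ` C"
    have C: "C \<in> sets M" "f ` C \<in> sets M" and P: "?P \<in> sets M" using pw_sets[OF pw] pw_image[OF pw] by auto
    have "emeasure M ?P \<le> emeasure M C + emeasure M (f ` C)" using C by (rule emeasure_subadditive)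
    also have "\<dots> \<le> ennreal (b / 2) + ennreal (b / 2)" using le pw_emeasure[OF pw] by (intro add_mono) auto
    also have "\<dots> = emeasure M B" using b by (simp add: ennreal_plus[symmetric] del: ennreal_plus)
    finally have leB: "emeasure M ?P \<le> emeasure M B" .
    then have Pfin: "emeasure M ?P < \<infinity>" using B(4) by simp
    obtain Q where Q: "Q \<in> sets M" "Q \<subseteq> B" "emeasure M Q = emeasure M ?P"
      by (rule ex_subset_emeasure[OF B(1) leB Pfin])
    \<comment> \<open>The sets \<open>?P\<close> and \<open>Q\<close> may overlap. Having equal
      finite measure, they have differences of equal measure, and the flip \<open>F\<close>
      exchanging the differences carries \<open>?P\<close> into \<open>Q\<close> up to a null
      set.\<close>
    have "emeasure M (?P - Q) = emeasure M (Q - ?P)"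
    proof -
      have diff: "emeasure M (X - Y) = emeasure M X - emeasure M (X \<inter> Y)"
        if "X \<in> sets M" "Y \<in> sets M" "emeasure M X < \<infinity>" for X Y
      proof -
        have "emeasure M (X \<inter> Y) \<le> emeasure M X" using that by (intro emeasure_mono) auto
        then have "emeasure M (X \<inter> Y) \<noteq> \<infinity>" using that(3) by auto
        then have "emeasure M (X - X \<inter> Y) = emeasure M X - emeasure M (X \<inter> Y)"
          using that by (intro emeasure_Diff) auto
        moreover have "X - X \<inter> Y = X - Y" by blast
        ultimately show ?thesis by simp
      qed
      have "Q \<inter> ?P = ?P \<inter> Q" by blast
      then show ?thesis using diff[OF P Q(1) Pfin] diff[OF Q(1) P] Q(3) Pfin by simp
    qed
    then have leq: "emeasure M (?P - Q) \<le> emeasure M (Q - ?P)" by simp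
    obtain E k where k: "pw E k" "E \<subseteq> ?P - Q" "emeasure M (?P - Q - E) = 0" "k ` E \<subseteq> Q - ?P"
      by (rule embed[OF _ _ leq]) (use P Q in auto)
    have E: "E \<in> sets M" "k ` E \<in> sets M" using pw_sets[OF k(1)] pw_image[OF k(1)] .
    have flE: "flippable E k" using k by (auto simp: flippable_def)
    define F where "F = flip E k"
    have FG: "F \<in> Gam" using flip_Gam[OF flE] by (simp add: F_def)
    have "supp M F \<subseteq> ?P \<union> Q" using supp_flip[OF flE] k(2,4) unfolding F_def by blast
    then have "emeasure M (supp M F) \<le> emeasure M (?P \<union> Q)" using P Q by (intro emeasure_mono) auto
    also have "\<dots> \<le> emeasure M ?P + emeasure M Q" using P Q(1) by (rule emeasure_subadditive)
    also have "\<dots> < \<infinity>" using Pfin Q(3) by simp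
    finally have FK: "F \<in> K" by (rule K_fin[OF FG])
    define R where "R = ?P - Q - E"
    have R: "R \<in> null_sets M" unfolding R_def using k(3) P Q(1) E(1) by (intro null_setsI) auto
    have FQ: "F x \<in> Q" if "x \<in> ?P" "x \<notin> R" for x
    proof (cases "x \<in> E")
      case True
      then show ?thesis using flip_on[OF flE True] k(4) by (auto simp: F_def)
    next
      case False
      then have "x \<in> Q" using that by (auto simp: R_def)
      moreover have "x \<notin> k ` E" using k(4) that(1) by blast
      ultimately show ?thesis using flip_off[OF flE _ False] sets_space[OF Q(1)] by (simp add: F_def)
    qed
    \<comment> \<open>Points of \<open>C\<close> that lie in the null set \<open>R\<close>, or whose
      image under \<open>f\<close> does, are discarded, so that \<open>F\<close> carries both sides
      of the remaining flip into \<open>B\<close>.\<close>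
    define C' where "C' = C - R - inv_into C f ` (f ` C \<inter> R)"
    have nul: "f ` C \<inter> R \<in> null_sets M"
      by (rule null_sets_subset[OF R]) (use C R in auto)
    have pinv: "pw (f ` C \<inter> R) (inv_into C f)" by (rule pw_subset[OF pw_inv[OF pw]]) (use nul in auto)
    have nul2: "inv_into C f ` (f ` C \<inter> R) \<in> null_sets M"
      using pw_image[OF pinv] pw_emeasure[OF pinv] null_setsD1[OF nul] by (intro null_setsI) auto
    have C': "C' \<in> sets M" "C' \<subseteq> C" using C R nul2 by (auto simp: C'_def)
    have "R \<union> inv_into C f ` (f ` C \<inter> R) \<in> null_sets M" using R nul2 by (rule null_sets.Un)
    then have "C - C' \<in> null_sets M" by (rule null_sets_subset) (use C C' in \<open>auto simp: C'_def\<close>)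
    then have "emeasure M (C - C') = 0" by auto
    note fl' = flip_AE[OF f C' this]
    have fR: "f x \<notin> R" if "x \<in> C'" for x
    proof
      assume "f x \<in> R"
      then have "inv_into C f (f x) \<in> inv_into C f ` (f ` C \<inter> R)" using that C' by blast
      moreover have "inv_into C f (f x) = x" using that C' inv_into_f_f[OF pw_inj[OF pw]] by blast
      ultimately show False using that by (simp add: C'_def)
    qed
    let ?F = "\<lambda>x. F (f (iv F x))"
    note fc = flip_conj[OF fl'(1) FG]
    have inB: "F ` C' \<union> F ` f ` C' \<subseteq> B"
    proof -
      have "F x \<in> B" "F (f x) \<in> B" if "x \<in> C'" for x
      proof -
        have "x \<in> ?P" "x \<notin> R" "f x \<in> ?P" using that C'(2) by (auto simp: C'_def)
        then show "F x \<in> B" "F (f x) \<in> B" using FQ fR[OF that] Q(2) by blast+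
      qed
      then show ?thesis by auto
    qed
    have finC': "emeasure M (F ` C') < \<infinity>"
    proof -
      have "emeasure M (F ` C') = emeasure M C'" using FG C'(1) by (rule Gam_emeasure)
      also have "\<dots> \<le> emeasure M ?P" using C' P by (intro emeasure_mono) auto
      finally show ?thesis using Pfin by simp
    qed
    have "flip (F ` C') ?F \<in> N"
      by (rule flip_in_N_of_wandering[OF g(1) B(1) Bg fc(1) _ finC']) (use inB fc(2) in simp)
    moreover have "iv (iv F) = F" using FG by (simp add: Gam_carrier)
    ultimately have "flip C' f \<in> N" using fc(3) conj_cancel[of "flip C' f" F "flip (F ` C') ?F"] FK by simp
    moreover have "AE x in M. flip C f x = flip C' f x" using fl'(2) by eventually_elim simp
    ultimately show ?thesis using N_AE flip_Gam[OF f] by blast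
  qed
  have "flip C f \<in> N" if "flippable C f" "emeasure M C \<le> ennreal (2 ^ n * (b / 2))" for n C f
    using that
  proof (induction n arbitrary: C f)
    case 0 then show ?case using small by simp
  next
    case (Suc n)
    have pw: "pw C f" using Suc.prems(1) by (simp add: flippable_def)
    have C: "C \<in> sets M" using pw_sets[OF pw] .
    obtain r where r: "emeasure M C = ennreal r" "0 \<le> r"
      using Suc.prems(2) by (cases "emeasure M C") (auto simp: top_unique)
    have rle: "r \<le> 2 ^ Suc n * (b / 2)" using Suc.prems(2) r b by (subst (asm) r(1), subst (asm) ennreal_le_iff) auto
    obtain C' where C': "C' \<in> sets M" "C' \<subseteq> C" "emeasure M C' = ennreal (r / 2)" "emeasure M (C - C') = ennreal (r - r / 2)"
      by (rule split_measure[OF C r(1), of "r / 2"]) (use r in auto)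
    note sp = flip_split[OF Suc.prems(1) C'(1,2)]
    have "r / 2 \<le> 2 ^ n * (b / 2)" using rle by simp
    then have "emeasure M C' \<le> ennreal (2 ^ n * (b / 2))" "emeasure M (C - C') \<le> ennreal (2 ^ n * (b / 2))"
      using C'(3,4) by (auto intro: ennreal_leI)
    then have "flip C' f \<in> N" "flip (C - C') f \<in> N" using Suc.IH sp by blast+
    then show ?case unfolding sp(3) by (rule N_mul)
  qed
  moreover obtain n where "emeasure M C \<le> ennreal (2 ^ n * (b / 2))"
  proof -
    obtain r where r: "emeasure M C = ennreal r" "0 \<le> r" using fin by (cases "emeasure M C") auto
    obtain n where "r / (b / 2) < 2 ^ n" using real_arch_pow[of 2 "r / (b / 2)"] by auto
    then have "r \<le> 2 ^ n * (b / 2)" using b by (simp add: field_simps)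
    then show ?thesis using that r by (metis ennreal_leI)
  qed
  ultimately show ?thesis using f by blast
qed

end

section \<open>Elements of finite support\<close>

text \<open>The set \<open>Y - Y'\<close> and its image under \<open>T\<close> together have measure
  at most \<open>2 * s\<close>, so \<open>3 * s \<le> r\<close> leaves room in \<open>Y\<close> for
  a copy of \<open>Y - Y'\<close> disjoint from both. By \<open>two_flips\<close> a product of two
  flips inside \<open>Y\<close> then agrees with \<open>T\<close> on almost all of
  \<open>Y - Y'\<close>, and dividing by it leaves an element supported in \<open>Y'\<close> up to a
  null set.\<close>

lemma (in ergodic_full_group) finite_step:
  assumes T: "T \<in> Gam" "supp M T \<subseteq> Y" and Y: "Y \<in> sets M" "Y' \<in> sets M" "Y' \<subseteq> Y"
    and meas: "emeasure M Y = ennreal r" "emeasure M (Y - Y') = ennreal s" and rs: "0 \<le> s" "3 * s \<le> r"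
  obtains C1 f1 C2 f2 T' where "flippable C1 f1" "C1 \<union> f1 ` C1 \<subseteq> Y" "flippable C2 f2" "C2 \<union> f2 ` C2 \<subseteq> Y"
    "T' \<in> Gam" "supp M T' \<subseteq> Y'" "AE x in M. T x = (flip C2 f2 \<star> flip C1 f1 \<star> T') x"
proof -
  let ?B = "Y - Y'"
  have B: "?B \<in> sets M" using Y by auto
  have TY: "T x \<in> Y" if "x \<in> Y" for x using supp_mem[OF T that sets_space[OF Y(1) that]] .
  let ?W = "Y - (?B \<union> T ` ?B)"
  have BT: "?B \<union> T ` ?B \<in> sets M" "?B \<union> T ` ?B \<subseteq> Y" using B T Gam_image[OF T(1) B] TY by auto
  have "emeasure M (?B \<union> T ` ?B) \<le> emeasure M ?B + emeasure M (T ` ?B)"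
    using B T by (intro emeasure_subadditive Gam_image)
  also have "\<dots> = ennreal (2 * s)" using Gam_emeasure[OF T(1) B] meas(2) rs by (simp flip: ennreal_plus)
  finally have le: "emeasure M (?B \<union> T ` ?B) \<le> ennreal (2 * s)" .
  then obtain q where q: "emeasure M (?B \<union> T ` ?B) = ennreal q" "0 \<le> q"
    by (cases "emeasure M (?B \<union> T ` ?B)") (auto simp: top_unique)
  have "q \<le> 2 * s" using le rs unfolding q(1) by (subst (asm) ennreal_le_iff) auto
  have "emeasure M ?W = ennreal (r - q)"
    using q meas(1) BT Y(1) by (subst emeasure_Diff) (auto simp: ennreal_minus)
  moreover have "ennreal s \<le> ennreal (r - q)" using \<open>q \<le> 2 * s\<close> rs by (intro ennreal_leI) auto
  ultimately have le': "emeasure M ?B \<le> emeasure M ?W" using meas(2) by simp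
  obtain C k where k: "pw C k" "C \<subseteq> ?B" "emeasure M (?B - C) = 0" "k ` C \<subseteq> ?W"
    by (rule embed[OF B _ le']) (use BT Y in auto)
  have disj: "k ` C \<inter> C = {}" "k ` C \<inter> T ` C = {}" using k(2,4) by blast+
  obtain f where f: "flippable C k" "flippable (k ` C) f" "f ` k ` C = T ` C"
    "\<forall>x\<in>C. (flip (k ` C) f \<star> flip C k) x = T x"
    by (rule two_flips[OF T(1) k(1) disj]) auto
  define S where "S = flip (k ` C) f \<star> flip C k"
  have S: "S \<in> Gam" using flip_Gam[OF f(1)] flip_Gam[OF f(2)] by (simp add: S_def)
  have sub1: "C \<union> k ` C \<subseteq> Y" using k(2,4) by auto
  have sub2: "k ` C \<union> f ` k ` C \<subseteq> Y" unfolding f(3) using k(2,4) TY by auto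
  have suppS: "supp M S \<subseteq> Y"
  proof -
    have "supp M S \<subseteq> supp M (flip (k ` C) f) \<union> supp M (flip C k)"
      unfolding S_def using flip_Gam[OF f(1)] flip_Gam[OF f(2)] by (intro supp_mul)
    then show ?thesis using order_trans[OF supp_flip[OF f(1)] sub1] order_trans[OF supp_flip[OF f(2)] sub2] by blast
  qed
  have fixed: "supp M (iv S \<star> T) \<subseteq> Y - C"
    by (rule supp_iv_mul_fixed[OF S T(1) _ suppS T(2)]) (use f(4) in \<open>simp add: S_def\<close>)
  have U: "iv S \<star> T \<in> Gam" using S T by simp
  have "?B - C \<in> null_sets M" using k(3) B pw_sets[OF k(1)] by auto
  then have "supp M (iv S \<star> T) - Y' \<in> null_sets M"
    by (rule null_sets_subset) (use fixed supp_sets[OF U] Y in auto)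
  then have "emeasure M (supp M (iv S \<star> T) - Y') = 0" by auto
  then obtain T' where T': "T' \<in> Gam" "supp M T' \<subseteq> Y'" "AE x in M. T' x = (iv S \<star> T) x"
    by (rule null_modification[OF U Y(2)])
  have "AE x in M. T x = (S \<star> T') x"
    using T'(3) AE_space by eventually_elim (use S T T' in simp)
  then show ?thesis using that[OF f(1) sub1 f(2) sub2 T'(1,2)] by (simp add: S_def)
qed

context invariant_subgroup
begin

lemma K_of_subset:
  assumes "T \<in> Gam" "supp M T \<subseteq> A" "A \<in> sets M" "emeasure M A < \<infinity>"
  shows "T \<in> K"
  by (rule K_fin[OF assms(1) le_less_trans[OF emeasure_mono[OF assms(2,3)] assms(4)]])

text \<open>The factors \<open>S\<close> and \<open>V'\<close> are products of flips of finite
  support, hence in \<open>N\<close>, while \<open>Q\<close> only has to lie in \<open>K\<close>.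
  Both rest on the geometric decay of the sets \<open>Y n\<close>, which keeps the total measure of
  the copies finite.\<close>

lemma finite_in_N:
  assumes g: "g \<in> N" "0 < emeasure M (supp M g)"
    and T: "T \<in> Gam" and fin: "emeasure M (supp M T) < \<infinity>"
  shows "T \<in> N"
proof -
  let ?Z = "supp M T"
  have Z: "?Z \<in> sets M" by (rule supp_sets[OF T])
  obtain r where r: "emeasure M ?Z = ennreal r" "0 \<le> r" using fin by (cases "emeasure M ?Z") auto
  \<comment> \<open>The ratio 2/3 makes each step remove exactly a third of the set, the most that
    \<open>finite_step\<close> allows, and makes the measures summable.\<close>
  define \<rho> where "\<rho> n = r * (2 / 3) ^ n" for n
  have \<rho>: "0 \<le> \<rho> n" "\<rho> (Suc n) \<le> \<rho> n" "3 * (\<rho> n - \<rho> (Suc n)) = \<rho> n" for n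
    using r(2) by (auto simp: \<rho>_def)
  have "\<exists>Y. \<forall>n. (Y n \<in> sets M \<and> emeasure M (Y n) = ennreal (\<rho> n) \<and> (n = 0 \<longrightarrow> Y n = ?Z)) \<and>
     (Y (Suc n) \<subseteq> Y n \<and> emeasure M (Y n - Y (Suc n)) = ennreal (\<rho> n - \<rho> (Suc n)))"
  proof (rule dependent_nat_choice)
    show "\<exists>Y. Y \<in> sets M \<and> emeasure M Y = ennreal (\<rho> 0) \<and> (0 = 0 \<longrightarrow> Y = ?Z)"
      using Z r by (auto simp: \<rho>_def)
    fix Y n assume "Y \<in> sets M \<and> emeasure M Y = ennreal (\<rho> n) \<and> (n = 0 \<longrightarrow> Y = ?Z)"
    then have Y: "Y \<in> sets M" "emeasure M Y = ennreal (\<rho> n)" by auto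
    obtain Y' where "Y' \<in> sets M" "Y' \<subseteq> Y" "emeasure M Y' = ennreal (\<rho> (Suc n))" "emeasure M (Y - Y') = ennreal (\<rho> n - \<rho> (Suc n))"
      by (rule split_measure[OF Y \<rho>(1,2)])
    then show "\<exists>Y'. (Y' \<in> sets M \<and> emeasure M Y' = ennreal (\<rho> (Suc n)) \<and> (Suc n = 0 \<longrightarrow> Y' = ?Z)) \<and>
       (Y' \<subseteq> Y \<and> emeasure M (Y - Y') = ennreal (\<rho> n - \<rho> (Suc n)))" by blast
  qed
  then obtain Y where Y': "\<forall>n. (Y n \<in> sets M \<and> emeasure M (Y n) = ennreal (\<rho> n) \<and> (n = 0 \<longrightarrow> Y n = ?Z)) \<and>
     (Y (Suc n) \<subseteq> Y n \<and> emeasure M (Y n - Y (Suc n)) = ennreal (\<rho> n - \<rho> (Suc n)))"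
    by (rule exE)
  then have Y: "Y n \<in> sets M" "emeasure M (Y n) = ennreal (\<rho> n)" "Y (Suc n) \<subseteq> Y n"
    "emeasure M (Y n - Y (Suc n)) = ennreal (\<rho> n - \<rho> (Suc n))" and Y0: "Y 0 = ?Z" for n
    using spec[OF Y', of n] spec[OF Y', of 0] by simp_all
  have W: "space M - ?Z \<in> sets M" "emeasure M (space M - ?Z) = \<infinity>"
    using Z r infinite_measure by (auto simp: emeasure_Diff supp_def)
  obtain D where D: "\<And>k. D k \<in> sets M" "\<And>k. D k \<subseteq> space M - ?Z" "disjoint_family D"
    "\<And>k. emeasure M (D k) = emeasure M (Y (k div 2))"
    by (rule ex_disjoint_subsets[OF W, of "\<lambda>k. emeasure M (Y (k div 2))"]) (auto simp: Y(2))
  define \<Omega> where "\<Omega> = (\<Union>n. D (2 * n)) \<union> (\<Union>n. D (2 * n + 1))"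
  have \<Omega>: "\<Omega> \<in> sets M" "emeasure M \<Omega> < \<infinity>"
  proof -
    have "summable \<rho>" unfolding \<rho>_def by (intro summable_mult summable_geometric) simp
    then have sum: "(\<Sum>n. ennreal (\<rho> n)) < \<infinity>" by (subst suminf_ennreal2) (use \<rho> in auto)
    have "emeasure M (\<Union>n. D (2 * n)) \<le> (\<Sum>n. emeasure M (D (2 * n)))"
      using D(1) by (intro emeasure_subadditive_countably) auto
    then have 1: "emeasure M (\<Union>n. D (2 * n)) < \<infinity>" using sum by (simp add: D(4) Y(2) le_less_trans)
    have "emeasure M (\<Union>n. D (2 * n + 1)) \<le> (\<Sum>n. emeasure M (D (2 * n + 1)))"
      using D(1) by (intro emeasure_subadditive_countably) auto
    then have 2: "emeasure M (\<Union>n. D (2 * n + 1)) < \<infinity>" using sum by (simp add: D(4) Y(2) le_less_trans)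
    have "emeasure M \<Omega> \<le> emeasure M (\<Union>n. D (2 * n)) + emeasure M (\<Union>n. D (2 * n + 1))"
      unfolding \<Omega>_def using D(1) by (intro emeasure_subadditive) auto
    then show "emeasure M \<Omega> < \<infinity>" using 1 2 by (auto intro: le_less_trans)
    show "\<Omega> \<in> sets M" unfolding \<Omega>_def using D(1) by auto
  qed
  have leD: "emeasure M (Y (k div 2)) \<le> emeasure M (D k)" for k by (simp add: D(4))
  obtain R \<phi> \<psi> where R: "R \<in> null_sets M"
    and maps: "\<forall>n. pw (Y n - R) (\<phi> n) \<and> pw (Y n - R) (\<psi> n) \<and> \<phi> n ` (Y n - R) \<subseteq> D (2 * n) \<and> \<psi> n ` (Y n - R) \<subseteq> D (2 * n + 1)"
    and dis: "disjoint_family (\<lambda>n. \<phi> n ` (Y n - R))" "disjoint_family (\<lambda>n. \<psi> n ` (Y n - R))"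
      "\<forall>m n. \<phi> m ` (Y m - R) \<inter> \<psi> n ` (Y n - R) = {}"
    by (rule copies[OF Y(1) D(1,3) leD])
  \<comment> \<open>Off the null set \<open>R\<close> all copies are defined. The restriction to
    these sets is paid for by replacing \<open>T\<close> with an almost everywhere equal
    \<open>T0\<close> supported in \<open>X 0\<close>.\<close>
  define X where "X n = Y n - R" for n
  have \<phi>: "pw (X n) (\<phi> n)" "pw (X n) (\<psi> n)" "\<phi> n ` X n \<subseteq> D (2 * n)" "\<psi> n ` X n \<subseteq> D (2 * n + 1)" for n
    using spec[OF maps, of n] by (simp_all add: X_def)
  have d\<phi>: "disjoint_family (\<lambda>n. \<phi> n ` X n)" "disjoint_family (\<lambda>n. \<psi> n ` X n)" "\<phi> m ` X m \<inter> \<psi> n ` X n = {}" for m n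
    using dis by (simp_all add: X_def)
  have sub\<Omega>: "(\<Union>n. \<phi> n ` X n) \<subseteq> \<Omega>" "(\<Union>n. \<psi> n ` X n) \<subseteq> \<Omega>"
  proof -
    have "(\<Union>n. \<phi> n ` X n) \<subseteq> (\<Union>n. D (2 * n))" by (rule UN_mono) (use \<phi>(3) in auto)
    then show "(\<Union>n. \<phi> n ` X n) \<subseteq> \<Omega>" unfolding \<Omega>_def by (rule le_supI1)
    have "(\<Union>n. \<psi> n ` X n) \<subseteq> (\<Union>n. D (2 * n + 1))" by (rule UN_mono) (use \<phi>(4) in auto)
    then show "(\<Union>n. \<psi> n ` X n) \<subseteq> \<Omega>" unfolding \<Omega>_def by (rule le_supI2)
  qed
  have X: "X n \<in> sets M" "X (Suc n) \<subseteq> X n" for n using Y(1,3)[of n] R by (auto simp: X_def)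
  have Xm: "emeasure M (X n) = ennreal (\<rho> n)" "emeasure M (X n - X (Suc n)) = ennreal (\<rho> n - \<rho> (Suc n))" for n
  proof -
    show "emeasure M (X n) = ennreal (\<rho> n)" using emeasure_Diff_null_set[OF R Y(1)] Y(2) by (simp add: X_def)
    have "X n - X (Suc n) = (Y n - Y (Suc n)) - R" by (auto simp: X_def)
    then show "emeasure M (X n - X (Suc n)) = ennreal (\<rho> n - \<rho> (Suc n))"
      using emeasure_Diff_null_set[OF R, of "Y n - Y (Suc n)"] Y(1,4) by simp
  qed
  have "?Z - X 0 \<in> null_sets M" by (rule null_sets_subset[OF R sets.Diff[OF Z X(1)]]) (auto simp: X_def Y0)
  then have "emeasure M (?Z - X 0) = 0" by auto
  then obtain T0 where T0: "T0 \<in> Gam" "supp M T0 \<subseteq> X 0" "AE x in M. T0 x = T x"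
    by (rule null_modification[OF T X(1)])
  \<comment> \<open>The data of the two flips are packed into nested pairs, so that one application
    of \<open>choice\<close> turns all of them into sequences.\<close>
  let ?Q = "\<lambda>n U U' q. flippable (fst (fst q)) (snd (fst q)) \<and> fst (fst q) \<union> snd (fst q) ` fst (fst q) \<subseteq> X n \<and>
      flippable (fst (snd q)) (snd (snd q)) \<and> fst (snd q) \<union> snd (snd q) ` fst (snd q) \<subseteq> X n \<and>
      (AE x in M. U x = (flip (fst (snd q)) (snd (snd q)) \<star> flip (fst (fst q)) (snd (fst q)) \<star> U') x)"
  have "\<exists>t. \<forall>n. (t n \<in> Gam \<and> supp M (t n) \<subseteq> X n \<and> (n = 0 \<longrightarrow> t n = T0)) \<and> (\<exists>q. ?Q n (t n) (t (Suc n)) q)"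
  proof (rule dependent_nat_choice)
    show "\<exists>U. U \<in> Gam \<and> supp M U \<subseteq> X 0 \<and> (0 = 0 \<longrightarrow> U = T0)" using T0 by blast
    fix U n assume U: "U \<in> Gam \<and> supp M U \<subseteq> X n \<and> (n = 0 \<longrightarrow> U = T0)"
    obtain C1 f1 C2 f2 U' where *: "flippable C1 f1" "C1 \<union> f1 ` C1 \<subseteq> X n" "flippable C2 f2" "C2 \<union> f2 ` C2 \<subseteq> X n"
      "U' \<in> Gam" "supp M U' \<subseteq> X (Suc n)" "AE x in M. U x = (flip C2 f2 \<star> flip C1 f1 \<star> U') x"
      by (rule finite_step[OF _ _ X(1,1,2) Xm]) (use U \<rho> in \<open>auto simp: \<rho>(3)\<close>)
    then have "?Q n U U' ((C1, f1), (C2, f2))" by simp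
    then show "\<exists>U'. (U' \<in> Gam \<and> supp M U' \<subseteq> X (Suc n) \<and> (Suc n = 0 \<longrightarrow> U' = T0)) \<and> (\<exists>q. ?Q n U U' q)"
      using *(5,6) by blast
  qed
  then obtain t where t': "\<forall>n. (t n \<in> Gam \<and> supp M (t n) \<subseteq> X n \<and> (n = 0 \<longrightarrow> t n = T0)) \<and> (\<exists>q. ?Q n (t n) (t (Suc n)) q)"
    by (rule exE)
  then have t: "t n \<in> Gam" "supp M (t n) \<subseteq> X n" and t0: "t 0 = T0" for n
    using spec[OF t', of n] spec[OF t', of 0] by simp_all
  have "\<forall>n. \<exists>q. ?Q n (t n) (t (Suc n)) q" using t' by blast
  from choice[OF this] obtain q where q: "\<forall>n. ?Q n (t n) (t (Suc n)) (q n)" by (rule exE)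
  define C1 f1 C2 f2 where "C1 n = fst (fst (q n))" and "f1 n = snd (fst (q n))"
    and "C2 n = fst (snd (q n))" and "f2 n = snd (snd (q n))" for n
  have fl: "flippable (C1 n) (f1 n)" "C1 n \<union> f1 n ` C1 n \<subseteq> X n" "flippable (C2 n) (f2 n)" "C2 n \<union> f2 n ` C2 n \<subseteq> X n"
    "AE x in M. t n x = (flip (C2 n) (f2 n) \<star> flip (C1 n) (f1 n) \<star> t (Suc n)) x" for n
    using spec[OF q, of n] by (simp_all add: C1_def f1_def C2_def f2_def)
  obtain P where P: "P \<in> Gam" "\<forall>n. \<forall>y\<in>X n. P (\<phi> n y) = \<phi> n (t n y)" "supp M P \<subseteq> (\<Union>n. \<phi> n ` X n)"
    by (rule glue_conjugates[OF \<phi>(1) d\<phi>(1) t])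
  have tS: "supp M (t (Suc n)) \<subseteq> X n" for n using t(2)[of "Suc n"] X(2)[of n] by blast
  obtain Q where Q: "Q \<in> Gam" "\<forall>n. \<forall>y\<in>X n. Q (\<phi> n y) = \<phi> n (t (Suc n) y)" "supp M Q \<subseteq> (\<Union>n. \<phi> n ` X n)"
    by (rule glue_conjugates[OF \<phi>(1) d\<phi>(1) t(1) tS])
  obtain D1 F1 where F1: "flippable D1 F1" "D1 \<union> F1 ` D1 \<subseteq> (\<Union>n. \<phi> n ` X n)"
    "\<forall>n. \<forall>y\<in>X n. flip D1 F1 (\<phi> n y) = \<phi> n (flip (C1 n) (f1 n) y)"
    by (rule flip_glue[OF \<phi>(1) d\<phi>(1) fl(1,2)])
  obtain D2 F2 where F2: "flippable D2 F2" "D2 \<union> F2 ` D2 \<subseteq> (\<Union>n. \<phi> n ` X n)"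
    "\<forall>n. \<forall>y\<in>X n. flip D2 F2 (\<phi> n y) = \<phi> n (flip (C2 n) (f2 n) y)"
    by (rule flip_glue[OF \<phi>(1) d\<phi>(1) fl(3,4)])
  define S where "S = flip D2 F2 \<star> flip D1 F1"
  have flG: "flip D1 F1 \<in> Gam" "flip D2 F2 \<in> Gam" using flip_Gam F1(1) F2(1) by auto
  then have S: "S \<in> Gam" by (simp add: S_def)
  \<comment> \<open>Each relation between \<open>t n\<close> and \<open>t (Suc n)\<close> may fail
    on a null set. The images of these null sets under the countably many \<open>\<phi> n\<close>
    are null too, and off them the relations combine into one.\<close>
  have AE_P: "AE x in M. P x = (S \<star> Q) x"
  proof -
    have "AE x in M. \<forall>n. t n x = (flip (C2 n) (f2 n) \<star> flip (C1 n) (f1 n) \<star> t (Suc n)) x"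
      using fl(5) by (subst AE_all_countable) blast
    then obtain B where B: "B \<in> null_sets M"
      "{x \<in> space M. \<not> (\<forall>n. t n x = (flip (C2 n) (f2 n) \<star> flip (C1 n) (f1 n) \<star> t (Suc n)) x)} \<subseteq> B"
      by (auto elim!: AE_E)
    have "\<phi> n ` (X n \<inter> B) \<in> null_sets M" for n
    proof -
      have "pw (X n \<inter> B) (\<phi> n)" using pw_subset[OF \<phi>(1)] X(1) B by auto
      moreover have "X n \<inter> B \<in> null_sets M" by (rule null_sets_subset[OF B(1)]) (use X B in auto)
      ultimately show ?thesis using pw_image pw_emeasure by (auto simp: null_sets_def)
    qed
    then have null: "(\<Union>n. \<phi> n ` (X n \<inter> B)) \<in> null_sets M" by (intro null_sets_UN)
    show ?thesis
    proof (rule AE_I'[OF null], rule subsetI, rule ccontr)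
      fix x assume "x \<in> {x \<in> space M. P x \<noteq> (S \<star> Q) x}" and nx: "x \<notin> (\<Union>n. \<phi> n ` (X n \<inter> B))"
      then have x: "x \<in> space M" "P x \<noteq> flip D2 F2 (flip D1 F1 (Q x))" using S Q flG by (auto simp: S_def)
      show False
      proof (cases "x \<in> (\<Union>n. \<phi> n ` X n)")
        case False
        then have "P x = x" "Q x = x" "flip D1 F1 x = x" "flip D2 F2 x = x"
          using supp_fix[OF P(3) x(1)] supp_fix[OF Q(3) x(1)]
            supp_fix[OF order_trans[OF supp_flip[OF F1(1)] F1(2)] x(1)]
            supp_fix[OF order_trans[OF supp_flip[OF F2(1)] F2(2)] x(1)] by blast+
        then show False using x(2) by simp
      next
        case True
        then obtain n y where y: "y \<in> X n" "x = \<phi> n y" by blast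
        then have "y \<notin> B" using nx by blast
        moreover have ys: "y \<in> space M" using sets_space[OF X(1) y(1)] .
        ultimately have "t n y = (flip (C2 n) (f2 n) \<star> flip (C1 n) (f1 n) \<star> t (Suc n)) y" using B(2) by blast
        then have ty: "t n y = flip (C2 n) (f2 n) (flip (C1 n) (f1 n) (t (Suc n) y))"
          using flip_Gam[OF fl(1)] flip_Gam[OF fl(3)] t ys by simp
        have z: "t (Suc n) y \<in> X n" "t (Suc n) y \<in> space M" using supp_mem[OF t(1) tS y(1) ys] t(1) ys by auto
        have "flip (C1 n) (f1 n) (t (Suc n) y) \<in> X n"
          by (rule supp_mem[OF flip_Gam[OF fl(1)] order_trans[OF supp_flip[OF fl(1)] fl(2)] z])
        then have "P x = flip D2 F2 (flip D1 F1 (Q x))"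
          using y z ty P(2) Q(2) F1(3) F2(3) by simp
        then show False using x(2) by simp
      qed
    qed
  qed
  have flX: "flippable (X 0) (\<phi> 0)"
  proof -
    have "X 0 \<subseteq> ?Z" by (auto simp: X_def Y0)
    then show ?thesis using \<phi>(1)[of 0] \<phi>(3)[of 0] D(2)[of 0] unfolding flippable_def by auto
  qed
  define F where "F = flip (X 0) (\<phi> 0)"
  define P0 where "P0 = F \<star> T0 \<star> iv F"
  note P0 = conj_flip[OF T0(1,2) flX, folded F_def, folded P0_def]
  have F: "F \<in> Gam" using flip_Gam[OF flX] by (simp add: F_def)
  \<comment> \<open>\<open>Q\<close> was glued over the sets \<open>X n\<close>, but
    \<open>t (Suc n)\<close> is supported in \<open>X (Suc n)\<close>; the swindle needs this
    smaller support, since only the smaller copies are shifted.\<close>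
  have QS: "supp M Q \<subseteq> (\<Union>n. \<phi> n ` X (Suc n))"
  proof
    fix x assume x: "x \<in> supp M Q"
    then obtain n y where y: "y \<in> X n" "x = \<phi> n y" using Q(3) by blast
    have "t (Suc n) y \<noteq> y" using x y Q(2) by (auto simp: supp_def)
    then have "y \<in> X (Suc n)" using supp_fix[OF t(2)[of "Suc n"] sets_space[OF X(1) y(1)]] by blast
    then show "x \<in> (\<Union>n. \<phi> n ` X (Suc n))" using y by blast
  qed
  obtain E1 g1 E2 g2 where V: "flippable E1 g1" "flippable E2 g2"
    "E1 \<union> g1 ` E1 \<union> E2 \<union> g2 ` E2 \<subseteq> (\<Union>n. \<phi> n ` X n \<union> \<psi> n ` X n)"
    "P0 = P \<star> (flip E2 g2 \<star> flip E1 g1) \<star> iv Q \<star> iv (flip E2 g2 \<star> flip E1 g1)"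
  proof (rule swindle[OF X(2) \<phi>(1) d\<phi>(1) \<phi>(2) d\<phi>(2,3) t P0(1) _ P0(3) P(1) _ P(3) Q(1) _ QS])
    show "P0 (\<phi> 0 y) = \<phi> 0 (t 0 y)" if "y \<in> X 0" for y using P0(2)[OF that] by (simp add: t0)
    show "P (\<phi> n y) = \<phi> n (t n y)" if "y \<in> X n" for n y using P(2) that by blast
    show "Q (\<phi> n y) = \<phi> n (t (Suc n) y)" if "y \<in> X (Suc n)" for n y using Q(2) X(2)[of n] that by blast
  qed
  have fin_flip: "flip A f \<in> N" if "flippable A f" "A \<subseteq> \<Omega>" for A f
  proof (rule finite_flip_in_N[OF g that(1)])
    show "emeasure M A < \<infinity>" using emeasure_mono[OF that(2) \<Omega>(1)] \<Omega>(2) by (rule le_less_trans)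
  qed
  have "(\<Union>n. \<phi> n ` X n \<union> \<psi> n ` X n) \<subseteq> \<Omega>" unfolding UN_Un_distrib using sub\<Omega> by (rule Un_least)
  with V(3) have "E1 \<union> g1 ` E1 \<union> E2 \<union> g2 ` E2 \<subseteq> \<Omega>" by (rule order_trans)
  then have E\<Omega>: "E1 \<subseteq> \<Omega>" "E2 \<subseteq> \<Omega>" by simp_all
  have D\<Omega>: "D1 \<subseteq> \<Omega>" "D2 \<subseteq> \<Omega>" using F1(2) F2(2) sub\<Omega>(1) by blast+
  define V' where "V' = flip E2 g2 \<star> flip E1 g1"
  have VN: "V' \<in> N" unfolding V'_def using fin_flip V(1,2) E\<Omega> N_mul by blast
  have SN: "S \<in> N" unfolding S_def using fin_flip F1(1) F2(1) D\<Omega> N_mul by blast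
  have QK: "Q \<in> K" by (rule K_of_subset[OF Q(1) order_trans[OF Q(3) sub\<Omega>(1)] \<Omega>])
  have V'G: "V' \<in> Gam" using VN N_in_Gam by blast
  \<comment> \<open>Inserting \<open>S \<star> Q\<close> for \<open>P\<close> into the formula for
    \<open>P0\<close> groups the factors into \<open>S\<close>, a conjugate of \<open>V'\<close> by
    \<open>Q\<close>, and \<open>iv V'\<close>, each of them in \<open>N\<close>.\<close>
  have "S \<star> (Q \<star> V' \<star> iv Q) \<star> iv V' \<in> N" using SN N_conj[OF QK VN] N_iv[OF VN] N_mul by blast
  moreover have "AE x in M. P0 x = (S \<star> (Q \<star> V' \<star> iv Q) \<star> iv V') x"
  proof -
    have z: "V' \<star> iv Q \<star> iv V' \<in> Gam" using V'G Q(1) by simp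
    show ?thesis
      using Gam_AE_apply[OF z AE_P] AE_space
    proof eventually_elim
      case (elim x)
      have "P0 x = P ((V' \<star> iv Q \<star> iv V') x)"
        unfolding V(4) V'_def[symmetric] using P(1) Q(1) V'G elim(2) by simp
      then show ?case using elim S Q(1) V'G by simp
    qed
  qed
  ultimately have "P0 \<in> N" using N_AE P0(1) by blast
  moreover have "F \<in> K"
  proof (rule K_of_subset[OF F])
    show "supp M F \<subseteq> ?Z \<union> \<Omega>"
    proof -
      have "\<phi> 0 ` X 0 \<subseteq> \<Omega>" using sub\<Omega>(1) by blast
      then show ?thesis using supp_flip[OF flX] unfolding F_def X_def Y0 by blast
    qed
    show "?Z \<union> \<Omega> \<in> sets M" using Z \<Omega> by auto
    show "emeasure M (?Z \<union> \<Omega>) < \<infinity>"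
      using emeasure_subadditive[OF Z \<Omega>(1)] fin \<Omega>(2) by (auto intro: le_less_trans)
  qed
  ultimately have "T0 \<in> N" using conj_cancel[OF P0(4)] by blast
  moreover have "AE x in M. T x = T0 x" using T0(3) by eventually_elim simp
  ultimately show ?thesis using N_AE T by blast
qed

section \<open>Elements of infinite support\<close>

lemma in_N_of_conj_flip:
  assumes "K = Gam" "T \<in> Gam" "supp M T \<subseteq> X" "flippable X f" "flip X f \<star> T \<star> iv (flip X f) \<in> N"
  shows "T \<in> N"
  using conj_cancel[OF conj_flip(4)[OF assms(2-4)] _ assms(5)] flip_Gam[OF assms(4)] assms(1) by simp

text \<open>With the constant sequence \<open>T0\<close> on infinitely many copies inside
  \<open>A - Y\<close>, the elements \<open>P\<close> and \<open>Q\<close> of the swindle coincide,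
  and a conjugate of \<open>T0\<close> becomes the commutator of \<open>P\<close> and the shift,
  both supported in \<open>A\<close>. As these may have infinite support,
  \<open>commutator_in_N\<close> is applied with \<open>K = Gam\<close>.\<close>

lemma in_N_of_wandering_infinite:
  assumes K: "K = Gam" and g: "g \<in> N" and A: "A \<in> sets M" "A \<inter> g ` A = {}"
    and T: "T \<in> Gam" "supp M T \<subseteq> Y" and Y: "Y \<in> sets M" and inf: "emeasure M (A - Y) = \<infinity>"
  shows "T \<in> N"
proof -
  have AY: "A - Y \<in> sets M" using A Y by auto
  obtain D :: "nat \<Rightarrow> 'a set" where D: "\<And>n. D n \<in> sets M" "\<And>n. D n \<subseteq> A - Y" "disjoint_family D" "\<And>n. emeasure M (D n) = \<infinity>"
    by (rule ex_disjoint_infinite_subsets[OF AY inf]) auto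
  obtain R \<phi> \<psi> where R: "R \<in> null_sets M"
    and maps: "\<forall>n. pw (Y - R) (\<phi> n) \<and> pw (Y - R) (\<psi> n) \<and> \<phi> n ` (Y - R) \<subseteq> D (2 * n) \<and> \<psi> n ` (Y - R) \<subseteq> D (2 * n + 1)"
    and dis: "disjoint_family (\<lambda>n. \<phi> n ` (Y - R))" "disjoint_family (\<lambda>n. \<psi> n ` (Y - R))"
      "\<forall>m n. \<phi> m ` (Y - R) \<inter> \<psi> n ` (Y - R) = {}"
    by (rule copies[of "\<lambda>_. Y", OF Y D(1,3)]) (simp_all add: D(4))
  define X where "X = Y - R"
  have \<phi>: "pw X (\<phi> n)" "pw X (\<psi> n)" "\<phi> n ` X \<subseteq> A - Y" "\<psi> n ` X \<subseteq> A - Y" for n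
    using spec[OF maps, of n] D(2)[of "2 * n"] D(2)[of "2 * n + 1"] by (auto simp: X_def)
  have d\<phi>: "disjoint_family (\<lambda>n. \<phi> n ` X)" "disjoint_family (\<lambda>n. \<psi> n ` X)" "\<phi> m ` X \<inter> \<psi> n ` X = {}" for m n
    using dis by (simp_all add: X_def)
  have sub: "(\<Union>n. \<phi> n ` X) \<subseteq> A" "(\<Union>n. \<psi> n ` X) \<subseteq> A"
    by (rule UN_least, use \<phi>(3,4) in blast)+
  have X: "X \<in> sets M" using Y R by (auto simp: X_def)
  have "supp M T - X \<in> null_sets M"
    by (rule null_sets_subset[OF R]) (use T(2) supp_sets[OF T(1)] X in \<open>auto simp: X_def\<close>)
  then have "emeasure M (supp M T - X) = 0" by auto
  then obtain T0 where T0: "T0 \<in> Gam" "supp M T0 \<subseteq> X" "AE x in M. T0 x = T x"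
    by (rule null_modification[OF T(1) X])
  have flX: "flippable X (\<phi> 0)" using \<phi>(1)[of 0] \<phi>(3)[of 0] by (auto simp: flippable_def X_def)
  define P0 where "P0 = flip X (\<phi> 0) \<star> T0 \<star> iv (flip X (\<phi> 0))"
  note P0 = conj_flip[OF T0(1,2) flX, folded P0_def]
  obtain P where P: "P \<in> Gam" "\<forall>n. \<forall>y\<in>X. P (\<phi> n y) = \<phi> n (T0 y)" "supp M P \<subseteq> (\<Union>n. \<phi> n ` X)"
    by (rule glue_conjugates[OF \<phi>(1) d\<phi>(1) T0(1,2)])
  obtain E1 g1 E2 g2 where V: "flippable E1 g1" "flippable E2 g2"
    "E1 \<union> g1 ` E1 \<union> E2 \<union> g2 ` E2 \<subseteq> (\<Union>n. \<phi> n ` X \<union> \<psi> n ` X)"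
    "P0 = P \<star> (flip E2 g2 \<star> flip E1 g1) \<star> iv P \<star> iv (flip E2 g2 \<star> flip E1 g1)"
  proof (rule swindle[of "\<lambda>_. X", OF _ \<phi>(1) d\<phi>(1) \<phi>(2) d\<phi>(2,3) T0(1,2) P0(1,2,3) P(1) _ P(3) P(1) _ P(3)])
    show "P (\<phi> n y) = \<phi> n (T0 y)" "P (\<phi> n y) = \<phi> n (T0 y)" if "y \<in> X" for n y using P(2) that by blast+
  qed auto
  have "(\<Union>n. \<phi> n ` X \<union> \<psi> n ` X) \<subseteq> A" unfolding UN_Un_distrib using sub by (rule Un_least)
  with V(3) have "E1 \<union> g1 ` E1 \<union> E2 \<union> g2 ` E2 \<subseteq> A" by (rule order_trans)
  then have EA: "E1 \<union> g1 ` E1 \<subseteq> A" "E2 \<union> g2 ` E2 \<subseteq> A" by simp_all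
  have G: "flip E1 g1 \<in> Gam" "flip E2 g2 \<in> Gam" using V flip_Gam by auto
  have "supp M (flip E2 g2 \<star> flip E1 g1) \<subseteq> A"
    using supp_mul[OF G(2,1)] order_trans[OF supp_flip[OF V(1)] EA(1)] order_trans[OF supp_flip[OF V(2)] EA(2)] by blast
  then have "P0 \<in> N"
    unfolding V(4) using G P sub(1) by (intro commutator_in_N[OF g A]) (auto simp: K)
  then have "T0 \<in> N" unfolding P0_def by (rule in_N_of_conj_flip[OF K T0(1,2) flX])
  moreover have "AE x in M. T x = T0 x" using T0(3) by eventually_elim simp
  ultimately show ?thesis using N_AE T by blast
qed

text \<open>The wandering set \<open>A\<close> has infinite measure. If \<open>A - Y\<close> has
  not, then \<open>A \<inter> Y\<close> has, and a flip moves the support of \<open>T\<close>, up to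
  a null set, into the complement of \<open>Y\<close>, so that infinitely much of \<open>A\<close>
  lies off the new support.\<close>

lemma coinfinite_in_N:
  assumes K: "K = Gam" and g: "g \<in> N" "emeasure M (supp M g) = \<infinity>"
    and T: "T \<in> Gam" "supp M T \<subseteq> Y" and Y: "Y \<in> sets M" and inf: "emeasure M (space M - Y) = \<infinity>"
  shows "T \<in> N"
proof -
  obtain A where A: "A \<in> sets M" "A \<inter> g ` A = {}" "emeasure M (supp M g) \<le> 3 * emeasure M A"
    by (rule wandering[OF N_in_Gam[OF g(1)]])
  have Ainf: "emeasure M A = \<infinity>"
  proof (rule ccontr)
    assume "emeasure M A \<noteq> \<infinity>"
    then have "3 * emeasure M A < \<infinity>" by (simp add: ennreal_mult_less_top less_top)
    then show False using A(3) g(2) by simp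
  qed
  show ?thesis
  proof (cases "emeasure M (A - Y) = \<infinity>")
    case True
    then show ?thesis by (rule in_N_of_wandering_infinite[OF K g(1) A(1,2) T Y])
  next
    case False
    have "emeasure M A = emeasure M (A \<inter> Y) + emeasure M (A - Y)"
      using A(1) Y by (subst plus_emeasure) (auto simp: Int_Diff_Un)
    then have "emeasure M (A \<inter> Y) + emeasure M (A - Y) = \<infinity>" using Ainf by simp
    then have AY: "emeasure M (A \<inter> Y) = \<infinity>" using False by (simp add: ennreal_add_eq_top)
    have le: "emeasure M Y \<le> emeasure M (space M - Y)" using inf by simp
    obtain C k where k: "pw C k" "C \<subseteq> Y" "emeasure M (Y - C) = 0" "k ` C \<subseteq> space M - Y"
      by (rule embed[OF Y _ le]) (use Y in auto)
    have C: "C \<in> sets M" "k ` C \<in> sets M" using pw_sets[OF k(1)] pw_image[OF k(1)] .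
    have fl: "flippable C k" using k by (auto simp: flippable_def)
    have "Y - C \<in> null_sets M" using k(3) Y C by auto
    then have "supp M T - C \<in> null_sets M"
      by (rule null_sets_subset) (use T(2) supp_sets[OF T(1)] C in auto)
    then have "emeasure M (supp M T - C) = 0" by auto
    then obtain T0 where T0: "T0 \<in> Gam" "supp M T0 \<subseteq> C" "AE x in M. T0 x = T x"
      by (rule null_modification[OF T(1) C(1)])
    note cf = conj_flip[OF T0(1,2) fl]
    have "emeasure M (A \<inter> Y) \<le> emeasure M (A - k ` C)"
      using A(1) C k(4) by (intro emeasure_mono) auto
    then have "emeasure M (A - k ` C) = \<infinity>" using AY by (simp add: top_unique)
    then have "flip C k \<star> T0 \<star> iv (flip C k) \<in> N"
      by (rule in_N_of_wandering_infinite[OF K g(1) A(1,2) cf(1,3) C(2)])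
    then have "T0 \<in> N" by (rule in_N_of_conj_flip[OF K T0(1,2) fl])
    moreover have "AE x in M. T x = T0 x" using T0(3) by eventually_elim simp
    ultimately show ?thesis using N_AE T by blast
  qed
qed

text \<open>\<open>T\<close> is the product of \<open>S\<close>, two flips that reproduce
  \<open>T\<close> on a set \<open>C'\<close> of infinite measure, and of
  \<open>iv S \<star> T\<close>, which fixes \<open>C'\<close> pointwise. Each of these three
  elements fixes a set of infinite measure pointwise, so \<open>coinfinite_in_N\<close> applies to
  all of them.\<close>

lemma all_in_N:
  assumes K: "K = Gam" and g: "g \<in> N" "emeasure M (supp M g) = \<infinity>" and T: "T \<in> Gam"
  shows "T \<in> N"
proof -
  obtain P :: "nat \<Rightarrow> 'a set" where P: "\<And>n. P n \<in> sets M" "\<And>n. P n \<subseteq> space M" "disjoint_family P" "\<And>n. emeasure M (P n) = \<infinity>"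
    by (rule ex_disjoint_infinite_subsets[OF sets.top infinite_measure]) auto
  have dis: "P 0 \<inter> P 1 = {}" "P 0 \<inter> P 2 = {}" "P 1 \<inter> P 2 = {}" using P(3) by (auto simp: disjoint_family_on_def)
  let ?V = "P 0 \<inter> (T -` P 1 \<inter> space M)"
  have V: "?V \<in> sets M" using P T by (intro sets.Int Gam_vimage) auto
  \<comment> \<open>If infinitely much of \<open>P 0\<close> is sent into \<open>P 1\<close>, that
    part and its image both miss \<open>P 2\<close>. Otherwise the rest of \<open>P 0\<close> is
    infinite, and it and its image miss \<open>P 1\<close>.\<close>
  obtain C j where C: "C \<in> sets M" "emeasure M C = \<infinity>" "C \<inter> P j = {}" "T ` C \<inter> P j = {}"
  proof (cases "emeasure M ?V = \<infinity>")
    case True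
    then show ?thesis by (intro that[of ?V 2]) (use V dis in auto)
  next
    case False
    have "emeasure M (P 0) = emeasure M ?V + emeasure M (P 0 - ?V)"
      using P(1) V by (subst plus_emeasure) (auto simp: Un_absorb1)
    then have "emeasure M ?V + emeasure M (P 0 - ?V) = \<infinity>" using P(4)[of 0] by simp
    then have "emeasure M (P 0 - ?V) = \<infinity>" using False by (simp add: ennreal_add_eq_top)
    then show ?thesis by (intro that[of "P 0 - ?V" 1]) (use V P dis sets_space[OF P(1)] in auto)
  qed
  \<comment> \<open>\<open>L 0\<close> takes the intermediate stop of the two flips, while
    \<open>L 1\<close> is kept untouched by both.\<close>
  obtain L :: "nat \<Rightarrow> 'a set" where L: "\<And>n. L n \<in> sets M" "\<And>n. L n \<subseteq> P j" "disjoint_family L" "\<And>n. emeasure M (L n) = \<infinity>"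
    by (rule ex_disjoint_infinite_subsets[OF P(1)[of j] P(4)[of j]]) auto
  have L01: "L 0 \<inter> L 1 = {}" using L(3) by (auto simp: disjoint_family_on_def)
  have le: "emeasure M C \<le> emeasure M (L 0)" using L(4) by simp
  obtain C' k where k: "pw C' k" "C' \<subseteq> C" "emeasure M (C - C') = 0" "k ` C' \<subseteq> L 0"
    by (rule embed[OF C(1) L(1) le])
  have C': "C' \<in> sets M" using pw_sets[OF k(1)] .
  have "emeasure M C' = \<infinity>"
  proof -
    have "C - C' \<in> null_sets M" using k(3) C(1) C' by auto
    then have "emeasure M (C' \<union> (C - C')) = emeasure M C'" using C' by (intro emeasure_Un_null_set)
    then show ?thesis using k(2) C(2) by (simp add: Un_absorb1)
  qed
  have kP: "k ` C' \<subseteq> P j" using k(4) L(2) by blast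
  have disj: "k ` C' \<inter> C' = {}" "k ` C' \<inter> T ` C' = {}" using kP k(2) C(3,4) by blast+
  obtain f where f: "flippable C' k" "flippable (k ` C') f" "f ` k ` C' = T ` C'"
    "\<forall>x\<in>C'. (flip (k ` C') f \<star> flip C' k) x = T x"
    by (rule two_flips[OF T k(1) disj]) auto
  have G: "flip C' k \<in> Gam" "flip (k ` C') f \<in> Gam" using f flip_Gam by auto
  let ?Y = "space M - L 1"
  have Yinf: "emeasure M (space M - ?Y) = \<infinity>"
  proof -
    have "space M - ?Y = L 1" using sets_space[OF L(1)] by auto
    then show ?thesis using L(4) by simp
  qed
  have CS: "C' \<subseteq> ?Y" "k ` C' \<subseteq> ?Y" "T ` C' \<subseteq> ?Y"
  proof -
    show "C' \<subseteq> ?Y" using k(2) C(3) L(2)[of 1] sets_space[OF C(1)] by blast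
    show "k ` C' \<subseteq> ?Y" using k(4) L01 sets_space[OF L(1)] by blast
    show "T ` C' \<subseteq> ?Y" using k(2) C(4) L(2)[of 1] sets_space[OF Gam_image[OF T C(1)]] by blast
  qed
  have N1: "flip C' k \<in> N"
    by (rule coinfinite_in_N[OF K g G(1) order_trans[OF supp_flip[OF f(1)] Un_least[OF CS(1,2)]] _ Yinf]) (use L in auto)
  have "flip (k ` C') f \<in> N"
    by (rule coinfinite_in_N[OF K g G(2) order_trans[OF supp_flip[OF f(2)] Un_least[OF CS(2) CS(3)[folded f(3)]]] _ Yinf]) (use L in auto)
  then have SN: "flip (k ` C') f \<star> flip C' k \<in> N" using N1 by (rule N_mul)
  define S where "S = flip (k ` C') f \<star> flip C' k"
  have S: "S \<in> Gam" "S \<in> N" using G SN by (simp_all add: S_def)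
  have "supp M (iv S \<star> T) \<subseteq> space M - C'"
    by (rule supp_iv_mul_fixed[OF S(1) T]) (use f(4) in \<open>auto simp: S_def supp_def\<close>)
  moreover have "space M - (space M - C') = C'" using sets_space[OF C'] by auto
  ultimately have "iv S \<star> T \<in> N"
    using S T C' \<open>emeasure M C' = \<infinity>\<close> by (intro coinfinite_in_N[OF K g, of "iv S \<star> T" "space M - C'"]) auto
  then have "S \<star> (iv S \<star> T) \<in> N" using S(2) N_mul by blast
  moreover have "S \<star> (iv S \<star> T) = T" by (rule Gam_eqI) (use S T in auto)
  ultimately show ?thesis by simp
qed

end

section \<open>Passing to the quotient\<close>

context ergodic_full_group
begin

lemma emeasure_supp_cong:
  assumes "S \<in> Gam" "T \<in> Gam" "AE x in M. S x = T x"
  shows "emeasure M (supp M S) = emeasure M (supp M T)"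
proof (rule emeasure_eq_AE)
  show "AE x in M. x \<in> supp M S \<longleftrightarrow> x \<in> supp M T"
    using assms(3) by eventually_elim (simp add: supp_def)
qed (use assms supp_sets in auto)

lemma cls_eq_one_iff: "T \<in> Gam \<Longrightarrow> cls M T = \<one>\<^bsub>Aut M\<^esub> \<longleftrightarrow> emeasure M (supp M T) = 0"
proof
  assume T: "T \<in> Gam" and "cls M T = \<one>\<^bsub>Aut M\<^esub>"
  then have "T \<in> cls M idm" using mem_cls_iff[OF Gam_mp[OF T], of T] Gam_mp[OF T] by simp
  then have "AE x in M. T x = idm x" using mem_cls_iff[OF Gam_mp[OF Gam_one]] by simp
  then have "emeasure M (supp M T) = emeasure M (supp M idm)" by (rule emeasure_supp_cong[OF T Gam_one])
  moreover have "supp M idm = {}" by (auto simp: supp_def)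
  ultimately show "emeasure M (supp M T) = 0" by simp
next
  assume T: "T \<in> Gam" and "emeasure M (supp M T) = 0"
  then have "supp M T \<in> null_sets M" using supp_sets by (auto simp: null_sets_def)
  then have "AE x in M. T x = idm x" by (rule AE_I') (auto simp: supp_def)
  then have "cls M T = cls M idm" by (rule cls_eqI[OF Gam_mp[OF T] Gam_mp[OF Gam_one]])
  then show "cls M T = \<one>\<^bsub>Aut M\<^esub>" by simp
qed

lemma cls_finite_supp_iff: "T \<in> Gam \<Longrightarrow> cls M T \<in> finite_supp_part M G \<longleftrightarrow> emeasure M (supp M T) < \<infinity>"
proof -
  assume T: "T \<in> Gam"
  have eq: "emeasure M (supp M S) = emeasure M (supp M T)" if "S \<in> cls M T" for S
  proof -
    have S: "S \<in> mp_bijections M" "AE x in M. S x = T x" using that mem_cls_iff[OF Gam_mp[OF T]] by auto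
    show ?thesis by (rule emeasure_supp_cong[OF Gam_AE[OF T S] T S(2)])
  qed
  have mem: "T \<in> cls M T" using mem_cls_iff[OF Gam_mp[OF T]] Gam_mp[OF T] by simp
  have "cls M T \<in> G" using T by (simp add: Gam_iff)
  then have "cls M T \<in> finite_supp_part M G \<longleftrightarrow> (\<forall>S\<in>cls M T. emeasure M (supp M S) < \<infinity>)"
    by (simp add: finite_supp_part_def)
  also have "\<dots> \<longleftrightarrow> (\<forall>S\<in>cls M T. emeasure M (supp M T) < \<infinity>)" by (rule ball_cong[OF refl]) (simp only: eq)
  also have "\<dots> \<longleftrightarrow> emeasure M (supp M T) < \<infinity>" using mem by blast
  finally show ?thesis .
qed

lemma finite_supp_part_subset: "finite_supp_part M G \<subseteq> G"
  by (auto simp: finite_supp_part_def)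

lemma G_cases:
  assumes "t \<in> G"
  obtains T where "T \<in> Gam" "t = cls M T"
  using assms G_eq by auto

lemma cls_mul: "S \<in> Gam \<Longrightarrow> T \<in> Gam \<Longrightarrow> cls M S \<otimes>\<^bsub>Aut M\<^esub> cls M T = cls M (S \<star> T)"
  and cls_iv: "T \<in> Gam \<Longrightarrow> inv\<^bsub>Aut M\<^esub> (cls M T) = cls M (iv T)"
  using cl.hom_mult cl.hom_inv Gam_carrier by auto

lemma subgroup_finite_supp_part: "subgroup (finite_supp_part M G) (Aut M)"
proof
  show "finite_supp_part M G \<subseteq> carrier (Aut M)"
    using finite_supp_part_subset subgroup.subset[OF subgroup_G] by blast
  have "supp M idm = {}" by (auto simp: supp_def)
  then show "\<one>\<^bsub>Aut M\<^esub> \<in> finite_supp_part M G" using cls_finite_supp_iff[OF Gam_one] by simp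
next
  fix s t assume st: "s \<in> finite_supp_part M G" "t \<in> finite_supp_part M G"
  then have "s \<in> G" "t \<in> G" using finite_supp_part_subset by auto
  then obtain S T where S: "S \<in> Gam" "s = cls M S" and T: "T \<in> Gam" "t = cls M T"
    by (auto elim!: G_cases)
  have "emeasure M (supp M (S \<star> T)) \<le> emeasure M (supp M S \<union> supp M T)"
    using S T supp_mul supp_sets by (intro emeasure_mono) auto
  also have "\<dots> \<le> emeasure M (supp M S) + emeasure M (supp M T)"
    using S T supp_sets by (intro emeasure_subadditive)
  also have "\<dots> < \<infinity>" using st S T cls_finite_supp_iff by auto
  finally show "s \<otimes>\<^bsub>Aut M\<^esub> t \<in> finite_supp_part M G"
    using S T cls_finite_supp_iff[of "S \<star> T"] by (simp add: cls_mul)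
next
  fix t assume t: "t \<in> finite_supp_part M G"
  then have "t \<in> G" using finite_supp_part_subset by auto
  then obtain T where T: "T \<in> Gam" "t = cls M T" by (rule G_cases)
  then show "inv\<^bsub>Aut M\<^esub> t \<in> finite_supp_part M G"
    using t cls_finite_supp_iff[of T] cls_finite_supp_iff[of "iv T"] by (simp add: cls_iv supp_iv)
qed

lemma subgroup_group_Aut: "subgroup L (Aut M) \<Longrightarrow> group ((Aut M)\<lparr>carrier := L\<rparr>)"
  by (rule subgroup.subgroup_is_group[OF _ group_Aut])

lemma inv_restricted: "subgroup L (Aut M) \<Longrightarrow> x \<in> L \<Longrightarrow> inv\<^bsub>(Aut M)\<lparr>carrier := L\<rparr>\<^esub> x = inv\<^bsub>Aut M\<^esub> x"
  by (rule group.m_inv_consistent[OF group_Aut])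

text \<open>The support of a conjugate is the image of the support under a measure preserving
  map.\<close>

lemma normal_finite_supp_part: "finite_supp_part M G \<lhd> (Aut M)\<lparr>carrier := G\<rparr>"
proof -
  interpret GG: group "(Aut M)\<lparr>carrier := G\<rparr>" by (rule subgroup_group_Aut[OF subgroup_G])
  have "subgroup (finite_supp_part M G) ((Aut M)\<lparr>carrier := G\<rparr>)"
    by (rule group.subgroup_incl[OF group_Aut subgroup_finite_supp_part subgroup_G finite_supp_part_subset])
  moreover have "x \<otimes>\<^bsub>Aut M\<^esub> t \<otimes>\<^bsub>Aut M\<^esub> inv\<^bsub>Aut M\<^esub> x \<in> finite_supp_part M G"
    if x: "x \<in> G" and t: "t \<in> finite_supp_part M G" for x t
  proof -
    obtain X where X: "X \<in> Gam" "x = cls M X" using x by (rule G_cases)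
    have "t \<in> G" using t finite_supp_part_subset by auto
    then obtain T where T: "T \<in> Gam" "t = cls M T" by (rule G_cases)
    have "emeasure M (supp M (X \<star> T \<star> iv X)) = emeasure M (supp M T)"
      using X T supp_conj[of X T] supp_sets[of T] by simp
    also have "\<dots> < \<infinity>" using t T cls_finite_supp_iff by simp
    finally show ?thesis using X T cls_finite_supp_iff[of "X \<star> T \<star> iv X"] by (simp add: cls_mul cls_iv)
  qed
  ultimately show ?thesis
    unfolding GG.normal_inv_iff by (simp add: inv_restricted[OF subgroup_G])
qed

text \<open>The group \<open>L\<close> will be either \<open>G\<close> or its finite support part;
  the conditions on representatives hold because \<open>cls\<close> is a homomorphism.\<close>

lemma invariant_subgroup_of_normal:
  assumes L: "subgroup L (Aut M)" "L \<subseteq> G" "finite_supp_part M G \<subseteq> L"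
    and H: "H \<lhd> (Aut M)\<lparr>carrier := L\<rparr>"
  shows "invariant_subgroup M G {T \<in> Gam. cls M T \<in> L} {T \<in> Gam. cls M T \<in> H}"
proof -
  interpret LL: group "(Aut M)\<lparr>carrier := L\<rparr>" by (rule subgroup_group_Aut[OF L(1)])
  have sub: "subgroup H ((Aut M)\<lparr>carrier := L\<rparr>)"
    and conj: "\<And>x h. x \<in> L \<Longrightarrow> h \<in> H \<Longrightarrow> x \<otimes>\<^bsub>Aut M\<^esub> h \<otimes>\<^bsub>Aut M\<^esub> inv\<^bsub>Aut M\<^esub> x \<in> H"
    using H unfolding LL.normal_inv_iff by (auto simp: inv_restricted[OF L(1)])
  have HL: "H \<subseteq> L" using subgroup.subset[OF sub] by simp
  have mul: "\<And>x y. x \<in> H \<Longrightarrow> y \<in> H \<Longrightarrow> x \<otimes>\<^bsub>Aut M\<^esub> y \<in> H" using subgroup.m_closed[OF sub] by simp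
  have inv: "inv\<^bsub>Aut M\<^esub> x \<in> H" if "x \<in> H" for x
    using subgroup.m_inv_closed[OF sub that] inv_restricted[OF L(1), of x] HL that by auto
  show ?thesis
  proof unfold_locales
    show "{T \<in> Gam. cls M T \<in> L} \<subseteq> Gam" "{T \<in> Gam. cls M T \<in> H} \<subseteq> Gam" by auto
    show "iv k \<in> {T \<in> Gam. cls M T \<in> L}" if "k \<in> {T \<in> Gam. cls M T \<in> L}" for k
      using that subgroup.m_inv_closed[OF L(1), of "cls M k"] by (simp add: cls_iv)
    show "T \<in> {T \<in> Gam. cls M T \<in> L}" if "T \<in> Gam" "emeasure M (supp M T) < \<infinity>" for T
      using that cls_finite_supp_iff L(3) by auto
    show "S \<star> T \<in> {T \<in> Gam. cls M T \<in> H}" if "S \<in> {T \<in> Gam. cls M T \<in> H}" "T \<in> {T \<in> Gam. cls M T \<in> H}" for S T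
      using that mul[of "cls M S" "cls M T"] by (simp add: cls_mul)
    show "iv T \<in> {T \<in> Gam. cls M T \<in> H}" if "T \<in> {T \<in> Gam. cls M T \<in> H}" for T
      using that inv[of "cls M T"] by (simp add: cls_iv)
    show "S \<in> {T \<in> Gam. cls M T \<in> H}" if "T \<in> {T \<in> Gam. cls M T \<in> H}" "S \<in> Gam" "AE x in M. S x = T x" for S T
      using that cls_eqI[OF Gam_mp Gam_mp, of S T] by simp
    show "k \<star> T \<star> iv k \<in> {T \<in> Gam. cls M T \<in> H}"
      if "k \<in> {T \<in> Gam. cls M T \<in> L}" "T \<in> {T \<in> Gam. cls M T \<in> H}" for k T
      using that conj[of "cls M k" "cls M T"] by (simp add: cls_mul cls_iv)
  qed
qed

section \<open>Nontriviality and the list of normal subgroups\<close>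

text \<open>The value \<open>c = 1\<close> shows that the finite support part is nontrivial, and
  \<open>c = \<infinity>\<close> that it is not all of \<open>G\<close>; the upper bound provides
  finiteness in the first case. The witness exchanges two disjoint sets of measure
  \<open>c\<close>.\<close>

lemma ex_flip_emeasure:
  fixes c :: ennreal
  obtains T where "T \<in> Gam" "c \<le> emeasure M (supp M T)" "emeasure M (supp M T) \<le> c + c"
proof -
  obtain P :: "nat \<Rightarrow> 'a set" where P: "\<And>n. P n \<in> sets M" "\<And>n. P n \<subseteq> space M" "disjoint_family P" "\<And>n. emeasure M (P n) = \<infinity>"
    by (rule ex_disjoint_infinite_subsets[OF sets.top infinite_measure]) auto
  have dis: "P 0 \<inter> P 1 = {}" using P(3) by (auto simp: disjoint_family_on_def)
  obtain B where B: "B \<in> sets M" "B \<subseteq> P 0" "emeasure M B = c"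
  proof (cases "c < \<infinity>")
    case True
    obtain B where "B \<in> sets M" "B \<subseteq> P 0" "emeasure M B = c"
      by (rule ex_subset_emeasure[OF P(1)[of 0] _ True]) (use P(4) in simp)
    then show ?thesis by (rule that)
  next
    case False
    then have "c = \<infinity>" by (simp add: not_less top_unique)
    then show ?thesis using P(1,4) by (intro that[of "P 0"]) simp_all
  qed
  have le: "emeasure M B \<le> emeasure M (P 1)" using P(4) by simp
  obtain C k where k: "pw C k" "C \<subseteq> B" "emeasure M (B - C) = 0" "k ` C \<subseteq> P 1"
    by (rule embed[OF B(1) P(1) le])
  have C: "C \<in> sets M" "k ` C \<in> sets M" using pw_sets[OF k(1)] pw_image[OF k(1)] .
  have "B - C \<in> null_sets M" using k(3) B(1) C by auto
  then have "emeasure M (C \<union> (B - C)) = emeasure M C" using C by (intro emeasure_Un_null_set)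
  then have Cc: "emeasure M C = c" using k(2) B(3) by (simp add: Un_absorb1)
  have disj: "C \<inter> k ` C = {}" using k(2,4) B(2) dis by blast
  then have fl: "flippable C k" using k(1) by (simp add: flippable_def)
  have G: "flip C k \<in> Gam" by (rule flip_Gam[OF fl])
  have "C \<subseteq> supp M (flip C k)"
  proof
    fix x assume x: "x \<in> C"
    then have "k x \<noteq> x" using disj by force
    then show "x \<in> supp M (flip C k)" using x flip_on[OF fl x] sets_space[OF C(1) x] by (simp add: supp_def)
  qed
  then have "c \<le> emeasure M (supp M (flip C k))" using emeasure_mono[OF _ supp_sets[OF G]] Cc by metis
  moreover have "emeasure M (supp M (flip C k)) \<le> emeasure M (C \<union> k ` C)"
    using supp_flip[OF fl] C by (intro emeasure_mono) auto
  then have "emeasure M (supp M (flip C k)) \<le> c + c"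
    using emeasure_subadditive[OF C] pw_emeasure[OF k(1)] Cc by (metis order_trans)
  ultimately show ?thesis by (rule that[OF G])
qed

lemma finite_supp_part_ne_one: "finite_supp_part M G \<noteq> {\<one>\<^bsub>Aut M\<^esub>}"
proof -
  obtain T where T: "T \<in> Gam" "1 \<le> emeasure M (supp M T)" "emeasure M (supp M T) \<le> 1 + 1"
    by (rule ex_flip_emeasure[of 1])
  have "emeasure M (supp M T) < \<infinity>" using T(3) by (rule le_less_trans) simp
  then have "cls M T \<in> finite_supp_part M G" using cls_finite_supp_iff[OF T(1)] by simp
  moreover have "cls M T \<noteq> \<one>\<^bsub>Aut M\<^esub>" using cls_eq_one_iff[OF T(1)] T(2) by auto
  ultimately show ?thesis by blast
qed

lemma finite_supp_part_ne: "finite_supp_part M G \<noteq> G"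
proof -
  obtain T where T: "T \<in> Gam" "\<infinity> \<le> emeasure M (supp M T)"
    by (rule ex_flip_emeasure[of \<infinity>])
  then have "cls M T \<notin> finite_supp_part M G" using cls_finite_supp_iff[OF T(1)] by (simp add: top_unique)
  moreover have "cls M T \<in> G" using T Gam_iff by blast
  ultimately show ?thesis by blast
qed

text \<open>With \<open>L = finite_supp_part M G\<close> this gives simplicity, and with
  \<open>L = G\<close> the lower bound for normal subgroups of \<open>G\<close>.\<close>

lemma normal_contains_finite_supp_part:
  assumes L: "subgroup L (Aut M)" "L \<subseteq> G" "finite_supp_part M G \<subseteq> L"
    and H: "H \<lhd> (Aut M)\<lparr>carrier := L\<rparr>" "H \<noteq> {\<one>\<^bsub>Aut M\<^esub>}"
  shows "H \<subseteq> L" "finite_supp_part M G \<subseteq> H"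
proof -
  interpret I: invariant_subgroup M G "{T \<in> Gam. cls M T \<in> L}" "{T \<in> Gam. cls M T \<in> H}"
    by (rule invariant_subgroup_of_normal[OF L H(1)])
  have sub: "subgroup H ((Aut M)\<lparr>carrier := L\<rparr>)" using H(1) by (rule normal_imp_subgroup)
  show HL: "H \<subseteq> L" using subgroup.subset[OF sub] by simp
  have "\<one>\<^bsub>Aut M\<^esub> \<in> H" using subgroup.one_closed[OF sub] by simp
  then obtain t where t: "t \<in> H" "t \<noteq> \<one>\<^bsub>Aut M\<^esub>" using H(2) by blast
  then have "t \<in> G" using HL L(2) by blast
  then obtain g where g: "g \<in> Gam" "t = cls M g" by (rule G_cases)
  then have g': "g \<in> {T \<in> Gam. cls M T \<in> H}" "0 < emeasure M (supp M g)"
    using t cls_eq_one_iff[OF g(1)] by (auto simp: zero_less_iff_neq_zero)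
  show "finite_supp_part M G \<subseteq> H"
  proof
    fix s assume s: "s \<in> finite_supp_part M G"
    then have "s \<in> G" using finite_supp_part_subset by blast
    then obtain S where S: "S \<in> Gam" "s = cls M S" by (rule G_cases)
    then have "S \<in> {T \<in> Gam. cls M T \<in> H}" using s cls_finite_supp_iff by (intro I.finite_in_N[OF g']) auto
    then show "s \<in> H" using S by simp
  qed
qed

text \<open>Such an \<open>H\<close> contains the class of an element of infinite support, so that
  \<open>all_in_N\<close> applies.\<close>

lemma normal_eq_whole:
  assumes H: "H \<lhd> (Aut M)\<lparr>carrier := G\<rparr>" and not: "\<not> H \<subseteq> finite_supp_part M G"
  shows "H = G"
proof -
  interpret I: invariant_subgroup M G "{T \<in> Gam. cls M T \<in> G}" "{T \<in> Gam. cls M T \<in> H}"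
    by (rule invariant_subgroup_of_normal[OF subgroup_G order_refl finite_supp_part_subset H])
  have sub: "H \<subseteq> G" using subgroup.subset[OF normal_imp_subgroup[OF H]] by simp
  obtain t where t: "t \<in> H" "t \<notin> finite_supp_part M G" using not by blast
  then have "t \<in> G" using sub by blast
  then obtain g where g: "g \<in> Gam" "t = cls M g" by (rule G_cases)
  then have g': "g \<in> {T \<in> Gam. cls M T \<in> H}" "emeasure M (supp M g) = \<infinity>"
    using t cls_finite_supp_iff[OF g(1)] by (simp_all add: not_less top_unique)
  have eq: "{T \<in> Gam. cls M T \<in> G} = Gam" using Gam_iff by blast
  have "G \<subseteq> H"
  proof
    fix s assume "s \<in> G"
    then obtain S where S: "S \<in> Gam" "s = cls M S" by (rule G_cases)
    then show "s \<in> H" using I.all_in_N[OF eq g' S(1)] by simp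
  qed
  then show ?thesis using sub by blast
qed

end

theorem theorem6:
  fixes M :: "'a measure" and G :: "('a \<Rightarrow> 'a) set set"
  assumes "standard_sigma_finite_space M"
    and "full_group M G"
    and "ergodic M G"
  shows "simple_grp ((Aut M)\<lparr>carrier := finite_supp_part M G\<rparr>) \<and>
    {H. H \<lhd> (Aut M)\<lparr>carrier := G\<rparr> \<and> H \<noteq> {\<one>\<^bsub>Aut M\<^esub>} \<and> H \<noteq> G} = {finite_supp_part M G}"
proof -
  interpret ergodic_full_group M G
    using assms by (intro ergodic_full_group.intro ergodic_full_group_axioms.intro)
  let ?F = "finite_supp_part M G"
  have "H = {\<one>\<^bsub>Aut M\<^esub>} \<or> H = ?F" if "H \<lhd> (Aut M)\<lparr>carrier := ?F\<rparr>" for H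
    using normal_contains_finite_supp_part[OF subgroup_finite_supp_part finite_supp_part_subset order_refl that] by blast
  then have "simple_grp ((Aut M)\<lparr>carrier := ?F\<rparr>)"
    using subgroup_group_Aut[OF subgroup_finite_supp_part] finite_supp_part_ne_one by (simp add: simple_grp_def)
  \<comment> \<open>A nontrivial normal subgroup contains \<open>?F\<close>; if it were not also
    contained in \<open>?F\<close>, it would be all of \<open>G\<close>.\<close>
  moreover have "H = ?F" if "H \<lhd> (Aut M)\<lparr>carrier := G\<rparr>" "H \<noteq> {\<one>\<^bsub>Aut M\<^esub>}" "H \<noteq> G" for H
    using normal_contains_finite_supp_part(2)[OF subgroup_G order_refl finite_supp_part_subset that(1,2)]
      normal_eq_whole[OF that(1)] that(3) by blast
  ultimately show ?thesis
    using normal_finite_supp_part finite_supp_part_ne_one finite_supp_part_ne by blast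
qed

end
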